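(* Let $(A,\cdot,\Delta)$ be a finite-dimensional anti-Leibniz bialgebra and $(C=\oplus_{i\in\mathbb{Z}}C_i,\varpi)$ a quadratic $\mathbb{Z}$-graded commutative associative algebra. Let $\mathcal{A}:=A\otimes C$, graded by $\mathcal{A}_i=A\otimes C_i$, with product $(a_1\otimes c_1)\diamond(a_2\otimes c_2)=(a_1a_2)\otimes(c_1c_2)$; let $\bar{\Delta}:C\to C\,\hat{\otimes}\,C$ be the linear map determined by $\bar{\varpi}(\bar{\Delta}(c_1),c_2\otimes c_3)=\varpi(c_1,c_2c_3)$ for all $c_1,c_2,c_3\in C$; and let $\hat{\Delta}:\mathcal{A}\to\mathcal{A}\,\hat{\otimes}\,\mathcal{A}$ be the linear map $$\hat{\Delta}(a\otimes c)=\Delta(a)\bullet\bar{\Delta}(c)=\sum_{(a)}\sum_{i,j,\alpha}(a_{(1)}\otimes c_{1,i,\alpha})\otimes(a_{(2)}\otimes c_{2,j,\alpha}),$$ where $\Delta(a)=\sum_{(a)}a_{(1)}\otimes a_{(2)}$ and $\bar{\Delta}(c)=\sum_{i,j,\alpha}c_{1,i,\alpha}\otimes c_{2,j,\alpha}$. Then $(\mathcal{A},\diamond,\hat{\Delta})$ is a completed anti-Leibniz bialgebra. Furthermore, let $A$ be a finite-dimensional vector space with a bilinear product $\cdot$ and a linear map $\Delta:A\to A\otimes A$, and let $(C,\varpi)$ be the quadratic $\mathbb{Z}$-graded Laurent polynomial algebra $(\Bbbk[\mathfrak{t},\mathfrak{t}^{-1}],\varpi)$, $\varpi(\mathfrak{t}^i,\mathfrak{t}^j)=\delta_{i+j,0}$.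 Then $(\mathcal{A},\diamond,\hat{\Delta})$, constructed by the same formulas, is a completed anti-Leibniz bialgebra if and only if $(A,\cdot,\Delta)$ is an anti-Leibniz bialgebra.
   Context: $\Bbbk$ is a field of characteristic zero, $\otimes=\otimes_\Bbbk$, $\tau(a\otimes b)=b\otimes a$. For an algebra $A$, $\mathbf{l}_A(a)(b)=ab$, $\mathbf{r}_A(a)(b)=ba$. Anti-Leibniz algebra: $a_1(a_2a_3)+(a_1a_2)a_3+a_2(a_1a_3)=0$. Anti-Leibniz bialgebra: $(A,\cdot,\Delta)$ with $(A,\cdot)$ a (finite-dimensional) anti-Leibniz algebra, $\Delta:A\to A\otimes A$ linear with $(\Delta\otimes\mathrm{id})\Delta+(\mathrm{id}\otimes\Delta)\Delta+(\tau\otimes\mathrm{id})(\mathrm{id}\otimes\Delta)\Delta=0$, and for all $a_1,a_2$: (B1) $\Delta(a_1a_2)+\big((\mathrm{id}\otimes\mathbf{r}_A(a_2)+(\mathbf{l}_A-\mathbf{r}_A)(a_2)\otimes\mathrm{id})(\mathrm{id}\otimes\mathrm{id}-\tau)\big)\Delta(a_1)+(\mathrm{id}\otimes\mathbf{l}_A(a_1)+\mathbf{l}_A(a_1)\otimes\mathrm{id})\Delta(a_2)=0$; (B2) $(\mathbf{r}_A(a_1)\otimes\mathrm{id})\Delta(a_2)-\tau\big((\mathbf{r}_A(a_2)\otimes\mathrm{id})\Delta(a_1)\big)=0$. A $\mathbb{Z}$-graded commutative associative (resp. anti-Leibniz) algebra is a commutative associative (resp. anti-Leibniz) algebra $C=\oplus_{i\in\mathbb{Z}}C_i$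 with every $C_i$ finite-dimensional and $C_iC_j\subseteq C_{i+j}$. It is a quadratic $\mathbb{Z}$-graded commutative associative algebra $(C,\varpi)$ if equipped with a symmetric nondegenerate bilinear form $\varpi$ that is invariant, $\varpi(c_1c_2,c_3)=\varpi(c_1,c_2c_3)$, and graded: there is $m\in\mathbb{Z}$ with $\varpi(C_i,C_j)=0$ whenever $i+j+m\neq0$. For $\mathbb{Z}$-graded spaces $U=\oplus U_i$, $V=\oplus V_j$, the completed tensor product is $U\,\hat{\otimes}\,V:=\prod_{i,j\in\mathbb{Z}}U_i\otimes V_j$; its elements are possibly infinite formal sums $\sum_{i,j,\alpha}u_{i,\alpha}\otimes v_{j,\alpha}$ with $u_{i,\alpha}\in U_i$, $v_{j,\alpha}\in V_j$, $\alpha$ in a finite index set depending on $i,j$. For linear maps $f,g$, $f\,\hat{\otimes}\,g$ is defined by $\sum u_{i,\alpha}\otimes v_{j,\alpha}\mapsto\sum f(u_{i,\alpha})\otimes g(v_{j,\alpha})$; $\hat{\tau}$ is the termwise flip; similarly for triple products, and $(\hat{\Delta}\,\hat{\otimes}\,\mathrm{id})\hat{\Delta}$, $(\mathrm{id}\,\hat{\otimes}\,\hat{\Delta})\hat{\Delta}$ are computed termwise. $\bar{\varpi}$ is the pairing $(C\,\hat{\otimes}\,C)\otimes(C\otimes C)\to\Bbbk$, $\bar{\varpi}\big(\sum_{i,j,\alpha}c'_{i,\alpha}\otimes c''_{j,\alpha},\,c_1\otimes c_2\big)=\sum_{i,j,\alpha}\varpi(c'_{i,\alpha},c_1)\varpi(c''_{j,\alpha},c_2)$;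 it is left nondegenerate. A completed anti-Leibniz coalgebra is a $\mathbb{Z}$-graded space $A=\oplus A_i$ with a linear map $\hat{\Delta}:A\to A\,\hat{\otimes}\,A$ satisfying $(\hat{\Delta}\,\hat{\otimes}\,\mathrm{id})\hat{\Delta}+(\mathrm{id}\,\hat{\otimes}\,\hat{\Delta})\hat{\Delta}+(\hat{\tau}\,\hat{\otimes}\,\mathrm{id})(\mathrm{id}\,\hat{\otimes}\,\hat{\Delta})\hat{\Delta}=0$. A completed anti-Leibniz bialgebra is $(A=\oplus A_i,\cdot,\hat{\Delta})$ with $(A,\cdot)$ a $\mathbb{Z}$-graded anti-Leibniz algebra, $(A,\hat{\Delta})$ a completed anti-Leibniz coalgebra, and (B1), (B2) holding with $\Delta,\otimes,\tau$ replaced by $\hat{\Delta},\hat{\otimes},\hat{\tau}$. $\Bbbk[\mathfrak{t},\mathfrak{t}^{-1}]$ is graded by $C_i=\Bbbk\mathfrak{t}^i$; for the bilinear form $\varpi(\mathfrak{t}^i,\mathfrak{t}^j)=\delta_{i+j,0}$ on $\Bbbk[\mathfrak{t},\mathfrak{t}^{-1}]$, $\bar{\Delta}(\mathfrak{t}^k)=\sum_{i\in\mathbb{Z}}\mathfrak{t}^i\otimes\mathfrak{t}^{k-i}$. *)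

theory Defs
  imports Complex_Main "HOL-Library.Poly_Mapping" "HOL-Library.Function_Algebras"
begin

section \<open>Vector spaces and multilinear maps\<close>

text \<open>
  A vector space is a subspace \<^term>\<open>carr V\<close> of an ambient type on which
  \<^term>\<open>scl V\<close> is a scalar multiplication; all notions below are relative to carriers.
  Explicit carriers are needed because the graded pieces and the tensor products are subsets of types.
\<close>

record ('k, 'v) space =
  scl :: "'k \<Rightarrow> 'v \<Rightarrow> 'v"
  carr :: "'v set"

definition is_space :: "('k::field, 'v::ab_group_add) space \<Rightarrow> bool" where
  "is_space V \<longleftrightarrow> vector_space (scl V) \<and> module.subspace (scl V) (carr V)"

definition fin_dim :: "('k::field, 'v::ab_group_add) space \<Rightarrow> bool" where
  "fin_dim V \<longleftrightarrow> (\<exists>B. finite B \<and> carr V = module.span (scl V) B)"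

definition sub :: "('k, 'v) space \<Rightarrow> 'v set \<Rightarrow> ('k, 'v) space" where
  "sub V S = V\<lparr>carr := S\<rparr>"

definition scalars :: "('k::field, 'k) space" where
  "scalars = \<lparr>scl = (*), carr = UNIV\<rparr>"

definition linear_map ::
  "('k::field, 'v::ab_group_add) space \<Rightarrow> ('k, 'w::ab_group_add) space \<Rightarrow> ('v \<Rightarrow> 'w) \<Rightarrow> bool" where
  "linear_map V W f \<longleftrightarrow>
     (\<forall>x\<in>carr V. f x \<in> carr W) \<and>
     (\<forall>x\<in>carr V. \<forall>y\<in>carr V. f (x + y) = f x + f y) \<and>
     (\<forall>c. \<forall>x\<in>carr V. f (scl V c x) = scl W c (f x))"

definition bilinear_map ::
  "('k::field, 'u::ab_group_add) space \<Rightarrow> ('k, 'v::ab_group_add) space \<Rightarrow>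
   ('k, 'w::ab_group_add) space \<Rightarrow> ('u \<Rightarrow> 'v \<Rightarrow> 'w) \<Rightarrow> bool" where
  "bilinear_map U V W h \<longleftrightarrow>
     (\<forall>u\<in>carr U. linear_map V W (\<lambda>v. h u v)) \<and>
     (\<forall>v\<in>carr V. linear_map U W (\<lambda>u. h u v))"

definition trilinear_map ::
  "('k::field, 'u::ab_group_add) space \<Rightarrow> ('k, 'v::ab_group_add) space \<Rightarrow>
   ('k, 'w::ab_group_add) space \<Rightarrow> ('k, 'x::ab_group_add) space \<Rightarrow>
   ('u \<Rightarrow> 'v \<Rightarrow> 'w \<Rightarrow> 'x) \<Rightarrow> bool" where
  "trilinear_map U V W X h \<longleftrightarrow>
     (\<forall>u\<in>carr U. bilinear_map V W X (\<lambda>v w. h u v w)) \<and>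
     (\<forall>v\<in>carr V. \<forall>w\<in>carr W. linear_map U X (\<lambda>u. h u v w))"


section \<open>Tensor products\<close>

text \<open>
  The tensor product is realized inside the dual of the space of bilinear forms:
  \<open>u \<otimes> v\<close> is evaluation at \<open>(u, v)\<close>, and \<open>U \<otimes> V\<close> is the span of these
  evaluations (functions on all of \<open>'u \<Rightarrow> 'v \<Rightarrow> 'k\<close> that vanish off the bilinear forms).
  The lemmas \<open>tensor_universal\<close> and \<open>tensor_unique\<close> below show that this is the tensor product.
  The threefold product \<open>U \<otimes> V \<otimes> W\<close> is built likewise from trilinear forms, so that no
  associativity isomorphism is needed to compare \<open>(\<Delta> \<otimes> id)\<Delta>\<close> with \<open>(id \<otimes> \<Delta>)\<Delta>\<close>.
\<close>

type_synonym ('k, 'u, 'v) tensor = "('u \<Rightarrow> 'v \<Rightarrow> 'k) \<Rightarrow> 'k"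
type_synonym ('k, 'u, 'v, 'w) tensor3 = "('u \<Rightarrow> 'v \<Rightarrow> 'w \<Rightarrow> 'k) \<Rightarrow> 'k"

definition fscale :: "'k::field \<Rightarrow> ('y \<Rightarrow> 'k) \<Rightarrow> ('y \<Rightarrow> 'k)" where
  "fscale c f = (\<lambda>y. c * f y)"

definition tens ::
  "('k::field, 'u::ab_group_add) space \<Rightarrow> ('k, 'v::ab_group_add) space \<Rightarrow>
   'u \<Rightarrow> 'v \<Rightarrow> ('k, 'u, 'v) tensor" where
  "tens U V u v = (\<lambda>\<beta>. if bilinear_map U V scalars \<beta> then \<beta> u v else 0)"

definition tensor_space ::
  "('k::field, 'u::ab_group_add) space \<Rightarrow> ('k, 'v::ab_group_add) space \<Rightarrow>
   ('k, ('k, 'u, 'v) tensor) space" where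
  "tensor_space U V =
     \<lparr>scl = fscale, carr = module.span fscale {tens U V u v |u v. u \<in> carr U \<and> v \<in> carr V}\<rparr>"

definition tens3 ::
  "('k::field, 'u::ab_group_add) space \<Rightarrow> ('k, 'v::ab_group_add) space \<Rightarrow>
   ('k, 'w::ab_group_add) space \<Rightarrow> 'u \<Rightarrow> 'v \<Rightarrow> 'w \<Rightarrow> ('k, 'u, 'v, 'w) tensor3" where
  "tens3 U V W u v w = (\<lambda>\<gamma>. if trilinear_map U V W scalars \<gamma> then \<gamma> u v w else 0)"

text \<open>
  \<open>lift h\<close> is the linear map on \<open>U \<otimes> V\<close> with \<open>u \<otimes> v \<mapsto> h u v\<close> induced by a
  bilinear map \<open>h\<close> into a space of \<open>'k\<close>-valued functions, in particular into
  a tensor product (lemmas \<open>lift_tens\<close> and \<open>lift_linear\<close>);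
  \<open>lift3\<close> is the same for trilinear \<open>h\<close>.
\<close>

definition lift :: "('u \<Rightarrow> 'v \<Rightarrow> 'y \<Rightarrow> 'k) \<Rightarrow> ('k, 'u, 'v) tensor \<Rightarrow> 'y \<Rightarrow> 'k" where
  "lift h t = (\<lambda>y. t (\<lambda>u v. h u v y))"

definition lift3 :: "('u \<Rightarrow> 'v \<Rightarrow> 'w \<Rightarrow> 'y \<Rightarrow> 'k) \<Rightarrow> ('k, 'u, 'v, 'w) tensor3 \<Rightarrow> 'y \<Rightarrow> 'k" where
  "lift3 h t = (\<lambda>y. t (\<lambda>u v w. h u v w y))"

definition fun_space :: "('k::field, 'y \<Rightarrow> 'k) space" where
  "fun_space = \<lparr>scl = fscale, carr = UNIV\<rparr>"

text \<open>
  In the maps below the space arguments are the tensor factors of the \<^emph>\<open>target\<close>: for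
  \<open>f\<close> into \<open>U\<close> and \<open>g\<close> into \<open>V\<close>, \<open>tensor_map U V f g\<close> is \<open>f \<otimes> g\<close>;
  \<open>tensor_flip U V\<close> is \<open>\<tau>\<close> into \<open>U \<otimes> V\<close>.
\<close>

definition tensor_map ::
  "('k::field, 'u::ab_group_add) space \<Rightarrow> ('k, 'v::ab_group_add) space \<Rightarrow>
   ('p \<Rightarrow> 'u) \<Rightarrow> ('q \<Rightarrow> 'v) \<Rightarrow> ('k, 'p, 'q) tensor \<Rightarrow> ('k, 'u, 'v) tensor" where
  "tensor_map U V f g = lift (\<lambda>u v. tens U V (f u) (g v))"

definition tensor_flip ::
  "('k::field, 'u::ab_group_add) space \<Rightarrow> ('k, 'v::ab_group_add) space \<Rightarrow>
   ('k, 'v, 'u) tensor \<Rightarrow> ('k, 'u, 'v) tensor" where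
  "tensor_flip U V = lift (\<lambda>v u. tens U V u v)"

text \<open>\<open>\<Delta> \<otimes> id\<close>, \<open>id \<otimes> \<Delta>\<close> and \<open>\<tau> \<otimes> id\<close> with values in \<open>U \<otimes> V \<otimes> W\<close>.\<close>

definition cop_left ::
  "('k::field, 'u::ab_group_add) space \<Rightarrow> ('k, 'v::ab_group_add) space \<Rightarrow>
   ('k, 'w::ab_group_add) space \<Rightarrow> ('a \<Rightarrow> ('k, 'u, 'v) tensor) \<Rightarrow>
   ('k, 'a, 'w) tensor \<Rightarrow> ('k, 'u, 'v, 'w) tensor3" where
  "cop_left U V W \<Delta> = lift (\<lambda>a w. lift (\<lambda>u v. tens3 U V W u v w) (\<Delta> a))"

definition cop_right ::
  "('k::field, 'u::ab_group_add) space \<Rightarrow> ('k, 'v::ab_group_add) space \<Rightarrow>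
   ('k, 'w::ab_group_add) space \<Rightarrow> ('a \<Rightarrow> ('k, 'v, 'w) tensor) \<Rightarrow>
   ('k, 'u, 'a) tensor \<Rightarrow> ('k, 'u, 'v, 'w) tensor3" where
  "cop_right U V W \<Delta> = lift (\<lambda>u a. lift (\<lambda>v w. tens3 U V W u v w) (\<Delta> a))"

definition flip_left ::
  "('k::field, 'u::ab_group_add) space \<Rightarrow> ('k, 'v::ab_group_add) space \<Rightarrow>
   ('k, 'w::ab_group_add) space \<Rightarrow> ('k, 'v, 'u, 'w) tensor3 \<Rightarrow> ('k, 'u, 'v, 'w) tensor3" where
  "flip_left U V W = lift3 (\<lambda>v u w. tens3 U V W u v w)"


section \<open>Anti-Leibniz bialgebras\<close>

definition lmult :: "('v \<Rightarrow> 'v \<Rightarrow> 'v) \<Rightarrow> 'v \<Rightarrow> 'v \<Rightarrow> 'v" where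
  "lmult m a = (\<lambda>b. m a b)"

definition rmult :: "('v \<Rightarrow> 'v \<Rightarrow> 'v) \<Rightarrow> 'v \<Rightarrow> 'v \<Rightarrow> 'v" where
  "rmult m a = (\<lambda>b. m b a)"

definition anti_leibniz_algebra ::
  "('k::field, 'v::ab_group_add) space \<Rightarrow> ('v \<Rightarrow> 'v \<Rightarrow> 'v) \<Rightarrow> bool" where
  "anti_leibniz_algebra A m \<longleftrightarrow>
     is_space A \<and> bilinear_map A A A m \<and>
     (\<forall>a1\<in>carr A. \<forall>a2\<in>carr A. \<forall>a3\<in>carr A.
        m a1 (m a2 a3) + m (m a1 a2) a3 + m a2 (m a1 a3) = 0)"

definition anti_leibniz_coalgebra ::
  "('k::field, 'v::ab_group_add) space \<Rightarrow> ('v \<Rightarrow> ('k, 'v, 'v) tensor) \<Rightarrow> bool" where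
  "anti_leibniz_coalgebra A \<Delta> \<longleftrightarrow>
     is_space A \<and> linear_map A (tensor_space A A) \<Delta> \<and>
     (\<forall>a\<in>carr A.
        cop_left A A A \<Delta> (\<Delta> a) + cop_right A A A \<Delta> (\<Delta> a) +
        flip_left A A A (cop_right A A A \<Delta> (\<Delta> a)) = 0)"

definition anti_leibniz_bialgebra ::
  "('k::field, 'v::ab_group_add) space \<Rightarrow> ('v \<Rightarrow> 'v \<Rightarrow> 'v) \<Rightarrow>
   ('v \<Rightarrow> ('k, 'v, 'v) tensor) \<Rightarrow> bool" where
  "anti_leibniz_bialgebra A m \<Delta> \<longleftrightarrow>
     anti_leibniz_algebra A m \<and> anti_leibniz_coalgebra A \<Delta> \<and>
     (\<forall>a1\<in>carr A. \<forall>a2\<in>carr A.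
        (let d = \<Delta> a1 - tensor_flip A A (\<Delta> a1) in
           \<Delta> (m a1 a2) +
           (tensor_map A A id (rmult m a2) d + tensor_map A A (lmult m a2 - rmult m a2) id d) +
           (tensor_map A A id (lmult m a1) (\<Delta> a2) + tensor_map A A (lmult m a1) id (\<Delta> a2)) = 0) \<and>
        tensor_map A A (rmult m a1) id (\<Delta> a2) -
          tensor_flip A A (tensor_map A A (rmult m a2) id (\<Delta> a1)) = 0)"


section \<open>Graded spaces and graded algebras\<close>

definition graded_space ::
  "('k::field, 'v::ab_group_add) space \<Rightarrow> (int \<Rightarrow> 'v set) \<Rightarrow> bool" where
  "graded_space V G \<longleftrightarrow>
     is_space V \<and> (\<forall>i. module.subspace (scl V) (G i) \<and> G i \<subseteq> carr V) \<and>
     (\<forall>v\<in>carr V. \<exists>!f. (\<forall>i. f i \<in> G i) \<and> finite {i. f i \<noteq> 0} \<and> Sum_any f = v)"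

definition hpart :: "(int \<Rightarrow> 'v::ab_group_add set) \<Rightarrow> 'v \<Rightarrow> int \<Rightarrow> 'v" where
  "hpart G v = (THE f. (\<forall>i. f i \<in> G i) \<and> finite {i. f i \<noteq> 0} \<and> Sum_any f = v)"

definition graded_algebra ::
  "('k::field, 'v::ab_group_add) space \<Rightarrow> (int \<Rightarrow> 'v set) \<Rightarrow> ('v \<Rightarrow> 'v \<Rightarrow> 'v) \<Rightarrow> bool" where
  "graded_algebra V G m \<longleftrightarrow>
     graded_space V G \<and> (\<forall>i. fin_dim (sub V (G i))) \<and> bilinear_map V V V m \<and>
     (\<forall>i j. \<forall>x\<in>G i. \<forall>y\<in>G j. m x y \<in> G (i + j))"

definition quadratic_graded_comm_algebra ::
  "('k::field, 'v::ab_group_add) space \<Rightarrow> (int \<Rightarrow> 'v set) \<Rightarrow> ('v \<Rightarrow> 'v \<Rightarrow> 'v) \<Rightarrow>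
   ('v \<Rightarrow> 'v \<Rightarrow> 'k) \<Rightarrow> bool" where
  "quadratic_graded_comm_algebra C G m \<omega> \<longleftrightarrow>
     graded_algebra C G m \<and>
     (\<forall>x\<in>carr C. \<forall>y\<in>carr C. m x y = m y x) \<and>
     (\<forall>x\<in>carr C. \<forall>y\<in>carr C. \<forall>z\<in>carr C. m (m x y) z = m x (m y z)) \<and>
     bilinear_map C C scalars \<omega> \<and>
     (\<forall>x\<in>carr C. \<forall>y\<in>carr C. \<omega> x y = \<omega> y x) \<and>
     (\<forall>x\<in>carr C. (\<forall>y\<in>carr C. \<omega> x y = 0) \<longrightarrow> x = 0) \<and>
     (\<forall>x\<in>carr C. \<forall>y\<in>carr C. \<forall>z\<in>carr C. \<omega> (m x y) z = \<omega> x (m y z)) \<and>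
     (\<exists>d. \<forall>i j. i + j + d \<noteq> 0 \<longrightarrow> (\<forall>x\<in>G i. \<forall>y\<in>G j. \<omega> x y = 0))"


section \<open>Completed tensor products\<close>

text \<open>
  An element of \<open>\<Prod>\<^sub>i\<^sub>,\<^sub>j U\<^sub>i \<otimes> V\<^sub>j\<close> is the family \<open>x\<close> of its components
  \<open>x i j \<in> U\<^sub>i \<otimes> V\<^sub>j\<close>; threefold completed tensors are families \<open>y p q r\<close>.
\<close>

type_synonym ('k, 'u, 'v) ctensor = "int \<Rightarrow> int \<Rightarrow> ('k, 'u, 'v) tensor"
type_synonym ('k, 'u, 'v, 'w) ctensor3 = "int \<Rightarrow> int \<Rightarrow> int \<Rightarrow> ('k, 'u, 'v, 'w) tensor3"

definition ctensor_space ::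
  "('k::field, 'u::ab_group_add) space \<Rightarrow> (int \<Rightarrow> 'u set) \<Rightarrow>
   ('k, 'v::ab_group_add) space \<Rightarrow> (int \<Rightarrow> 'v set) \<Rightarrow> ('k, ('k, 'u, 'v) ctensor) space" where
  "ctensor_space U G V H =
     \<lparr>scl = (\<lambda>c x i j. fscale c (x i j)),
      carr = {x. \<forall>i j. x i j \<in> carr (tensor_space (sub U (G i)) (sub V (H j)))}\<rparr>"

text \<open>
  \<open>f \<otimes> g\<close> termwise: the summand \<open>u \<otimes> v\<close> of degree \<open>(i, j)\<close> contributes
  \<open>f(u)\<^sub>p \<otimes> g(v)\<^sub>q\<close> to the component \<open>(p, q)\<close>. \<^const>\<open>Sum_any\<close> sums over the support. For the identity
  and for multiplications of a graded algebra, only finitely many \<open>(i, j)\<close> contribute to each \<open>(p, q)\<close>.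
\<close>

definition cmap ::
  "('k::field, 'v::ab_group_add) space \<Rightarrow> (int \<Rightarrow> 'v set) \<Rightarrow> ('v \<Rightarrow> 'v) \<Rightarrow> ('v \<Rightarrow> 'v) \<Rightarrow>
   ('k, 'v, 'v) ctensor \<Rightarrow> ('k, 'v, 'v) ctensor" where
  "cmap V G f g x = (\<lambda>p q. Sum_any (\<lambda>(i, j).
     tensor_map (sub V (G p)) (sub V (G q)) (\<lambda>u. hpart G (f u) p) (\<lambda>v. hpart G (g v) q) (x i j)))"

definition cflip ::
  "('k::field, 'v::ab_group_add) space \<Rightarrow> (int \<Rightarrow> 'v set) \<Rightarrow>
   ('k, 'v, 'v) ctensor \<Rightarrow> ('k, 'v, 'v) ctensor" where
  "cflip V G x = (\<lambda>i j. tensor_flip (sub V (G i)) (sub V (G j)) (x j i))"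

definition cflip_left ::
  "('k::field, 'v::ab_group_add) space \<Rightarrow> (int \<Rightarrow> 'v set) \<Rightarrow>
   ('k, 'v, 'v, 'v) ctensor3 \<Rightarrow> ('k, 'v, 'v, 'v) ctensor3" where
  "cflip_left V G y =
     (\<lambda>p q r. flip_left (sub V (G p)) (sub V (G q)) (sub V (G r)) (y q p r))"

text \<open>
  The component \<open>(p, q, r)\<close> of \<open>(\<Delta> \<otimes> id)x\<close> is the sum over \<open>i\<close> of the images
  under \<open>\<Delta>\<^sub>p\<^sub>q \<otimes> id\<close> of the components \<open>x i r\<close>. For a general \<open>\<Delta>\<close>
  it only makes sense if almost all of these images vanish; the predicates
  \<open>ccop_left_defined\<close> and \<open>ccop_right_defined\<close> say so for every \<open>(p, q, r)\<close>.
\<close>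

definition ccop_left_term ::
  "('k::field, 'v::ab_group_add) space \<Rightarrow> (int \<Rightarrow> 'v set) \<Rightarrow> ('v \<Rightarrow> ('k, 'v, 'v) ctensor) \<Rightarrow>
   ('k, 'v, 'v) ctensor \<Rightarrow> int \<Rightarrow> int \<Rightarrow> int \<Rightarrow> int \<Rightarrow> ('k, 'v, 'v, 'v) tensor3" where
  "ccop_left_term V G \<Delta> x p q r i =
     cop_left (sub V (G p)) (sub V (G q)) (sub V (G r)) (\<lambda>a. \<Delta> a p q) (x i r)"

definition ccop_right_term ::
  "('k::field, 'v::ab_group_add) space \<Rightarrow> (int \<Rightarrow> 'v set) \<Rightarrow> ('v \<Rightarrow> ('k, 'v, 'v) ctensor) \<Rightarrow>
   ('k, 'v, 'v) ctensor \<Rightarrow> int \<Rightarrow> int \<Rightarrow> int \<Rightarrow> int \<Rightarrow> ('k, 'v, 'v, 'v) tensor3" where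
  "ccop_right_term V G \<Delta> x p q r j =
     cop_right (sub V (G p)) (sub V (G q)) (sub V (G r)) (\<lambda>a. \<Delta> a q r) (x p j)"

definition ccop_left_defined ::
  "('k::field, 'v::ab_group_add) space \<Rightarrow> (int \<Rightarrow> 'v set) \<Rightarrow> ('v \<Rightarrow> ('k, 'v, 'v) ctensor) \<Rightarrow>
   ('k, 'v, 'v) ctensor \<Rightarrow> bool" where
  "ccop_left_defined V G \<Delta> x \<longleftrightarrow> (\<forall>p q r. finite {i. ccop_left_term V G \<Delta> x p q r i \<noteq> 0})"

definition ccop_right_defined ::
  "('k::field, 'v::ab_group_add) space \<Rightarrow> (int \<Rightarrow> 'v set) \<Rightarrow> ('v \<Rightarrow> ('k, 'v, 'v) ctensor) \<Rightarrow>
   ('k, 'v, 'v) ctensor \<Rightarrow> bool" where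
  "ccop_right_defined V G \<Delta> x \<longleftrightarrow> (\<forall>p q r. finite {j. ccop_right_term V G \<Delta> x p q r j \<noteq> 0})"

definition ccop_left ::
  "('k::field, 'v::ab_group_add) space \<Rightarrow> (int \<Rightarrow> 'v set) \<Rightarrow> ('v \<Rightarrow> ('k, 'v, 'v) ctensor) \<Rightarrow>
   ('k, 'v, 'v) ctensor \<Rightarrow> ('k, 'v, 'v, 'v) ctensor3" where
  "ccop_left V G \<Delta> x = (\<lambda>p q r. Sum_any (\<lambda>i. ccop_left_term V G \<Delta> x p q r i))"

definition ccop_right ::
  "('k::field, 'v::ab_group_add) space \<Rightarrow> (int \<Rightarrow> 'v set) \<Rightarrow> ('v \<Rightarrow> ('k, 'v, 'v) ctensor) \<Rightarrow>
   ('k, 'v, 'v) ctensor \<Rightarrow> ('k, 'v, 'v, 'v) ctensor3" where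
  "ccop_right V G \<Delta> x = (\<lambda>p q r. Sum_any (\<lambda>j. ccop_right_term V G \<Delta> x p q r j))"


section \<open>Completed anti-Leibniz bialgebras\<close>

definition completed_anti_leibniz_coalgebra ::
  "('k::field, 'v::ab_group_add) space \<Rightarrow> (int \<Rightarrow> 'v set) \<Rightarrow> ('v \<Rightarrow> ('k, 'v, 'v) ctensor) \<Rightarrow> bool" where
  "completed_anti_leibniz_coalgebra A G \<Delta> \<longleftrightarrow>
     graded_space A G \<and> linear_map A (ctensor_space A G A G) \<Delta> \<and>
     (\<forall>a\<in>carr A.
        ccop_left_defined A G \<Delta> (\<Delta> a) \<and> ccop_right_defined A G \<Delta> (\<Delta> a) \<and>
        ccop_left A G \<Delta> (\<Delta> a) + ccop_right A G \<Delta> (\<Delta> a) +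
        cflip_left A G (ccop_right A G \<Delta> (\<Delta> a)) = 0)"

definition completed_anti_leibniz_bialgebra ::
  "('k::field, 'v::ab_group_add) space \<Rightarrow> (int \<Rightarrow> 'v set) \<Rightarrow> ('v \<Rightarrow> 'v \<Rightarrow> 'v) \<Rightarrow>
   ('v \<Rightarrow> ('k, 'v, 'v) ctensor) \<Rightarrow> bool" where
  "completed_anti_leibniz_bialgebra A G m \<Delta> \<longleftrightarrow>
     graded_algebra A G m \<and> anti_leibniz_algebra A m \<and> completed_anti_leibniz_coalgebra A G \<Delta> \<and>
     (\<forall>a1\<in>carr A. \<forall>a2\<in>carr A.
        (let d = \<Delta> a1 - cflip A G (\<Delta> a1) in
           \<Delta> (m a1 a2) +
           (cmap A G id (rmult m a2) d + cmap A G (lmult m a2 - rmult m a2) id d) +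
           (cmap A G id (lmult m a1) (\<Delta> a2) + cmap A G (lmult m a1) id (\<Delta> a2)) = 0) \<and>
        cmap A G (rmult m a1) id (\<Delta> a2) - cflip A G (cmap A G (rmult m a2) id (\<Delta> a1)) = 0)"


section \<open>The construction on \<open>A \<otimes> C\<close>\<close>

definition tensor_grading ::
  "('k::field, 'a::ab_group_add) space \<Rightarrow> ('k, 'c::ab_group_add) space \<Rightarrow> (int \<Rightarrow> 'c set) \<Rightarrow>
   int \<Rightarrow> ('k, 'a, 'c) tensor set" where
  "tensor_grading A C G i = module.span fscale {tens A C a c |a c. a \<in> carr A \<and> c \<in> G i}"

definition tensor_mult ::
  "('k::field, 'a::ab_group_add) space \<Rightarrow> ('a \<Rightarrow> 'a \<Rightarrow> 'a) \<Rightarrow>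
   ('k, 'c::ab_group_add) space \<Rightarrow> ('c \<Rightarrow> 'c \<Rightarrow> 'c) \<Rightarrow>
   ('k, 'a, 'c) tensor \<Rightarrow> ('k, 'a, 'c) tensor \<Rightarrow> ('k, 'a, 'c) tensor" where
  "tensor_mult A mA C mC x y =
     lift (\<lambda>a1 c1. lift (\<lambda>a2 c2. tens A C (mA a1 a2) (mC c1 c2)) y) x"

definition bar_pairing ::
  "('c \<Rightarrow> 'c \<Rightarrow> 'k::field) \<Rightarrow> ('k, 'c::ab_group_add, 'c) ctensor \<Rightarrow> 'c \<Rightarrow> 'c \<Rightarrow> 'k" where
  "bar_pairing \<omega> x c1 c2 = Sum_any (\<lambda>(i, j). x i j (\<lambda>u v. \<omega> u c1 * \<omega> v c2))"

definition bar_coproduct ::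
  "('k::field, 'c::ab_group_add) space \<Rightarrow> (int \<Rightarrow> 'c set) \<Rightarrow> ('c \<Rightarrow> 'c \<Rightarrow> 'c) \<Rightarrow>
   ('c \<Rightarrow> 'c \<Rightarrow> 'k) \<Rightarrow> ('c \<Rightarrow> ('k, 'c, 'c) ctensor) \<Rightarrow> bool" where
  "bar_coproduct C G m \<omega> D \<longleftrightarrow>
     linear_map C (ctensor_space C G C G) D \<and>
     (\<forall>c1\<in>carr C. \<forall>c2\<in>carr C. \<forall>c3\<in>carr C. bar_pairing \<omega> (D c1) c2 c3 = \<omega> c1 (m c2 c3))"

text \<open>Componentwise, \<open>(a' \<otimes> a'') \<bullet> (c' \<otimes> c'') = (a' \<otimes> c') \<otimes> (a'' \<otimes> c'')\<close>.\<close>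

definition bullet ::
  "('k::field, 'a::ab_group_add) space \<Rightarrow> ('k, 'c::ab_group_add) space \<Rightarrow> (int \<Rightarrow> 'c set) \<Rightarrow>
   ('k, 'a, 'a) tensor \<Rightarrow> ('k, 'c, 'c) ctensor \<Rightarrow>
   ('k, ('k, 'a, 'c) tensor, ('k, 'a, 'c) tensor) ctensor" where
  "bullet A C G t x = (\<lambda>i j.
     lift (\<lambda>a1 a2. lift (\<lambda>c1 c2.
       tens (sub (tensor_space A C) (tensor_grading A C G i))
            (sub (tensor_space A C) (tensor_grading A C G j))
         (tens A C a1 c1) (tens A C a2 c2)) (x i j)) t)"

definition hat_coproduct ::
  "('k::field, 'a::ab_group_add) space \<Rightarrow> ('a \<Rightarrow> ('k, 'a, 'a) tensor) \<Rightarrow>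
   ('k, 'c::ab_group_add) space \<Rightarrow> (int \<Rightarrow> 'c set) \<Rightarrow> ('c \<Rightarrow> ('k, 'c, 'c) ctensor) \<Rightarrow>
   ('k, 'a, 'c) tensor \<Rightarrow> ('k, ('k, 'a, 'c) tensor, ('k, 'a, 'c) tensor) ctensor" where
  "hat_coproduct A \<Delta> C G D x = (\<lambda>i j. lift (\<lambda>a c. bullet A C G (\<Delta> a) (D c) i j) x)"


section \<open>Laurent polynomials\<close>

text \<open>
  \<open>\<k>[t, t\<^sup>-\<^sup>1]\<close> is the group algebra of the integers: the type \<^typ>\<open>int \<Rightarrow>\<^sub>0 'k\<close>
  of finitely supported functions with convolution as multiplication, where
  \<open>Poly_Mapping.single i 1\<close> is \<open>t\<^sup>i\<close>.
\<close>

definition laurent :: "('k::field, int \<Rightarrow>\<^sub>0 'k) space" where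
  "laurent = \<lparr>scl = (\<lambda>c. Poly_Mapping.map ((*) c)), carr = UNIV\<rparr>"

definition laurent_grading :: "int \<Rightarrow> (int \<Rightarrow>\<^sub>0 'k::field) set" where
  "laurent_grading i = range (Poly_Mapping.single i)"

definition laurent_form :: "(int \<Rightarrow>\<^sub>0 'k::field) \<Rightarrow> (int \<Rightarrow>\<^sub>0 'k) \<Rightarrow> 'k" where
  "laurent_form p q = (\<Sum>i\<in>Poly_Mapping.keys p. Poly_Mapping.lookup p i * Poly_Mapping.lookup q (- i))"

lemma laurent_form_monomials:
  "laurent_form (Poly_Mapping.single i (1::'k::field)) (Poly_Mapping.single j 1) = (if i + j = 0 then 1 else 0)"
  by (auto simp: laurent_form_def lookup_single when_def)


section \<open>Properties characterizing the tensor constructions\<close>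

lemma vector_space_fscale: "vector_space (fscale :: 'k::field \<Rightarrow> ('y \<Rightarrow> 'k) \<Rightarrow> 'y \<Rightarrow> 'k)"
  by unfold_locales (auto simp: fscale_def algebra_simps)

lemma is_space_tensor_space: "is_space (tensor_space U V)"
proof -
  interpret vector_space "fscale :: 'a \<Rightarrow> (('b \<Rightarrow> 'c \<Rightarrow> 'a) \<Rightarrow> 'a) \<Rightarrow> _"
    by (rule vector_space_fscale)
  show ?thesis
    by (simp add: is_space_def tensor_space_def vector_space_fscale)
qed

lemma tens_bilinear: "bilinear_map U V (tensor_space U V) (tens U V)"
proof -
  interpret vector_space "fscale :: 'a \<Rightarrow> (('b \<Rightarrow> 'c \<Rightarrow> 'a) \<Rightarrow> 'a) \<Rightarrow> _"
    by (rule vector_space_fscale)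
  show ?thesis
    unfolding bilinear_map_def linear_map_def tensor_space_def
    by (auto intro!: span_base ext
        simp: tens_def fscale_def bilinear_map_def linear_map_def scalars_def)
qed

lemma lift_tens:
  assumes "bilinear_map U V fun_space h" "u \<in> carr U" "v \<in> carr V"
  shows "lift h (tens U V u v) = h u v"
proof -
  have "bilinear_map U V scalars (\<lambda>u v. h u v y)" for y
    using assms(1)
    by (auto simp: bilinear_map_def linear_map_def fun_space_def scalars_def fscale_def)
  then show ?thesis by (simp add: lift_def tens_def)
qed

lemma lift_linear: "linear_map (tensor_space U V) fun_space (lift h)"
  by (auto simp: linear_map_def lift_def fun_space_def tensor_space_def fscale_def)

lemma tensor_unique:
  fixes U :: "('a::field, 'b::ab_group_add) space" and V :: "('a, 'c::ab_group_add) space"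
    and W :: "('a, 'd::ab_group_add) space"
  assumes W: "is_space W"
    and L: "linear_map (tensor_space U V) W L" and M: "linear_map (tensor_space U V) W M"
    and eq: "\<And>u v. u \<in> carr U \<Longrightarrow> v \<in> carr V \<Longrightarrow> L (tens U V u v) = M (tens U V u v)"
    and t: "t \<in> carr (tensor_space U V)"
  shows "L t = M t"
proof -
  interpret vector_space "fscale :: 'a \<Rightarrow> (('b \<Rightarrow> 'c \<Rightarrow> 'a) \<Rightarrow> 'a) \<Rightarrow> _"
    by (rule vector_space_fscale)
  interpret W: vector_space "scl W" using W by (simp add: is_space_def)
  let ?S = "{tens U V u v |u v. u \<in> carr U \<and> v \<in> carr V}"
  have zero: "N 0 = 0" if "linear_map (tensor_space U V) W N" for N
  proof -
    have "N (fscale 0 0) = scl W 0 (N 0)"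
      using that span_zero[of ?S] unfolding linear_map_def tensor_space_def space.simps by blast
    then show ?thesis by simp
  qed
  have "t \<in> span ?S" using t by (simp add: tensor_space_def)
  then have "t \<in> span ?S \<and> L t = M t"
  proof (induction rule: span_induct_alt)
    case base
    show ?case using zero[OF L] zero[OF M] span_zero[of ?S] by presburger
  next
    case (step c x y)
    then obtain u v where x: "x = tens U V u v" "u \<in> carr U" "v \<in> carr V" by auto
    have xs: "x \<in> span ?S" using step by (intro span_base) auto
    have cx: "fscale c x \<in> span ?S" using xs by (rule span_scale)
    have "L (fscale c x + y) = scl W c (L x) + L y" "M (fscale c x + y) = scl W c (M x) + M y"
      using L M xs cx step by (auto simp: linear_map_def tensor_space_def)
    moreover have "fscale c x + y \<in> span ?S" using span_add cx step by blast
    moreover have "L x = M x" using eq x by simp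
    ultimately show ?case using step(2) by presburger
  qed
  then show ?thesis by simp
qed

lemma linear_form_separates:
  assumes "vector_space s" "w \<noteq> 0"
  obtains \<phi> where "Vector_Spaces.linear s ((*) :: 'k::field \<Rightarrow> 'k \<Rightarrow> 'k) \<phi>" "\<phi> w \<noteq> 0"
proof -
  interpret vector_space s by fact
  interpret K: vector_space "(*) :: 'k \<Rightarrow> 'k \<Rightarrow> 'k"
    by unfold_locales (auto simp: algebra_simps)
  interpret vector_space_pair s "(*) :: 'k \<Rightarrow> 'k \<Rightarrow> 'k" ..
  have "independent {w}" using assms(2) by simp
  then have "\<exists>g. Vector_Spaces.linear s ((*) :: 'k \<Rightarrow> 'k \<Rightarrow> 'k) g \<and> (\<forall>x\<in>{w}. g x = (\<lambda>_. 1) x)"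
    by (intro linear_independent_extend)
  then show ?thesis using that by fastforce
qed

theorem tensor_universal:
  fixes U :: "('a::field, 'b::ab_group_add) space" and V :: "('a, 'c::ab_group_add) space"
    and W :: "('a, 'd::ab_group_add) space"
  assumes W: "is_space W" and h: "bilinear_map U V W h"
  shows "\<exists>L. linear_map (tensor_space U V) W L \<and>
             (\<forall>u\<in>carr U. \<forall>v\<in>carr V. L (tens U V u v) = h u v)"
proof -
  interpret vector_space "fscale :: 'a \<Rightarrow> (('b \<Rightarrow> 'c \<Rightarrow> 'a) \<Rightarrow> 'a) \<Rightarrow> _"
    by (rule vector_space_fscale)
  interpret W: vector_space "scl W" using W by (simp add: is_space_def)
  let ?S = "{tens U V u v |u v. u \<in> carr U \<and> v \<in> carr V}"
  define R where "R t w \<longleftrightarrow> w \<in> carr W \<and>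
    (\<forall>\<phi>. Vector_Spaces.linear (scl W) (*) \<phi> \<longrightarrow> t (\<lambda>u v. \<phi> (h u v)) = \<phi> w)" for t w
  have Wsub: "W.subspace (carr W)" using W by (simp add: is_space_def)
  have R_tens: "R (tens U V u v) (h u v)" if "u \<in> carr U" "v \<in> carr V" for u v
  proof -
    have "bilinear_map U V scalars (\<lambda>u v. \<phi> (h u v))"
      if "Vector_Spaces.linear (scl W) (*) \<phi>" for \<phi>
      using h that
      by (auto simp: bilinear_map_def linear_map_def scalars_def
          Vector_Spaces.linear_iff)
    moreover have "h u v \<in> carr W" using h that by (auto simp: bilinear_map_def linear_map_def)
    ultimately show ?thesis by (auto simp: R_def tens_def)
  qed
  have R_scale: "R (fscale c t) (scl W c w)" if "R t w" for c t w
    using that Wsub by (auto simp: R_def fscale_def Vector_Spaces.linear_iff W.subspace_scale)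
  have R_add: "R (t + t') (w + w')" if "R t w" "R t' w'" for t t' w w'
    using that Wsub by (auto simp: R_def Vector_Spaces.linear_iff W.subspace_add)
  have R_zero: "R 0 0"
  proof -
    have "\<phi> 0 = 0" if "Vector_Spaces.linear (scl W) (*) \<phi>" for \<phi>
    proof -
      have "\<phi> (0 + 0) = \<phi> 0 + \<phi> 0" using that unfolding Vector_Spaces.linear_iff by blast
      then show ?thesis by (metis add.right_neutral add_left_cancel)
    qed
    then show ?thesis using Wsub by (auto simp: R_def W.subspace_0)
  qed
  have ex: "\<exists>w. R t w" if "t \<in> span ?S" for t
    using that
  proof (induction rule: span_induct_alt)
    case base
    show ?case using R_zero by blast
  next
    case (step c x y)
    then show ?case using R_tens R_scale R_add by blast
  qed
  have uniq: "w = w'" if "R t w" "R t w'" for t w w'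
  proof (rule ccontr)
    assume "w \<noteq> w'"
    then obtain \<phi> where \<phi>: "Vector_Spaces.linear (scl W) (*) \<phi>" "\<phi> (w - w') \<noteq> 0"
      using linear_form_separates[OF W.vector_space_axioms, of "w - w'"] by auto
    have "\<phi> w = \<phi> w'" using that \<phi>(1) by (auto simp: R_def)
    moreover have "\<phi> (w - w' + w') = \<phi> (w - w') + \<phi> w'"
      using \<phi>(1) unfolding Vector_Spaces.linear_iff by blast
    ultimately show False using \<phi>(2) by simp
  qed
  define L where "L t = (THE w. R t w)" for t
  have L: "L t = w" if "R t w" for t w
    unfolding L_def using that uniq by blast
  have RL: "R t (L t)" if "t \<in> span ?S" for t
    using ex[OF that] L by auto
  have "linear_map (tensor_space U V) W L"
    unfolding linear_map_def tensor_space_def space.simps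
  proof (intro conjI ballI allI)
    fix x assume "x \<in> span ?S"
    from RL[OF this] show "L x \<in> carr W" by (simp add: R_def)
  next
    fix x y assume "x \<in> span ?S" "y \<in> span ?S"
    then show "L (x + y) = L x + L y" by (intro L R_add RL)
  next
    fix c x assume "x \<in> span ?S"
    then show "L (fscale c x) = scl W c (L x)" by (intro L R_scale RL)
  qed
  moreover have "L (tens U V u v) = h u v" if "u \<in> carr U" "v \<in> carr V" for u v
    using L R_tens that by blast
  ultimately show ?thesis by blast
qed


section \<open>The Laurent polynomial algebra is quadratic\<close>

text \<open>
  The lemma \<open>laurent_coproduct\<close> is the formula \<open>t\<^sup>k \<mapsto> \<Sum>\<^sub>i t\<^sup>i \<otimes> t\<^sup>k\<^sup>-\<^sup>i\<close>.
\<close>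

lemma lookup_laurent_scale: "Poly_Mapping.lookup (Poly_Mapping.map ((*) (c::'k::field)) p) i = c * Poly_Mapping.lookup p i"
  by (simp add: Poly_Mapping.map.rep_eq when_def)

lemma laurent_form_Sum_any: "laurent_form p q = Sum_any (\<lambda>i. Poly_Mapping.lookup p i * Poly_Mapping.lookup q (- i))"
  unfolding laurent_form_def
  by (rule Sum_any.expand_superset[symmetric]) (auto simp: in_keys_iff)

lemma laurent_form_mult: "laurent_form p q = Poly_Mapping.lookup (p * q) 0"
proof -
  have "Sum_any (\<lambda>qa. Poly_Mapping.lookup q qa when 0 = l + qa) = Poly_Mapping.lookup q (-l)" for l :: int
  proof -
    have "(\<lambda>qa. Poly_Mapping.lookup q qa when 0 = l + qa) = (\<lambda>qa. Poly_Mapping.lookup q qa when qa = -l)"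
      by (auto simp: when_def fun_eq_iff)
    then show ?thesis by (simp only: Sum_any_when_equal)
  qed
  then show ?thesis unfolding lookup_mult laurent_form_Sum_any by simp
qed

lemma vs_laurent: "vector_space (\<lambda>c. Poly_Mapping.map ((*) (c::'k::field)) :: (int \<Rightarrow>\<^sub>0 'k) \<Rightarrow> _)"
  by unfold_locales (auto intro!: poly_mapping_eqI simp: lookup_laurent_scale lookup_add algebra_simps)

lemma laurent_form_bilinear: "bilinear_map laurent laurent scalars laurent_form"
proof -
  have "Poly_Mapping.map ((*) c) p * q = Poly_Mapping.map ((*) c) (p * q)"
       "p * Poly_Mapping.map ((*) c) q = Poly_Mapping.map ((*) c) (p * q)" for c and p q :: "int \<Rightarrow>\<^sub>0 'a"
    by (simp_all add: mult_map_scale_conv_mult mult.assoc mult.left_commute)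
  then show ?thesis
  by (auto simp: bilinear_map_def linear_map_def laurent_def scalars_def laurent_form_mult lookup_add algebra_simps lookup_laurent_scale)
qed

lemma laurent_quadratic: "quadratic_graded_comm_algebra (laurent :: ('k::field, _) space) laurent_grading (*) laurent_form"
proof -
  have sc: "Poly_Mapping.map ((*) c) p * q = Poly_Mapping.map ((*) c) (p * q)"
       "p * Poly_Mapping.map ((*) c) q = Poly_Mapping.map ((*) c) (p * q)" for c and p q :: "int \<Rightarrow>\<^sub>0 'k"
    by (simp_all add: mult_map_scale_conv_mult mult.assoc mult.left_commute)
  interpret V: vector_space "\<lambda>c. Poly_Mapping.map ((*) (c::'k)) :: (int \<Rightarrow>\<^sub>0 'k) \<Rightarrow> _" by (rule vs_laurent)
  have sp: "V.subspace (laurent_grading i)" for i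
    unfolding V.subspace_def laurent_grading_def
    by (auto simp flip: single_add simp: image_iff intro: exI[of _ 0]) 
  have gr: "\<exists>!f. (\<forall>i. f i \<in> laurent_grading i) \<and> finite {i. f i \<noteq> 0} \<and> Sum_any f = v" for v :: "int \<Rightarrow>\<^sub>0 'k"
  proof (intro ex1I conjI allI)
    let ?f = "\<lambda>i. Poly_Mapping.single i (Poly_Mapping.lookup v i)"
    show "?f i \<in> laurent_grading i" for i by (auto simp: laurent_grading_def)
    have *: "{i. ?f i \<noteq> 0} = Poly_Mapping.keys v" by (auto simp: in_keys_iff) (metis lookup_single_eq lookup_zero)
    then show "finite {i. ?f i \<noteq> 0}" by simp
    show "Sum_any ?f = v"
      unfolding Sum_any.expand_set *
      by (rule poly_mapping_eqI) (simp add: lookup_sum lookup_single when_def in_keys_iff)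
  next
    fix f assume f: "(\<forall>i. f i \<in> laurent_grading i) \<and> finite {i. f i \<noteq> 0} \<and> Sum_any f = v"
    have "\<forall>i. \<exists>c. f i = Poly_Mapping.single i c" using f by (auto simp: laurent_grading_def)
    then obtain c where c: "\<And>i. f i = Poly_Mapping.single i (c i)" by metis
    have "Poly_Mapping.lookup v i = c i" for i
    proof -
      have "Poly_Mapping.lookup v i = (\<Sum>j | f j \<noteq> 0. Poly_Mapping.lookup (f j) i)"
        using f by (simp add: Sum_any.expand_set flip: lookup_sum) 
      also have "\<dots> = c i" using f c by (auto simp: c lookup_single when_def) (metis lookup_single_eq lookup_zero)
      finally show ?thesis .
    qed
    then show "f = (\<lambda>i. Poly_Mapping.single i (Poly_Mapping.lookup v i))" using c by auto
  qed
  have fd: "fin_dim (sub laurent (laurent_grading i :: (int \<Rightarrow>\<^sub>0 'k) set))" for i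
    unfolding fin_dim_def
  proof (intro exI[of _ "{Poly_Mapping.single i 1}"] conjI)
    show "carr (sub laurent (laurent_grading i)) = module.span (scl (sub laurent (laurent_grading i)))  {Poly_Mapping.single i (1::'k)}"
      by (auto simp: sub_def laurent_def V.span_singleton laurent_grading_def)
  qed simp
  have nd: "p = 0" if "\<forall>q. laurent_form p q = 0" for p :: "int \<Rightarrow>\<^sub>0 'k"
  proof (rule poly_mapping_eqI)
    fix i
    have "laurent_form p (Poly_Mapping.single (-i) 1) = Poly_Mapping.lookup p i"
      unfolding laurent_form_Sum_any by (subst Sum_any.expand_superset[of "{i}"]) (auto simp: lookup_single when_def)
    then show "Poly_Mapping.lookup p i = Poly_Mapping.lookup 0 i" using that by simp
  qed
  show ?thesis
    unfolding quadratic_graded_comm_algebra_def graded_algebra_def graded_space_def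
    using sp gr fd nd laurent_form_bilinear vs_laurent
    apply (auto simp: is_space_def laurent_def)
       apply (auto simp: bilinear_map_def linear_map_def algebra_simps sc)[1]
      apply (auto simp: laurent_grading_def mult_single)[1]
    apply (auto simp: laurent_form_mult algebra_simps)[2]
    apply (rule exI[of _ 0]) apply (auto simp: laurent_grading_def laurent_form_mult mult_single lookup_single)
    done
qed

lemma laurent_coproduct: "bar_coproduct (laurent :: ('k::field, _) space) laurent_grading (*) laurent_form
  (\<lambda>p i j. fscale (Poly_Mapping.lookup p (i + j))
     (tens (sub laurent (laurent_grading i)) (sub laurent (laurent_grading j))
        (Poly_Mapping.single i 1) (Poly_Mapping.single j 1)))"
proof -
  let ?t = "\<lambda>i. Poly_Mapping.single i (1::'k)"
  let ?S = "\<lambda>i. sub (laurent :: ('k, _) space) (laurent_grading i)"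
  have inS: "?t i \<in> carr (?S i)" for i by (auto simp: sub_def laurent_grading_def)
  have lt: "laurent_form (?t i) q = Poly_Mapping.lookup q (-i)" for i q
    by (simp add: laurent_form_def lookup_single when_def)
  have bil: "bilinear_map (?S i) (?S j) scalars (\<lambda>u v. laurent_form u q * laurent_form v r)" for i j q r
    using laurent_form_bilinear[where 'a='k]
    by (auto simp: bilinear_map_def linear_map_def sub_def laurent_def scalars_def algebra_simps)
  have main: "bar_pairing laurent_form (\<lambda>i j. fscale (Poly_Mapping.lookup p (i + j)) (tens (?S i) (?S j) (?t i) (?t j))) q r
     = laurent_form p (q * r)" for p q r :: "int \<Rightarrow>\<^sub>0 'k"
  proof -
    have "bar_pairing laurent_form (\<lambda>i j. fscale (Poly_Mapping.lookup p (i + j)) (tens (?S i) (?S j) (?t i) (?t j))) q r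
      = Sum_any (\<lambda>(i,j). Poly_Mapping.lookup p (i+j) * (Poly_Mapping.lookup q (-i) * Poly_Mapping.lookup r (-j)))"
      unfolding bar_pairing_def by (simp add: fscale_def tens_def bil lt)
    also have "\<dots> = (\<Sum>(i,j)\<in>uminus ` Poly_Mapping.keys q \<times> uminus ` Poly_Mapping.keys r. Poly_Mapping.lookup p (i+j) * (Poly_Mapping.lookup q (-i) * Poly_Mapping.lookup r (-j)))"
      by (rule Sum_any.expand_superset) (auto simp: in_keys_iff image_iff intro!: bexI[of _ "- _"])
    also have "\<dots> = (\<Sum>i\<in>Poly_Mapping.keys q. \<Sum>j\<in>Poly_Mapping.keys r. Poly_Mapping.lookup p (-i-j) * (Poly_Mapping.lookup q i * Poly_Mapping.lookup r j))"
      by (simp add: sum.cartesian_product[symmetric] sum.reindex)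
    also have "\<dots> = Poly_Mapping.lookup (p * (q * r)) 0"
    proof -
      have e: "q = (\<Sum>i\<in>Poly_Mapping.keys q. Poly_Mapping.single i (Poly_Mapping.lookup q i))" for q :: "int \<Rightarrow>\<^sub>0 'k"
        by (rule poly_mapping_eqI) (simp add: lookup_sum lookup_single when_def in_keys_iff)
      have m: "Poly_Mapping.lookup (p * Poly_Mapping.single i c) 0 = Poly_Mapping.lookup p (-i) * c" for i c
        unfolding laurent_form_mult[symmetric] laurent_form_Sum_any 
        by (subst Sum_any.expand_superset[of "{-i}"]) (auto simp: lookup_single when_def)
      have "q * r = (\<Sum>i\<in>Poly_Mapping.keys q. \<Sum>j\<in>Poly_Mapping.keys r. Poly_Mapping.single (i+j) (Poly_Mapping.lookup q i * Poly_Mapping.lookup r j))"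
        by (subst e[of q], subst e[of r]) (simp add: sum_product mult_single)
      then show ?thesis by (simp add: sum_distrib_left lookup_sum m)
    qed
    finally show ?thesis unfolding laurent_form_mult .
  qed
  interpret T: vector_space "fscale :: 'k \<Rightarrow> (((int \<Rightarrow>\<^sub>0 'k) \<Rightarrow> (int \<Rightarrow>\<^sub>0 'k) \<Rightarrow> 'k) \<Rightarrow> 'k) \<Rightarrow> _"
    by (rule vector_space_fscale)
  have "fscale c (tens (?S i) (?S j) (?t i) (?t j)) \<in> carr (tensor_space (?S i) (?S j))" for i j c
    unfolding tensor_space_def space.simps by (rule T.span_scale, rule T.span_base) (use inS in blast)
  then show ?thesis unfolding bar_coproduct_def linear_map_def using main
    by (auto simp: ctensor_space_def laurent_def lookup_add fscale_def algebra_simps lookup_laurent_scale fun_eq_iff)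
qed

end

(*
  The dual of the invariant form makes C a completed cocommutative coalgebra for the coproduct D,
  whose coproduct is moreover C-linear: multiplying either leg of D(c) by z gives D(cz). Both facts
  follow from nondegeneracy, since a tensor in C_p (x) C_q is determined by its pairings with
  products of homogeneous elements. Consequently every term of an axiom for A (x) C, evaluated at
  a1 (x) c1 and a2 (x) c2, is the bullet product of the corresponding term for A with one and the
  same element D(c1 c2) (or, for the coalgebra axiom, with the iterated coproduct of c), so the
  axiom for A (x) C is the axiom for A tensored with that element. For Laurent polynomials the
  constant-term map A[t, t^-1] -> A recovers the axiom for A from the case c1 = c2 = 1.
*)

theory Submission
  imports Defs
begin

section \<open>Linear maps\<close>

text \<open>The delicate point is infinite sums. \<open>Sum_any\<close> returns 0 on an infinite
  support, so a termwise map is additive only once finiteness is known, while \<open>D c\<close> is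
  known only through its pairings. Finiteness is obtained by duality: G p is finite-dimensional and
  \<omega> pairs it nondegenerately with G (- p - d), where d is the degree of the form, so finitely
  many pairings detect an element of the (p, q) component. Each pairing involves finitely many
  degrees, hence so does the component. For the same reason the axioms are not extended from pure
  tensors as bare equations: the inductions carry support conditions along
  (\<open>cmap_sums\<close>, \<open>compat1\<close>, \<open>compat2\<close>). A second constraint is
  the encoding. A tensor is a functional that vanishes off multilinear forms, so every evaluation
  needs a proof that the form is multilinear, and separating the A-variables from the C-variables is
  an interchange of two finite contractions (\<open>tensor_swap\<close>). The axioms are computed as
  identities for their left-hand sides, without assuming that these vanish; one computation thus
  serves both directions of the equivalence.\<close>

lemma space_closed:
  assumes "is_space V"
  shows space_zero: "0 \<in> carr V"
    and space_add: "x \<in> carr V \<Longrightarrow> y \<in> carr V \<Longrightarrow> x + y \<in> carr V"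
    and space_scale: "x \<in> carr V \<Longrightarrow> scl V c x \<in> carr V"
    and space_diff: "x \<in> carr V \<Longrightarrow> y \<in> carr V \<Longrightarrow> x - y \<in> carr V"
    and space_sum: "(\<And>k. k \<in> K \<Longrightarrow> f k \<in> carr V) \<Longrightarrow> sum f K \<in> carr V"
proof -
  interpret vector_space "scl V" using assms by (simp add: is_space_def)
  have S: "subspace (carr V)" using assms by (simp add: is_space_def)
  show "0 \<in> carr V" using S by (rule subspace_0)
  show "x \<in> carr V \<Longrightarrow> y \<in> carr V \<Longrightarrow> x + y \<in> carr V" using S by (rule subspace_add)
  show "x \<in> carr V \<Longrightarrow> scl V c x \<in> carr V" using S by (rule subspace_scale)
  show "x \<in> carr V \<Longrightarrow> y \<in> carr V \<Longrightarrow> x - y \<in> carr V" using S by (rule subspace_diff)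
  show "(\<And>k. k \<in> K \<Longrightarrow> f k \<in> carr V) \<Longrightarrow> sum f K \<in> carr V" using S by (rule subspace_sum)
qed

lemma scl_sub [simp]: "scl (sub V S) = scl V"
  by (simp add: sub_def)

lemma carr_sub [simp]: "carr (sub V S) = S"
  by (simp add: sub_def)

lemma scl_scalars [simp]: "scl scalars = (*)"
  by (simp add: scalars_def)

lemma carr_scalars [simp]: "carr scalars = UNIV"
  by (simp add: scalars_def)

lemma scl_fun_space [simp]: "scl fun_space = fscale"
  by (simp add: fun_space_def)

lemma carr_fun_space [simp]: "carr fun_space = UNIV"
  by (simp add: fun_space_def)

lemma scl_tensor_space [simp]: "scl (tensor_space U V) = fscale"
  by (simp add: tensor_space_def)

lemma is_space_sub:
  "is_space V \<Longrightarrow> module.subspace (scl V) S \<Longrightarrow> is_space (sub V S)"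
  by (simp add: is_space_def)

lemma linear_mapI:
  assumes "\<And>x. x \<in> carr V \<Longrightarrow> f x \<in> carr W"
    and "\<And>x y. x \<in> carr V \<Longrightarrow> y \<in> carr V \<Longrightarrow> f (x + y) = f x + f y"
    and "\<And>c x. x \<in> carr V \<Longrightarrow> f (scl V c x) = scl W c (f x)"
  shows "linear_map V W f"
  using assms by (simp add: linear_map_def)

lemma linear_map_in: "linear_map V W f \<Longrightarrow> x \<in> carr V \<Longrightarrow> f x \<in> carr W"
  and linear_map_add: "linear_map V W f \<Longrightarrow> x \<in> carr V \<Longrightarrow> y \<in> carr V \<Longrightarrow> f (x + y) = f x + f y"
  and linear_map_scale: "linear_map V W f \<Longrightarrow> x \<in> carr V \<Longrightarrow> f (scl V c x) = scl W c (f x)"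
  by (simp_all add: linear_map_def)

lemma linear_map_zero:
  assumes "linear_map V W f" "is_space V"
  shows "f 0 = 0"
proof -
  have "f (0 + 0) = f 0 + f 0"
    by (rule linear_map_add[OF assms(1)]) (rule space_zero[OF assms(2)])+
  then show ?thesis by simp
qed

lemma linear_map_sum:
  assumes "linear_map V W f" "is_space V" "\<And>k. k \<in> K \<Longrightarrow> x k \<in> carr V"
  shows "f (sum x K) = (\<Sum>k\<in>K. f (x k))"
  using assms(3)
proof (induction K rule: infinite_finite_induct)
  case (insert k K)
  then show ?case
    by (simp add: linear_map_add[OF assms(1)] space_sum[OF assms(2)])
qed (simp_all add: linear_map_zero[OF assms(1,2)])

lemma linear_map_compose: "linear_map V W g \<Longrightarrow> linear_map U V f \<Longrightarrow> linear_map U W (\<lambda>x. g (f x))"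
  by (simp add: linear_map_def)

lemma linear_map_cong:
  "(\<And>x. x \<in> carr V \<Longrightarrow> f x = g x) \<Longrightarrow> is_space V \<Longrightarrow> linear_map V W f \<Longrightarrow> linear_map V W g"
  by (simp add: linear_map_def space_add space_scale)

text \<open>Every tensor product here consists of scalar-valued functions, so linearity of a map
  into one can be tested after evaluation at each point. Most later linearity proofs are thereby
  about scalars.\<close>

lemma linear_map_fun_space:
  "linear_map V fun_space f \<longleftrightarrow> (\<forall>y. linear_map V scalars (\<lambda>x. f x y))"
  by (auto simp: linear_map_def fscale_def fun_eq_iff)

lemma linear_map_to_fun_space:
  "linear_map V W f \<Longrightarrow> scl W = fscale \<Longrightarrow> linear_map V fun_space f"
  by (simp add: linear_map_def)

lemma linear_map_eval:
  "linear_map V W f \<Longrightarrow> scl W = fscale \<Longrightarrow> linear_map V scalars (\<lambda>x. f x y)"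
  using linear_map_to_fun_space linear_map_fun_space by blast

lemma linear_map_id: "linear_map V V (\<lambda>x. x)"
  by (simp add: linear_map_def)

lemma linear_map_plus:
  assumes "linear_map V W f" "linear_map V W g" "is_space W"
  shows "linear_map V W (\<lambda>x. f x + g x)"
proof -
  interpret vector_space "scl W" using assms(3) by (simp add: is_space_def)
  show ?thesis using assms by (auto simp: linear_map_def scale_right_distrib space_add)
qed

lemma linear_map_minus:
  assumes "linear_map V W f" "linear_map V W g" "is_space W"
  shows "linear_map V W (\<lambda>x. f x - g x)"
proof -
  interpret vector_space "scl W" using assms(3) by (simp add: is_space_def)
  show ?thesis using assms by (auto simp: linear_map_def scale_right_diff_distrib space_diff)
qed

lemma linear_map_mult_right: "linear_map V scalars f \<Longrightarrow> linear_map V scalars (\<lambda>x. f x * c)"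
  and linear_map_mult_left: "linear_map V scalars f \<Longrightarrow> linear_map V scalars (\<lambda>x. c * f x)"
  by (auto simp: linear_map_def algebra_simps)

lemma linear_map_scalars_sum:
  "(\<And>k. k \<in> K \<Longrightarrow> linear_map V scalars (f k)) \<Longrightarrow> linear_map V scalars (\<lambda>x. \<Sum>k\<in>K. f k x)"
  by (auto simp: linear_map_def sum.distrib sum_distrib_left)

lemma bilinear_mapI:
  assumes "\<And>u. u \<in> carr U \<Longrightarrow> linear_map V W (\<lambda>v. h u v)"
    and "\<And>v. v \<in> carr V \<Longrightarrow> linear_map U W (\<lambda>u. h u v)"
  shows "bilinear_map U V W h"
  using assms by (simp add: bilinear_map_def)

lemma bilinear_mapD:
  assumes "bilinear_map U V W h"
  shows bilinear_mapD1: "v \<in> carr V \<Longrightarrow> linear_map U W (\<lambda>u. h u v)"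
    and bilinear_mapD2: "u \<in> carr U \<Longrightarrow> linear_map V W (\<lambda>v. h u v)"
    and bilinear_map_in: "u \<in> carr U \<Longrightarrow> v \<in> carr V \<Longrightarrow> h u v \<in> carr W"
  using assms by (auto simp: bilinear_map_def linear_map_def)

lemma trilinear_mapI:
  assumes "\<And>u v. u \<in> carr U \<Longrightarrow> v \<in> carr V \<Longrightarrow> linear_map W X (\<lambda>w. h u v w)"
    and "\<And>u w. u \<in> carr U \<Longrightarrow> w \<in> carr W \<Longrightarrow> linear_map V X (\<lambda>v. h u v w)"
    and "\<And>v w. v \<in> carr V \<Longrightarrow> w \<in> carr W \<Longrightarrow> linear_map U X (\<lambda>u. h u v w)"
  shows "trilinear_map U V W X h"
  using assms by (simp add: trilinear_map_def bilinear_map_def)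

lemma trilinear_mapD:
  assumes "trilinear_map U V W X h"
  shows trilinear_mapD1: "v \<in> carr V \<Longrightarrow> w \<in> carr W \<Longrightarrow> linear_map U X (\<lambda>u. h u v w)"
    and trilinear_mapD2: "u \<in> carr U \<Longrightarrow> w \<in> carr W \<Longrightarrow> linear_map V X (\<lambda>v. h u v w)"
    and trilinear_mapD3: "u \<in> carr U \<Longrightarrow> v \<in> carr V \<Longrightarrow> linear_map W X (\<lambda>w. h u v w)"
    and trilinear_mapD12: "w \<in> carr W \<Longrightarrow> bilinear_map U V X (\<lambda>u v. h u v w)"
    and trilinear_mapD23: "u \<in> carr U \<Longrightarrow> bilinear_map V W X (\<lambda>v w. h u v w)"
  using assms by (auto simp: bilinear_map_def trilinear_map_def)

lemma bilinear_map_fun_space: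
  "bilinear_map U V fun_space h \<longleftrightarrow> (\<forall>y. bilinear_map U V scalars (\<lambda>u v. h u v y))"
  by (auto simp: bilinear_map_def linear_map_fun_space)

text \<open>Only values on carriers matter. With the bilinear and trilinear versions below,
  functions that agree on carriers are multilinear together or not at all, which is needed because a
  tensor sends a non-multilinear function to 0.\<close>

lemma linear_map_cong_iff:
  assumes "is_space V" "\<And>x. x \<in> carr V \<Longrightarrow> f x = g x"
  shows "linear_map V W f \<longleftrightarrow> linear_map V W g"
  using linear_map_cong[of V f g W] linear_map_cong[of V g f W] assms by auto

lemma bilinear_map_cong_iff:
  assumes "is_space U" "is_space V"
    and "\<And>u v. u \<in> carr U \<Longrightarrow> v \<in> carr V \<Longrightarrow> h u v = h' u v"
  shows "bilinear_map U V W h \<longleftrightarrow> bilinear_map U V W h'"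
  unfolding bilinear_map_def
  by (intro arg_cong2[where f = "(\<and>)"] ball_cong refl linear_map_cong_iff) (use assms in auto)

lemma trilinear_map_cong_iff:
  assumes "is_space U" "is_space V" "is_space W"
    and "\<And>u v w. u \<in> carr U \<Longrightarrow> v \<in> carr V \<Longrightarrow> w \<in> carr W \<Longrightarrow> h u v w = h' u v w"
  shows "trilinear_map U V W X h \<longleftrightarrow> trilinear_map U V W X h'"
  unfolding trilinear_map_def
  by (intro arg_cong2[where f = "(\<and>)"] ball_cong refl linear_map_cong_iff bilinear_map_cong_iff)
    (use assms in auto)

section \<open>Evaluating tensors on multilinear forms\<close>

text \<open>The common codomain of \<open>cop_left\<close>, \<open>cop_right\<close> and
  \<open>flip_left\<close>. Membership in this span makes a functional a finite combination of
  evaluations, hence amenable to congruence and interchange.\<close>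

definition tensor3_space ::
  "('k::field, 'u::ab_group_add) space \<Rightarrow> ('k, 'v::ab_group_add) space \<Rightarrow>
   ('k, 'w::ab_group_add) space \<Rightarrow> ('k, ('k, 'u, 'v, 'w) tensor3) space" where
  "tensor3_space U V W =
     \<lparr>scl = fscale,
      carr = module.span fscale
        {tens3 U V W u v w |u v w. u \<in> carr U \<and> v \<in> carr V \<and> w \<in> carr W}\<rparr>"

lemma scl_tensor3_space [simp]: "scl (tensor3_space U V W) = fscale"
  by (simp add: tensor3_space_def)

lemma is_space_tensor3_space:
  fixes U :: "('k::field, 'u::ab_group_add) space" and V :: "('k, 'v::ab_group_add) space"
    and W :: "('k, 'w::ab_group_add) space"
  shows "is_space (tensor3_space U V W)"
proof -
  interpret vector_space "fscale :: 'k \<Rightarrow> (('u \<Rightarrow> 'v \<Rightarrow> 'w \<Rightarrow> 'k) \<Rightarrow> 'k) \<Rightarrow> _"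
    by (rule vector_space_fscale)
  show ?thesis
    by (simp add: is_space_def tensor3_space_def vector_space_fscale)
qed

section \<open>Pure tensors and induction on tensors\<close>

lemma tens_in: "u \<in> carr U \<Longrightarrow> v \<in> carr V \<Longrightarrow> tens U V u v \<in> carr (tensor_space U V)"
  using bilinear_map_in[OF tens_bilinear] .

lemma tens3_in:
  fixes U :: "('k::field, 'u::ab_group_add) space" and V :: "('k, 'v::ab_group_add) space"
    and W :: "('k, 'w::ab_group_add) space"
  assumes "u \<in> carr U" "v \<in> carr V" "w \<in> carr W"
  shows "tens3 U V W u v w \<in> carr (tensor3_space U V W)"
proof -
  interpret vector_space "fscale :: 'k \<Rightarrow> (('u \<Rightarrow> 'v \<Rightarrow> 'w \<Rightarrow> 'k) \<Rightarrow> 'k) \<Rightarrow> _"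
    by (rule vector_space_fscale)
  show ?thesis using assms by (auto simp: tensor3_space_def intro: span_base)
qed

lemma tens_add_left:
  "u \<in> carr U \<Longrightarrow> u' \<in> carr U \<Longrightarrow> v \<in> carr V \<Longrightarrow> tens U V (u + u') v = tens U V u v + tens U V u' v"
  and tens_add_right:
  "u \<in> carr U \<Longrightarrow> v \<in> carr V \<Longrightarrow> v' \<in> carr V \<Longrightarrow> tens U V u (v + v') = tens U V u v + tens U V u v'"
  and tens_scale_left:
  "u \<in> carr U \<Longrightarrow> v \<in> carr V \<Longrightarrow> tens U V (scl U c u) v = fscale c (tens U V u v)"
  and tens_scale_right:
  "u \<in> carr U \<Longrightarrow> v \<in> carr V \<Longrightarrow> tens U V u (scl V c v) = fscale c (tens U V u v)"
  using tens_bilinear[of U V] by (auto simp: bilinear_map_def linear_map_def)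

lemma tens_zero_left: "is_space U \<Longrightarrow> v \<in> carr V \<Longrightarrow> tens U V 0 v = 0"
  using linear_map_zero[OF bilinear_mapD1[OF tens_bilinear]] by blast

lemma tens_zero_right: "is_space V \<Longrightarrow> u \<in> carr U \<Longrightarrow> tens U V u 0 = 0"
  using linear_map_zero[OF bilinear_mapD2[OF tens_bilinear]] by blast

text \<open>The span of \<open>u \<otimes> v\<close> with \<open>v\<close> in a subset, so that the rule also covers the pieces \<open>A \<otimes> C\<^sub>i\<close>.\<close>

lemma tens_span_induct [consumes 4, case_names tens add]:
  fixes U :: "('k::field, 'u::ab_group_add) space" and V :: "('k, 'v::ab_group_add) space"
  assumes x: "x \<in> module.span fscale {tens U V u v |u v. u \<in> carr U \<and> v \<in> M}"
    and U: "is_space U" and M: "M \<subseteq> carr V" "0 \<in> M"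
    and tens: "\<And>u v. u \<in> carr U \<Longrightarrow> v \<in> M \<Longrightarrow> P (tens U V u v)"
    and add: "\<And>x y. x \<in> module.span fscale {tens U V u v |u v. u \<in> carr U \<and> v \<in> M} \<Longrightarrow>
       y \<in> module.span fscale {tens U V u v |u v. u \<in> carr U \<and> v \<in> M} \<Longrightarrow>
       P x \<Longrightarrow> P y \<Longrightarrow> P (x + y)"
  shows "P x"
proof -
  interpret vector_space "fscale :: 'k \<Rightarrow> (('u \<Rightarrow> 'v \<Rightarrow> 'k) \<Rightarrow> 'k) \<Rightarrow> _"
    by (rule vector_space_fscale)
  let ?S = "{tens U V u v |u v. u \<in> carr U \<and> v \<in> M}"
  from x have "x \<in> span ?S \<and> P x"
  proof (induction rule: span_induct_alt)
    case base
    have "tens U V 0 0 = 0" by (rule tens_zero_left[OF U]) (use M in blast)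
    then have "P 0" using tens[of 0 0] M space_zero[OF U] by simp
    then show ?case using span_zero by blast
  next
    case (step c x y)
    then obtain u v where x: "x = tens U V u v" "u \<in> carr U" "v \<in> M" by auto
    have "fscale c x = tens U V (scl U c u) v" using x M by (auto simp: tens_scale_left)
    moreover have "scl U c u \<in> carr U" using x U by (auto intro: space_scale)
    ultimately have "fscale c x \<in> span ?S \<and> P (fscale c x)"
      using x tens by (auto intro: span_base)
    then show ?case using add step span_add by blast
  qed
  then show ?thesis by simp
qed

lemma tensor_induct [consumes 3, case_names tens add]:
  fixes U :: "('k::field, 'u::ab_group_add) space" and V :: "('k, 'v::ab_group_add) space"
  assumes "x \<in> carr (tensor_space U V)" "is_space U" "is_space V"
    and "\<And>u v. u \<in> carr U \<Longrightarrow> v \<in> carr V \<Longrightarrow> P (tens U V u v)"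
    and "\<And>x y. x \<in> carr (tensor_space U V) \<Longrightarrow> y \<in> carr (tensor_space U V) \<Longrightarrow>
       P x \<Longrightarrow> P y \<Longrightarrow> P (x + y)"
  shows "P x"
  using tens_span_induct[of x U V "carr V" P] assms space_zero[of V] by (simp add: tensor_space_def)

lemma tensor_evalE:
  fixes U :: "('k::field, 'u::ab_group_add) space" and V :: "('k, 'v::ab_group_add) space"
  assumes "t \<in> carr (tensor_space U V)"
  obtains n :: nat and c u v where "\<And>k. k < n \<Longrightarrow> u k \<in> carr U" "\<And>k. k < n \<Longrightarrow> v k \<in> carr V"
    "t = (\<Sum>k<n. fscale (c k) (tens U V (u k) (v k)))"
proof -
  interpret vector_space "fscale :: 'k \<Rightarrow> (('u \<Rightarrow> 'v \<Rightarrow> 'k) \<Rightarrow> 'k) \<Rightarrow> _"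
    by (rule vector_space_fscale)
  let ?S = "{tens U V u v |u v. u \<in> carr U \<and> v \<in> carr V}"
  have "t \<in> span ?S" using assms by (simp add: tensor_space_def)
  then have "\<exists>n c u v. (\<forall>k<n. u k \<in> carr U \<and> v k \<in> carr V) \<and>
     t = (\<Sum>k<n::nat. fscale (c k) (tens U V (u k) (v k)))"
  proof (induction rule: span_induct_alt)
    case base
    show ?case by (rule exI[of _ 0]) simp
  next
    case (step a x y)
    then obtain u' v' where x: "x = tens U V u' v'" "u' \<in> carr U" "v' \<in> carr V" by auto
    from step obtain n c u v where *: "\<forall>k<n. u k \<in> carr U \<and> v k \<in> carr V"
      "y = (\<Sum>k<n::nat. fscale (c k) (tens U V (u k) (v k)))" by blast
    show ?case
      by (rule exI[of _ "Suc n"], rule exI[of _ "c(n := a)"], rule exI[of _ "u(n := u')"],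
          rule exI[of _ "v(n := v')"]) (use x * in \<open>auto simp: less_Suc_eq\<close>)
  qed
  then show ?thesis using that by blast
qed

lemma sum_fun_apply: "sum f K y = (\<Sum>k\<in>K. f k y)"
  by (induction K rule: infinite_finite_induct) auto

text \<open>On forms, a finite sum of pure tensors becomes an ordinary finite sum of scalars. The
  vanishing clause comes from the encoding; it reduces equality of tensors to a check on bilinear
  forms.\<close>

lemma tensor_formE:
  fixes U :: "('k::field, 'u::ab_group_add) space" and V :: "('k, 'v::ab_group_add) space"
  assumes "t \<in> carr (tensor_space U V)"
  obtains n :: nat and c u v where "\<And>k. k < n \<Longrightarrow> u k \<in> carr U" "\<And>k. k < n \<Longrightarrow> v k \<in> carr V"
    "\<And>\<beta>. bilinear_map U V scalars \<beta> \<Longrightarrow> t \<beta> = (\<Sum>k<n. c k * \<beta> (u k) (v k))"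
    "\<And>\<beta>. \<not> bilinear_map U V scalars \<beta> \<Longrightarrow> t \<beta> = 0"
proof -
  obtain n :: nat and c u v where *: "\<And>k. k < n \<Longrightarrow> u k \<in> carr U" "\<And>k. k < n \<Longrightarrow> v k \<in> carr V"
    "t = (\<Sum>k<n. fscale (c k) (tens U V (u k) (v k)))" by (rule tensor_evalE[OF assms], rule that, assumption+)
  show ?thesis
    by (rule that[of n u v c]) (use * in \<open>auto simp: sum_fun_apply fscale_def tens_def\<close>)
qed

lemma tensor3_evalE:
  fixes U :: "('k::field, 'u::ab_group_add) space" and V :: "('k, 'v::ab_group_add) space"
    and W :: "('k, 'w::ab_group_add) space"
  assumes "t \<in> carr (tensor3_space U V W)"
  obtains n :: nat and c u v w where "\<And>k. k < n \<Longrightarrow> u k \<in> carr U" "\<And>k. k < n \<Longrightarrow> v k \<in> carr V"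
    "\<And>k. k < n \<Longrightarrow> w k \<in> carr W"
    "t = (\<Sum>k<n. fscale (c k) (tens3 U V W (u k) (v k) (w k)))"
proof -
  interpret vector_space "fscale :: 'k \<Rightarrow> (('u \<Rightarrow> 'v \<Rightarrow> 'w \<Rightarrow> 'k) \<Rightarrow> 'k) \<Rightarrow> _"
    by (rule vector_space_fscale)
  let ?S = "{tens3 U V W u v w |u v w. u \<in> carr U \<and> v \<in> carr V \<and> w \<in> carr W}"
  have "t \<in> span ?S" using assms by (simp add: tensor3_space_def)
  then have "\<exists>n c u v w. (\<forall>k<n. u k \<in> carr U \<and> v k \<in> carr V \<and> w k \<in> carr W) \<and>
     t = (\<Sum>k<n::nat. fscale (c k) (tens3 U V W (u k) (v k) (w k)))"
  proof (induction rule: span_induct_alt)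
    case base
    show ?case by (rule exI[of _ 0]) simp
  next
    case (step a x y)
    then obtain u' v' w' where x: "x = tens3 U V W u' v' w'" "u' \<in> carr U" "v' \<in> carr V" "w' \<in> carr W"
      by auto
    from step obtain n c u v w where *: "\<forall>k<n. u k \<in> carr U \<and> v k \<in> carr V \<and> w k \<in> carr W"
      "y = (\<Sum>k<n::nat. fscale (c k) (tens3 U V W (u k) (v k) (w k)))" by blast
    show ?case
      by (rule exI[of _ "Suc n"], rule exI[of _ "c(n := a)"], rule exI[of _ "u(n := u')"],
          rule exI[of _ "v(n := v')"], rule exI[of _ "w(n := w')"])
        (use x * in \<open>auto simp: less_Suc_eq\<close>)
  qed
  then show ?thesis using that by blast
qed

lemma tensor_formE3:
  fixes U :: "('k::field, 'u::ab_group_add) space" and V :: "('k, 'v::ab_group_add) space"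
    and W :: "('k, 'w::ab_group_add) space"
  assumes "t \<in> carr (tensor3_space U V W)"
  obtains n :: nat and c u v w where "\<And>k. k < n \<Longrightarrow> u k \<in> carr U" "\<And>k. k < n \<Longrightarrow> v k \<in> carr V"
    "\<And>k. k < n \<Longrightarrow> w k \<in> carr W"
    "\<And>\<beta>. trilinear_map U V W scalars \<beta> \<Longrightarrow> t \<beta> = (\<Sum>k<n. c k * \<beta> (u k) (v k) (w k))"
    "\<And>\<beta>. \<not> trilinear_map U V W scalars \<beta> \<Longrightarrow> t \<beta> = 0"
proof -
  obtain n :: nat and c u v w where *: "\<And>k. k < n \<Longrightarrow> u k \<in> carr U" "\<And>k. k < n \<Longrightarrow> v k \<in> carr V"
    "\<And>k. k < n \<Longrightarrow> w k \<in> carr W"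
    "t = (\<Sum>k<n. fscale (c k) (tens3 U V W (u k) (v k) (w k)))"
    by (rule tensor3_evalE[OF assms], rule that, assumption+)
  show ?thesis
    by (rule that[of n u v w c]) (use * in \<open>auto simp: sum_fun_apply fscale_def tens3_def\<close>)
qed

section \<open>Congruence, parameters and interchange of contractions\<close>

lemma tensor_zero_form [simp]: "t \<in> carr (tensor_space U V) \<Longrightarrow> t (\<lambda>u v. 0) = 0"
  by (elim tensor_formE) (auto simp: bilinear_map_def linear_map_def)

lemma tensor3_zero_form [simp]: "t \<in> carr (tensor3_space U V W) \<Longrightarrow> t (\<lambda>u v w. 0) = 0"
  by (elim tensor_formE3) (auto simp: trilinear_map_def bilinear_map_def linear_map_def)

text \<open>The two functions are bilinear together or not at all: in the first case finitely many
  carrier vectors decide, in the second both values are 0. It permits rewriting under a tensor with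
  the bound variables known to lie in the carriers.\<close>

lemma tensor_cong:
  assumes "t \<in> carr (tensor_space U V)" "is_space U" "is_space V"
    and "\<And>u v. u \<in> carr U \<Longrightarrow> v \<in> carr V \<Longrightarrow> \<beta> u v = \<beta>' u v"
  shows "t \<beta> = t \<beta>'"
  using assms(1)
proof (rule tensor_formE)
  fix n :: nat and c u v
  assume *: "\<And>k. k < n \<Longrightarrow> u k \<in> carr U" "\<And>k. k < n \<Longrightarrow> v k \<in> carr V"
    "\<And>\<beta>. bilinear_map U V scalars \<beta> \<Longrightarrow> t \<beta> = (\<Sum>k<n. c k * \<beta> (u k) (v k))"
    "\<And>\<beta>. \<not> bilinear_map U V scalars \<beta> \<Longrightarrow> t \<beta> = 0"
  have "bilinear_map U V scalars \<beta> \<longleftrightarrow> bilinear_map U V scalars \<beta>'"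
    by (rule bilinear_map_cong_iff) (use assms in auto)
  moreover have "(\<Sum>k<n. c k * \<beta> (u k) (v k)) = (\<Sum>k<n. c k * \<beta>' (u k) (v k))"
    using * assms(4) by simp
  ultimately show ?thesis using *(3,4)[of \<beta>] *(3,4)[of \<beta>'] by (cases "bilinear_map U V scalars \<beta>") auto
qed

lemma tensor3_cong:
  assumes "t \<in> carr (tensor3_space U V W)" "is_space U" "is_space V" "is_space W"
    and "\<And>u v w. u \<in> carr U \<Longrightarrow> v \<in> carr V \<Longrightarrow> w \<in> carr W \<Longrightarrow> \<beta> u v w = \<beta>' u v w"
  shows "t \<beta> = t \<beta>'"
  using assms(1)
proof (rule tensor_formE3)
  fix n :: nat and c u v w
  assume *: "\<And>k. k < n \<Longrightarrow> u k \<in> carr U" "\<And>k. k < n \<Longrightarrow> v k \<in> carr V" "\<And>k. k < n \<Longrightarrow> w k \<in> carr W"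
    "\<And>\<beta>. trilinear_map U V W scalars \<beta> \<Longrightarrow> t \<beta> = (\<Sum>k<n. c k * \<beta> (u k) (v k) (w k))"
    "\<And>\<beta>. \<not> trilinear_map U V W scalars \<beta> \<Longrightarrow> t \<beta> = 0"
  have "trilinear_map U V W scalars \<beta> \<longleftrightarrow> trilinear_map U V W scalars \<beta>'"
    by (rule trilinear_map_cong_iff) (use assms in auto)
  moreover have "(\<Sum>k<n. c k * \<beta> (u k) (v k) (w k)) = (\<Sum>k<n. c k * \<beta>' (u k) (v k) (w k))"
    using * assms(5) by simp
  ultimately show ?thesis using *(4,5)[of \<beta>] *(4,5)[of \<beta>']
    by (cases "trilinear_map U V W scalars \<beta>") auto
qed

text \<open>For a fixed representation of \<open>t\<close> the value is a finite combination of the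
  scalars \<open>h p u v\<close>, each linear in p. Bilinearity of every \<open>h p\<close> guards
  against the default value 0, which could break linearity in p.\<close>

lemma tensor_param_linear:
  assumes t: "t \<in> carr (tensor_space U V)" and P: "is_space P"
    and h: "\<And>p. p \<in> carr P \<Longrightarrow> bilinear_map U V scalars (h p)"
    and l: "\<And>u v. u \<in> carr U \<Longrightarrow> v \<in> carr V \<Longrightarrow> linear_map P scalars (\<lambda>p. h p u v)"
  shows "linear_map P scalars (\<lambda>p. t (h p))"
  using t
proof (rule tensor_formE)
  fix n :: nat and c u v
  assume *: "\<And>k. k < n \<Longrightarrow> u k \<in> carr U" "\<And>k. k < n \<Longrightarrow> v k \<in> carr V"
    "\<And>\<beta>. bilinear_map U V scalars \<beta> \<Longrightarrow> t \<beta> = (\<Sum>k<n. c k * \<beta> (u k) (v k))"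
  have "linear_map P scalars (\<lambda>p. \<Sum>k<n. c k * h p (u k) (v k))"
    by (intro linear_map_scalars_sum linear_map_mult_left l *) auto
  then show ?thesis by (rule linear_map_cong[rotated 2]) (use * h P in auto)
qed

lemma tensor3_param_linear:
  assumes t: "t \<in> carr (tensor3_space U V W)" and P: "is_space P"
    and h: "\<And>p. p \<in> carr P \<Longrightarrow> trilinear_map U V W scalars (h p)"
    and l: "\<And>u v w. u \<in> carr U \<Longrightarrow> v \<in> carr V \<Longrightarrow> w \<in> carr W \<Longrightarrow> linear_map P scalars (\<lambda>p. h p u v w)"
  shows "linear_map P scalars (\<lambda>p. t (h p))"
  using t
proof (rule tensor_formE3)
  fix n :: nat and c u v w
  assume *: "\<And>k. k < n \<Longrightarrow> u k \<in> carr U" "\<And>k. k < n \<Longrightarrow> v k \<in> carr V" "\<And>k. k < n \<Longrightarrow> w k \<in> carr W"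
    "\<And>\<beta>. trilinear_map U V W scalars \<beta> \<Longrightarrow> t \<beta> = (\<Sum>k<n. c k * \<beta> (u k) (v k) (w k))"
  have "linear_map P scalars (\<lambda>p. \<Sum>k<n. c k * h p (u k) (v k) (w k))"
    by (intro linear_map_scalars_sum linear_map_mult_left l *) auto
  then show ?thesis by (rule linear_map_cong[rotated 2]) (use * h P in auto)
qed

lemma is_space_scalars: "is_space (scalars :: ('k::field, 'k) space)"
proof -
  interpret vector_space "(*) :: 'k \<Rightarrow> 'k \<Rightarrow> 'k" by unfold_locales (auto simp: algebra_simps)
  show ?thesis by (simp add: is_space_def vector_space_axioms)
qed

lemma tensor_form_add:
  assumes "t \<in> carr (tensor_space U V)" "bilinear_map U V scalars \<beta>" "bilinear_map U V scalars \<beta>'"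
  shows "t (\<lambda>u v. \<beta> u v + \<beta>' u v) = t \<beta> + t \<beta>'"
proof -
  have "bilinear_map U V scalars (\<lambda>u v. \<beta> u v + \<beta>' u v)"
    using assms(2,3) by (auto simp: bilinear_map_def intro!: linear_map_plus is_space_scalars)
  then show ?thesis
    using assms by (elim tensor_formE) (simp add: algebra_simps sum.distrib)
qed

lemma tensor_form_mult:
  assumes "t \<in> carr (tensor_space U V)" "bilinear_map U V scalars \<beta>"
  shows "t (\<lambda>u v. c * \<beta> u v) = c * t \<beta>"
proof -
  have "bilinear_map U V scalars (\<lambda>u v. c * \<beta> u v)"
    using assms(2) by (auto simp: bilinear_map_def intro!: linear_map_mult_left)
  then show ?thesis
    using assms by (elim tensor_formE) (simp add: algebra_simps sum_distrib_left)
qed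

text \<open>Fubini for two finite contractions: both sides are the same double sum over
  representations of \<open>t\<close> and \<open>s\<close>. The partial contractions must themselves
  be bilinear, or the outer tensor would return 0.\<close>

lemma tensor_swap:
  assumes t: "t \<in> carr (tensor_space U V)" and s: "s \<in> carr (tensor_space W X)"
    and sp: "is_space U" "is_space V" "is_space W" "is_space X"
    and h1: "\<And>u v. u \<in> carr U \<Longrightarrow> v \<in> carr V \<Longrightarrow> bilinear_map W X scalars (h u v)"
    and h2: "\<And>w x. w \<in> carr W \<Longrightarrow> x \<in> carr X \<Longrightarrow> bilinear_map U V scalars (\<lambda>u v. h u v w x)"
  shows "t (\<lambda>u v. s (h u v)) = s (\<lambda>w x. t (\<lambda>u v. h u v w x))"
proof -
  have b1: "bilinear_map U V scalars (\<lambda>u v. s (h u v))"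
    by (intro bilinear_mapI tensor_param_linear[OF s] sp h1)
      (use h2 in \<open>auto simp: bilinear_map_def\<close>)
  have b2: "bilinear_map W X scalars (\<lambda>w x. t (\<lambda>u v. h u v w x))"
    by (intro bilinear_mapI tensor_param_linear[OF t] sp h2)
      (use h1 in \<open>auto simp: bilinear_map_def\<close>)
  obtain n c u v where *: "\<And>k. k < n \<Longrightarrow> u k \<in> carr U" "\<And>k. k < n \<Longrightarrow> v k \<in> carr V"
    "\<And>\<beta>. bilinear_map U V scalars \<beta> \<Longrightarrow> t \<beta> = (\<Sum>k<n::nat. c k * \<beta> (u k) (v k))"
    by (rule tensor_formE[OF t], rule that, assumption+)
  obtain m d w x where **: "\<And>k. k < m \<Longrightarrow> w k \<in> carr W" "\<And>k. k < m \<Longrightarrow> x k \<in> carr X"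
    "\<And>\<beta>. bilinear_map W X scalars \<beta> \<Longrightarrow> s \<beta> = (\<Sum>k<m::nat. d k * \<beta> (w k) (x k))"
    by (rule tensor_formE[OF s], rule that, assumption+)
  have "t (\<lambda>u v. s (h u v)) = (\<Sum>k<n. c k * (\<Sum>l<m. d l * h (u k) (v k) (w l) (x l)))"
    using * ** b1 h1 by simp
  also have "\<dots> = (\<Sum>l<m. d l * (\<Sum>k<n. c k * h (u k) (v k) (w l) (x l)))"
    unfolding sum_distrib_left by (subst sum.swap) (simp add: mult.left_commute)
  also have "\<dots> = s (\<lambda>w x. t (\<lambda>u v. h u v w x))"
    using * ** b2 h2 by simp
  finally show ?thesis .
qed

section \<open>Target spaces of the induced maps\<close>

lemma tens_linear_left:
  assumes "linear_map P U f" "v \<in> carr V"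
  shows "linear_map P scalars (\<lambda>p. tens U V (f p) v \<beta>)"
  by (rule linear_map_eval[OF linear_map_compose[OF bilinear_mapD1[OF tens_bilinear] assms(1)]])
    (use assms in auto)

lemma tens_linear_right:
  assumes "linear_map P V f" "u \<in> carr U"
  shows "linear_map P scalars (\<lambda>p. tens U V u (f p) \<beta>)"
  by (rule linear_map_eval[OF linear_map_compose[OF bilinear_mapD2[OF tens_bilinear] assms(1)]])
    (use assms in auto)

lemma tens3_linear:
  shows tens3_linear1: "linear_map P U f \<Longrightarrow> v \<in> carr V \<Longrightarrow> w \<in> carr W \<Longrightarrow>
      linear_map P scalars (\<lambda>p. tens3 U V W (f p) v w \<gamma>)"
    and tens3_linear2: "linear_map P V g \<Longrightarrow> u \<in> carr U \<Longrightarrow> w \<in> carr W \<Longrightarrow>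
      linear_map P scalars (\<lambda>p. tens3 U V W u (g p) w \<gamma>)"
    and tens3_linear3: "linear_map P W h \<Longrightarrow> u \<in> carr U \<Longrightarrow> v \<in> carr V \<Longrightarrow>
      linear_map P scalars (\<lambda>p. tens3 U V W u v (h p) \<gamma>)"
  by (auto simp: tens3_def linear_map_def trilinear_map_def bilinear_map_def)

text \<open>By definition \<open>lift\<close> only lands in a function space. Writing
  \<open>t\<close> as a finite combination of pure tensors places the value in every subspace that
  contains the values of \<open>h\<close>.\<close>

lemma lift_in:
  assumes t: "t \<in> carr (tensor_space U V)"
    and h: "bilinear_map U V fun_space h"
    and W: "is_space W" "scl W = fscale"
    and hW: "\<And>u v. u \<in> carr U \<Longrightarrow> v \<in> carr V \<Longrightarrow> h u v \<in> carr W"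
  shows "lift h t \<in> carr W"
  using t
proof (rule tensor_evalE)
  fix n :: nat and c u v
  assume *: "\<And>k. k < n \<Longrightarrow> u k \<in> carr U" "\<And>k. k < n \<Longrightarrow> v k \<in> carr V"
    "t = (\<Sum>k<n. fscale (c k) (tens U V (u k) (v k)))"
  have b: "bilinear_map U V scalars (\<lambda>u v. h u v y)" for y
    using h by (simp add: bilinear_map_fun_space)
  have "lift h t = (\<Sum>k<n. fscale (c k) (h (u k) (v k)))"
    using * b by (auto simp: lift_def fun_eq_iff sum_fun_apply fscale_def tens_def)
  moreover have "\<dots> \<in> carr W"
    by (rule space_sum[OF W(1)]) (use * hW space_scale[OF W(1)] W(2) in auto)
  ultimately show ?thesis by simp
qed

lemma tensor_map_in:
  assumes "t \<in> carr (tensor_space P Q)" "linear_map P U f" "linear_map Q V g"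
  shows "tensor_map U V f g t \<in> carr (tensor_space U V)"
  unfolding tensor_map_def
proof (rule lift_in[OF assms(1) _ is_space_tensor_space])
  show "bilinear_map P Q fun_space (\<lambda>u v. tens U V (f u) (g v))"
    unfolding bilinear_map_fun_space
    by (intro allI bilinear_mapI tens_linear_left tens_linear_right linear_map_in[OF assms(2)]
        linear_map_in[OF assms(3)] assms)
qed (simp, intro tens_in linear_map_in[OF assms(2)] linear_map_in[OF assms(3)])

lemma tensor_flip_in:
  assumes "t \<in> carr (tensor_space V U)"
  shows "tensor_flip U V t \<in> carr (tensor_space U V)"
  unfolding tensor_flip_def
proof (rule lift_in[OF assms(1) _ is_space_tensor_space])
  show "bilinear_map V U fun_space (\<lambda>v u. tens U V u v)"
    unfolding bilinear_map_fun_space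
    by (intro allI bilinear_mapI tens_linear_left tens_linear_right linear_map_id)
qed (auto intro!: tens_in)

lemma tens3_embed_in:
  assumes "t \<in> carr (tensor_space U V)" "w \<in> carr W"
  shows "lift (\<lambda>u v. tens3 U V W u v w) t \<in> carr (tensor3_space U V W)"
    and "lift (\<lambda>u v. tens3 W U V w u v) t \<in> carr (tensor3_space W U V)"
  by (rule lift_in[OF assms(1) _ is_space_tensor3_space],
      auto simp: bilinear_map_fun_space intro!: bilinear_mapI tens3_linear linear_map_id tens3_in assms)+

lemma lift3_in:
  assumes t: "t \<in> carr (tensor3_space U V X)"
    and h: "trilinear_map U V X fun_space h"
    and W: "is_space W" "scl W = fscale"
    and hW: "\<And>u v x. u \<in> carr U \<Longrightarrow> v \<in> carr V \<Longrightarrow> x \<in> carr X \<Longrightarrow> h u v x \<in> carr W"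
  shows "lift3 h t \<in> carr W"
  using t
proof (rule tensor3_evalE)
  fix n :: nat and c u v x
  assume *: "\<And>k. k < n \<Longrightarrow> u k \<in> carr U" "\<And>k. k < n \<Longrightarrow> v k \<in> carr V" "\<And>k. k < n \<Longrightarrow> x k \<in> carr X"
    "t = (\<Sum>k<n. fscale (c k) (tens3 U V X (u k) (v k) (x k)))"
  have b: "trilinear_map U V X scalars (\<lambda>u v x. h u v x y)" for y
    using h by (simp add: trilinear_map_def bilinear_map_def linear_map_fun_space)
  have "lift3 h t = (\<Sum>k<n. fscale (c k) (h (u k) (v k) (x k)))"
    using * b by (auto simp: lift3_def fun_eq_iff sum_fun_apply fscale_def tens3_def)
  moreover have "\<dots> \<in> carr W"
    by (rule space_sum[OF W(1)]) (use * hW space_scale[OF W(1)] W(2) in auto)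
  ultimately show ?thesis by simp
qed

lemma flip_left_in:
  assumes "t \<in> carr (tensor3_space V U W)"
  shows "flip_left U V W t \<in> carr (tensor3_space U V W)"
  unfolding flip_left_def
proof (rule lift3_in[OF assms _ is_space_tensor3_space])
  show "trilinear_map V U W fun_space (\<lambda>v u w. tens3 U V W u v w)"
    by (intro trilinear_mapI) (auto simp: linear_map_fun_space intro!: tens3_linear linear_map_id)
qed (auto intro!: tens3_in)

lemma cop_left_in:
  assumes t: "t \<in> carr (tensor_space P W)" and \<Delta>: "linear_map P (tensor_space U V) \<Delta>"
    and sp: "is_space W"
  shows "cop_left U V W \<Delta> t \<in> carr (tensor3_space U V W)"
  unfolding cop_left_def
proof (rule lift_in[OF t _ is_space_tensor3_space])
  show "bilinear_map P W fun_space (\<lambda>a w. lift (\<lambda>u v. tens3 U V W u v w) (\<Delta> a))"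
    unfolding bilinear_map_fun_space lift_def
  proof (intro allI bilinear_mapI)
    fix a \<gamma> assume a: "a \<in> carr P"
    show "linear_map W scalars (\<lambda>w. \<Delta> a (\<lambda>u v. tens3 U V W u v w \<gamma>))"
      by (rule tensor_param_linear[OF linear_map_in[OF \<Delta> a] sp])
        (intro bilinear_mapI tens3_linear linear_map_id; assumption)+
  next
    fix w \<gamma> assume "w \<in> carr W"
    show "linear_map P scalars (\<lambda>a. \<Delta> a (\<lambda>u v. tens3 U V W u v w \<gamma>))"
      by (rule linear_map_eval[OF \<Delta>]) simp
  qed
qed (auto intro!: tens3_embed_in linear_map_in[OF \<Delta>])

lemma cop_right_in:
  assumes t: "t \<in> carr (tensor_space U P)" and \<Delta>: "linear_map P (tensor_space V W) \<Delta>"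
    and sp: "is_space U"
  shows "cop_right U V W \<Delta> t \<in> carr (tensor3_space U V W)"
  unfolding cop_right_def
proof (rule lift_in[OF t _ is_space_tensor3_space])
  show "bilinear_map U P fun_space (\<lambda>u a. lift (\<lambda>v w. tens3 U V W u v w) (\<Delta> a))"
    unfolding bilinear_map_fun_space lift_def
  proof (intro allI bilinear_mapI)
    fix a \<gamma> assume a: "a \<in> carr P"
    show "linear_map U scalars (\<lambda>u. \<Delta> a (\<lambda>v w. tens3 U V W u v w \<gamma>))"
      by (rule tensor_param_linear[OF linear_map_in[OF \<Delta> a] sp])
        (intro bilinear_mapI tens3_linear linear_map_id; assumption)+
  next
    fix u \<gamma> assume "u \<in> carr U"
    show "linear_map P scalars (\<lambda>a. \<Delta> a (\<lambda>v w. tens3 U V W u v w \<gamma>))"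
      by (rule linear_map_eval[OF \<Delta>]) simp
  qed
qed (auto intro!: tens3_embed_in linear_map_in[OF \<Delta>])

text \<open>Linearity in the form rather than in the tensor. It serves to expand the value at an
  arbitrary form along a finite family of test forms.\<close>

lemma tensor_form_lincomb:
  assumes t: "t \<in> carr (tensor_space U V)"
    and \<beta>: "\<And>k. k \<in> K \<Longrightarrow> bilinear_map U V scalars (\<beta> k)"
  shows "t (\<lambda>u v. \<Sum>k\<in>K. b k * \<beta> k u v) = (\<Sum>k\<in>K. b k * t (\<beta> k))"
  using t
proof (rule tensor_formE)
  fix n :: nat and c u v
  assume *: "\<And>\<beta>. bilinear_map U V scalars \<beta> \<Longrightarrow> t \<beta> = (\<Sum>k<n. c k * \<beta> (u k) (v k))"
  have "bilinear_map U V scalars (\<lambda>u v. \<Sum>k\<in>K. b k * \<beta> k u v)"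
    by (intro bilinear_mapI linear_map_scalars_sum linear_map_mult_left)
      (use \<beta> in \<open>auto intro: bilinear_mapD1 bilinear_mapD2\<close>)
  then show ?thesis
    using \<beta> by (simp add: * sum_distrib_left mult.left_commute sum.swap[of _ K])
qed

lemma tensor3_form_lincomb:
  assumes t: "t \<in> carr (tensor3_space U V W)"
    and \<beta>: "\<And>k. k \<in> K \<Longrightarrow> trilinear_map U V W scalars (\<beta> k)"
  shows "t (\<lambda>u v w. \<Sum>k\<in>K. b k * \<beta> k u v w) = (\<Sum>k\<in>K. b k * t (\<beta> k))"
  using t
proof (rule tensor_formE3)
  fix n :: nat and c u v w
  assume *: "\<And>\<beta>. trilinear_map U V W scalars \<beta> \<Longrightarrow> t \<beta> = (\<Sum>k<n. c k * \<beta> (u k) (v k) (w k))"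
  have "trilinear_map U V W scalars (\<lambda>u v w. \<Sum>k\<in>K. b k * \<beta> k u v w)"
    by (intro trilinear_mapI linear_map_scalars_sum linear_map_mult_left)
      (use \<beta> in \<open>auto intro: trilinear_mapD1 trilinear_mapD2 trilinear_mapD3\<close>)
  then show ?thesis
    using \<beta> by (simp add: * sum_distrib_left mult.left_commute sum.swap[of _ K])
qed

section \<open>Graded spaces\<close>

lemma graded_space_space: "graded_space V G \<Longrightarrow> is_space V"
  and graded_space_sub: "graded_space V G \<Longrightarrow> is_space (sub V (G i))"
  and graded_space_le: "graded_space V G \<Longrightarrow> x \<in> G i \<Longrightarrow> x \<in> carr V"
  by (auto simp: graded_space_def intro: is_space_sub)

lemma hpart_props:
  assumes "graded_space V G" "v \<in> carr V"
  shows "hpart G v i \<in> G i" "finite {i. hpart G v i \<noteq> 0}" "Sum_any (hpart G v) = v"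
proof -
  have "\<exists>!f. (\<forall>i. f i \<in> G i) \<and> finite {i. f i \<noteq> 0} \<and> Sum_any f = v"
    using assms by (simp add: graded_space_def)
  from theI'[OF this] show "hpart G v i \<in> G i" "finite {i. hpart G v i \<noteq> 0}" "Sum_any (hpart G v) = v"
    by (simp_all add: hpart_def)
qed

lemma hpart_unique:
  assumes "graded_space V G" "v \<in> carr V"
    and "\<And>i. f i \<in> G i" "finite {i. f i \<noteq> 0}" "Sum_any f = v"
  shows "hpart G v = f"
  unfolding hpart_def
proof (rule the1_equality)
  show "\<exists>!f. (\<forall>i. f i \<in> G i) \<and> finite {i. f i \<noteq> 0} \<and> Sum_any f = v"
    using assms by (simp add: graded_space_def)
qed (use assms in auto)

lemma hpart_homogeneous:
  assumes G: "graded_space V G" and v: "v \<in> G i"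
  shows "hpart G v p = (if p = i then v else 0)"
proof -
  let ?f = "\<lambda>p. if p = i then v else 0"
  have "Sum_any ?f = v" by (subst Sum_any.expand_superset[of "{i}"]) auto
  moreover have "0 \<in> G p" for p using space_zero[OF graded_space_sub[OF G]] by simp
  moreover have "finite {p. ?f p \<noteq> 0}" by (rule finite_subset[of _ "{i}"]) auto
  ultimately have "hpart G v = ?f"
    by (intro hpart_unique[OF G]) (use v graded_space_le[OF G] in auto)
  then show ?thesis by simp
qed

text \<open>The componentwise sum of two decompositions is a finitely supported decomposition of the
  sum, and uniqueness identifies it with the chosen one; scalar multiples are treated in the same
  way.\<close>

lemma hpart_linear:
  assumes G: "graded_space V G"
  shows "linear_map V (sub V (G p)) (\<lambda>v. hpart G v p)"
proof (rule linear_mapI)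
  interpret vector_space "scl V" using graded_space_space[OF G] by (simp add: is_space_def)
  note sp = graded_space_sub[OF G]
  fix x assume x: "x \<in> carr V"
  show "hpart G x p \<in> carr (sub V (G p))" using hpart_props[OF G x] by simp
  {
    fix y assume y: "y \<in> carr V"
    have fin: "finite {i. hpart G x i + hpart G y i \<noteq> 0}"
      by (rule finite_subset[OF _ finite_UnI[OF hpart_props(2)[OF G x] hpart_props(2)[OF G y]]]) auto
    have "hpart G (x + y) = (\<lambda>i. hpart G x i + hpart G y i)"
      by (rule hpart_unique[OF G])
        (use x y space_add[OF graded_space_space[OF G]] space_add[OF sp] hpart_props[OF G] fin
         in \<open>auto simp: Sum_any.distrib\<close>)
    then show "hpart G (x + y) p = hpart G x p + hpart G y p" by simp
  }
  fix c
  have fin: "finite {i. scl V c (hpart G x i) \<noteq> 0}"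
    by (rule finite_subset[OF _ hpart_props(2)[OF G x]]) auto
  have "Sum_any (\<lambda>i. scl V c (hpart G x i)) = (\<Sum>i | hpart G x i \<noteq> 0. scl V c (hpart G x i))"
    by (rule Sum_any.expand_superset) (use hpart_props[OF G x] in auto)
  also have "\<dots> = scl V c (Sum_any (hpart G x))"
    by (simp add: Sum_any.expand_set scale_sum_right)
  finally have "Sum_any (\<lambda>i. scl V c (hpart G x i)) = scl V c x"
    using hpart_props[OF G x] by simp
  then have "hpart G (scl V c x) = (\<lambda>i. scl V c (hpart G x i))"
    by (intro hpart_unique[OF G])
      (use x space_scale[OF graded_space_space[OF G]] space_scale[OF sp] hpart_props[OF G] fin in auto)
  then show "hpart G (scl V c x) p = scl (sub V (G p)) c (hpart G x p)" by simp
qed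

section \<open>Restrictions, linear combinations and finitely supported sums\<close>

lemma linear_map_sub: "linear_map V W f \<Longrightarrow> S \<subseteq> carr V \<Longrightarrow> linear_map (sub V S) W f"
  by (simp add: linear_map_def subset_iff)

lemma linear_map_lincomb:
  assumes "linear_map V W f" "is_space V" "\<And>k. k \<in> K \<Longrightarrow> e k \<in> carr V"
  shows "f (\<Sum>k\<in>K. scl V (a k) (e k)) = (\<Sum>k\<in>K. scl W (a k) (f (e k)))"
proof -
  have "f (\<Sum>k\<in>K. scl V (a k) (e k)) = (\<Sum>k\<in>K. f (scl V (a k) (e k)))"
    by (rule linear_map_sum[OF assms(1,2)]) (use assms(3) space_scale[OF assms(2)] in auto)
  then show ?thesis using assms by (simp add: linear_map_scale[OF assms(1)])
qed

text \<open>Finite support of the whole family is assumed, not merely of its values at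
  \<open>y\<close>: with an infinite support the left side would be the default 0.\<close>

lemma Sum_any_apply:
  assumes "finite {z. T z \<noteq> 0}"
  shows "Sum_any T y = Sum_any (\<lambda>z. T z y)"
proof -
  have "Sum_any (\<lambda>z. T z y) = (\<Sum>z | T z \<noteq> 0. T z y)"
    by (rule Sum_any.expand_superset) (use assms in auto)
  then show ?thesis by (simp add: Sum_any.expand_set sum_fun_apply)
qed

lemma Sum_any_in:
  assumes "is_space V" "\<And>z. T z \<in> carr V"
  shows "Sum_any T \<in> carr V"
  unfolding Sum_any.expand_set by (rule space_sum) (use assms in auto)

text \<open>
  The sums in \<^const>\<open>cmap\<close> are only meaningful when finitely supported; \<open>cmap_sums\<close> records
  the support condition together with the value.
\<close>

definition cmap_term where
  "cmap_term V G f g X p q = (\<lambda>(i, j).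
     tensor_map (sub V (G p)) (sub V (G q)) (\<lambda>u. hpart G (f u) p) (\<lambda>v. hpart G (g v) q) (X i j))"

definition cmap_sums where
  "cmap_sums V G f g X Y \<longleftrightarrow>
     (\<forall>p q. finite {z. cmap_term V G f g X p q z \<noteq> 0}) \<and> cmap V G f g X = Y"

lemma cmap_eq_Sum_any: "cmap V G f g X p q = Sum_any (cmap_term V G f g X p q)"
  by (simp add: cmap_def cmap_term_def)

lemma cmap_sumsD: "cmap_sums V G f g X Y \<Longrightarrow> cmap V G f g X = Y"
  by (simp add: cmap_sums_def)


section \<open>The completed coalgebra of a quadratic graded commutative algebra\<close>

text \<open>The degree of the form, existentially quantified in the definition of a quadratic
  algebra, is fixed as \<open>d\<close> so that the piece dual to G i can be named: it is G (- i -
  d). The map \<open>D\<close> is any solution of the defining equation of the coproduct.\<close>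

locale quadratic_coalgebra =
  fixes C :: "('k::field, 'c::ab_group_add) space" and G :: "int \<Rightarrow> 'c set"
    and mC :: "'c \<Rightarrow> 'c \<Rightarrow> 'c" and \<omega> :: "'c \<Rightarrow> 'c \<Rightarrow> 'k"
    and D :: "'c \<Rightarrow> ('k, 'c, 'c) ctensor" and d :: int
  assumes quadratic: "quadratic_graded_comm_algebra C G mC \<omega>"
    and degree: "i + j + d \<noteq> 0 \<Longrightarrow> x \<in> G i \<Longrightarrow> y \<in> G j \<Longrightarrow> \<omega> x y = 0"
    and coproduct: "bar_coproduct C G mC \<omega> D"
begin

abbreviation "Cp p \<equiv> sub C (G p)"
abbreviation "CC p q \<equiv> tensor_space (Cp p) (Cp q)"
abbreviation "CCC p q r \<equiv> tensor3_space (Cp p) (Cp q) (Cp r)"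
abbreviation "form2 a b \<equiv> (\<lambda>u v. \<omega> u a * \<omega> v b)"
abbreviation "form3 a b c \<equiv> (\<lambda>u v w. \<omega> u a * \<omega> v b * \<omega> w c)"

lemma C_graded_algebra: "graded_algebra C G mC"
  using quadratic by (simp add: quadratic_graded_comm_algebra_def)

lemma C_graded: "graded_space C G"
  using C_graded_algebra by (simp add: graded_algebra_def)

lemmas C_space = graded_space_space[OF C_graded]
  and Cp_space = graded_space_sub[OF C_graded]
  and Cp_le = graded_space_le[OF C_graded]

lemma mC_bilinear: "bilinear_map C C C mC"
  using C_graded_algebra by (simp add: graded_algebra_def)

lemma mC_in: "x \<in> carr C \<Longrightarrow> y \<in> carr C \<Longrightarrow> mC x y \<in> carr C"
  using bilinear_map_in[OF mC_bilinear] .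

lemma mC_comm: "x \<in> carr C \<Longrightarrow> y \<in> carr C \<Longrightarrow> mC x y = mC y x"
  and mC_assoc: "x \<in> carr C \<Longrightarrow> y \<in> carr C \<Longrightarrow> z \<in> carr C \<Longrightarrow> mC (mC x y) z = mC x (mC y z)"
  and form_bilinear: "bilinear_map C C scalars \<omega>"
  and form_sym: "x \<in> carr C \<Longrightarrow> y \<in> carr C \<Longrightarrow> \<omega> x y = \<omega> y x"
  and form_invariant: "x \<in> carr C \<Longrightarrow> y \<in> carr C \<Longrightarrow> z \<in> carr C \<Longrightarrow> \<omega> (mC x y) z = \<omega> x (mC y z)"
  using quadratic by (auto simp: quadratic_graded_comm_algebra_def)

lemma mC_degree: "x \<in> G i \<Longrightarrow> y \<in> G j \<Longrightarrow> mC x y \<in> G (i + j)"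
  using C_graded_algebra by (auto simp: graded_algebra_def)

section \<open>Duality between complementary degrees\<close>

lemma form_linear: "a \<in> carr C \<Longrightarrow> linear_map C scalars (\<lambda>u. \<omega> u a)"
  using bilinear_mapD1[OF form_bilinear] .

lemma form_linear_Cp: "a \<in> carr C \<Longrightarrow> linear_map (Cp i) scalars (\<lambda>u. \<omega> u a)"
  by (rule linear_map_sub[OF form_linear]) (use Cp_le in auto)

text \<open>A vector pairing nontrivially with x has a homogeneous component that does so too, and
  the degree condition on the form leaves only one possible degree for it.\<close>

lemma form_nondegenerate:
  assumes "x \<in> G i" "x \<noteq> 0"
  obtains y where "y \<in> G (- i - d)" "\<omega> x y \<noteq> 0"
proof -
  obtain y where y: "y \<in> carr C" "\<omega> x y \<noteq> 0"
    using quadratic assms Cp_le unfolding quadratic_graded_comm_algebra_def by blast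
  have "\<omega> x (Sum_any (hpart G y)) = (\<Sum>j | hpart G y j \<noteq> 0. \<omega> x (hpart G y j))"
    unfolding Sum_any.expand_set
    by (rule linear_map_sum[OF bilinear_mapD2[OF form_bilinear Cp_le[OF assms(1)]] C_space])
      (use hpart_props[OF C_graded y(1)] Cp_le in auto)
  then have "(\<Sum>j | hpart G y j \<noteq> 0. \<omega> x (hpart G y j)) \<noteq> 0"
    using y hpart_props(3)[OF C_graded y(1)] by simp
  then obtain j where j: "\<omega> x (hpart G y j) \<noteq> 0"
    by (meson sum.not_neutral_contains_not_neutral)
  then have "i + j + d = 0" using degree[OF _ assms(1) hpart_props(1)[OF C_graded y(1)]] by blast
  then have "j = - i - d" by simp
  then show ?thesis using that j hpart_props(1)[OF C_graded y(1)] by blast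
qed

text \<open>All components of \<open>u\<close> except the one in degree p are orthogonal to G (- p -
  d). This is how the projections built into \<open>cmap\<close> disappear when a term is paired
  with homogeneous vectors.\<close>

lemma form_hpart:
  assumes u: "u \<in> carr C" and b: "b \<in> G (- p - d)"
  shows "\<omega> (hpart G u p) b = \<omega> u b"
proof -
  have bC: "b \<in> carr C" using b Cp_le by blast
  \<comment> \<open>The index p is added by hand, because the component of \<open>u\<close> in
    degree p may be zero.\<close>
  let ?S = "insert p {i. hpart G u i \<noteq> 0}"
  have fin: "finite ?S" using hpart_props(2)[OF C_graded u] by simp
  have "\<omega> u b = \<omega> (\<Sum>i\<in>?S. hpart G u i) b"
    using Sum_any.expand_superset[OF fin, of "hpart G u"] hpart_props(3)[OF C_graded u]
    by (metis (mono_tags, lifting) mem_Collect_eq subset_insertI)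
  also have "\<dots> = (\<Sum>i\<in>?S. \<omega> (hpart G u i) b)"
    by (rule linear_map_sum[OF form_linear[OF bC] C_space])
      (use hpart_props(1)[OF C_graded u] Cp_le in blast)
  also have "\<dots> = (\<Sum>i\<in>{p}. \<omega> (hpart G u i) b)"
    by (rule sum.mono_neutral_right) (use fin degree[OF _ hpart_props(1)[OF C_graded u] b] in auto)
  finally show ?thesis by simp
qed

lemma form_hpart_right:
  assumes u: "u \<in> G i" and a: "a \<in> carr C"
  shows "\<omega> u a = \<omega> u (hpart G a (- i - d))"
proof -
  have "u \<in> G (- (- i - d) - d)" using u by simp
  from form_hpart[OF a this] show ?thesis
    using form_sym[OF Cp_le[OF u] a]
      form_sym[OF Cp_le[OF u] Cp_le[OF hpart_props(1)[OF C_graded a]]] by simp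
qed

text \<open>
  Peel off \<open>w\<close> with \<open>\<omega> w y = 1\<close> and recurse into the kernel of \<open>\<omega>(\<cdot>, y)\<close>; the bound
  \<open>N\<close> on independent sets plays the role of the dimension.
\<close>

lemma dual_family_aux:
  assumes "module.subspace (scl C) W" "W \<subseteq> G i"
    and "\<And>S. \<not> module.dependent (scl C) S \<Longrightarrow> S \<subseteq> W \<Longrightarrow> finite S \<and> card S \<le> N"
  shows "\<exists>n e f. (\<forall>s<n::nat. e s \<in> G i \<and> f s \<in> G (- i - d)) \<and>
     (\<forall>u\<in>W. u = (\<Sum>s<n. scl C (\<omega> u (f s)) (e s)))"
proof -
  interpret V: vector_space "scl C" using C_space by (simp add: is_space_def)
  have zero: "\<exists>n e f. (\<forall>s<n::nat. e s \<in> G i \<and> f s \<in> G (- i - d)) \<and>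
     (\<forall>u\<in>W. u = (\<Sum>s<n. scl C (\<omega> u (f s)) (e s)))" if "W \<subseteq> {0}" for W :: "'c set"
    by (rule exI[of _ 0]) (use that in \<open>simp add: subset_iff\<close>)
  show ?thesis
    using assms
  proof (induction N arbitrary: W)
    case 0
    have "W \<subseteq> {0}"
    proof
      fix w assume w: "w \<in> W"
      show "w \<in> {0}"
      proof (rule ccontr)
        assume "w \<notin> {0}"
        then have "V.independent {w}" by simp
        then show False using 0(3)[of "{w}"] w by simp
      qed
    qed
    then show ?case by (rule zero)
  next
    case (Suc N)
    show ?case
    proof (cases "W \<subseteq> {0}")
      case True
      then show ?thesis by (rule zero)
    next
      case False
      then obtain w where w: "w \<in> W" "w \<noteq> 0" by auto
      then have wG: "w \<in> G i" using Suc.prems(2) by auto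
      obtain y' where y': "y' \<in> G (- i - d)" "\<omega> w y' \<noteq> 0"
        using form_nondegenerate[OF wG w(2)] .
      define y where "y = scl C (1 / \<omega> w y') y'"
      have yG: "y \<in> G (- i - d)" using y' space_scale[OF Cp_space] by (simp add: y_def)
      then have yC: "y \<in> carr C" using Cp_le by blast
      have wy: "\<omega> w y = 1"
        using linear_map_scale[OF bilinear_mapD2[OF form_bilinear Cp_le[OF wG]] Cp_le[OF y'(1)]] y'
        by (simp add: y_def)
      let ?W = "{u \<in> W. \<omega> u y = 0}"
      have WC: "x \<in> carr C" if "x \<in> W" for x using that Suc.prems(2) Cp_le by blast
      have zy: "\<omega> 0 y = 0" using linear_map_zero[OF form_linear[OF yC] C_space] .
      have ay: "\<omega> (x + x') y = \<omega> x y + \<omega> x' y" if "x \<in> W" "x' \<in> W" for x x'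
        using linear_map_add[OF form_linear[OF yC]] that WC by simp
      have sy: "\<omega> (scl C c x) y = c * \<omega> x y" if "x \<in> W" for x c
        using linear_map_scale[OF form_linear[OF yC]] that WC by simp
      have sub: "V.subspace ?W"
        using Suc.prems(1) unfolding V.subspace_def by (auto simp: zy ay sy)
      have "finite S \<and> card S \<le> N" if S: "V.independent S" "S \<subseteq> ?W" for S
      proof -
        have "V.span S \<subseteq> ?W" using V.span_minimal[OF S(2) sub] .
        \<comment> \<open>The span stays in the kernel of pairing with \<open>y\<close>, while
          \<open>w\<close> pairs to 1. Adjoining \<open>w\<close> thus gives a larger independent
          set in \<open>W\<close>, so the bound \<open>Suc N\<close> for \<open>W\<close> becomes
          \<open>N\<close> for the kernel.\<close>
        then have "w \<notin> V.span S" using wy by auto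
        then have "V.independent (insert w S)" using S by (simp add: V.independent_insertI)
        then have "finite (insert w S) \<and> card (insert w S) \<le> Suc N"
          using Suc.prems(3) S w by auto
        moreover have "w \<notin> S" using S wy by auto
        ultimately show ?thesis by (auto simp: card_insert_if)
      qed
      then obtain n e f where IH: "\<forall>s<n::nat. e s \<in> G i \<and> f s \<in> G (- i - d)"
        "\<forall>u\<in>?W. u = (\<Sum>s<n. scl C (\<omega> u (f s)) (e s))"
        using Suc.IH[OF sub] Suc.prems(2) by blast
      \<comment> \<open>The earlier \<open>f s\<close> need not vanish on \<open>w\<close>.
        Subtracting the expansion of \<open>w\<close> in the old family corrects for what they
        already contribute to the multiple of \<open>w\<close> in \<open>u\<close>.\<close>
      define e' where "e' = e(n := w - (\<Sum>s<n. scl C (\<omega> w (f s)) (e s)))"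
      define f' where "f' = f(n := y)"
      have fC: "f s \<in> carr C" if "s < n" for s using IH that Cp_le by blast
      have eG: "w - (\<Sum>s<n. scl C (\<omega> w (f s)) (e s)) \<in> G i"
      proof -
        have "(\<Sum>s<n. scl C (\<omega> w (f s)) (e s)) \<in> carr (Cp i)"
          by (rule space_sum[OF Cp_space]) (use IH space_scale[OF Cp_space[of i]] in auto)
        then show ?thesis using space_diff[OF Cp_space[of i], of w] wG by simp
      qed
      have exp: "u = (\<Sum>s<Suc n. scl C (\<omega> u (f' s)) (e' s))" if u: "u \<in> W" for u
      proof -
        let ?k = "\<omega> u y"
        have kw: "scl C ?k w \<in> W" using Suc.prems(1) w V.subspace_scale by blast
        have u': "u - scl C ?k w \<in> W" using Suc.prems(1) u kw V.subspace_diff by blast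
        have "\<omega> (u - scl C ?k w + scl C ?k w) y = \<omega> (u - scl C ?k w) y + ?k"
          using ay[OF u' kw] sy[OF w(1)] wy by simp
        then have "u - scl C ?k w \<in> ?W" using u' by simp
        then have 1: "u - scl C ?k w = (\<Sum>s<n. scl C (\<omega> (u - scl C ?k w) (f s)) (e s))"
          using IH by blast
        have 2: "\<omega> (u - scl C ?k w) (f s) = \<omega> u (f s) - ?k * \<omega> w (f s)" if s: "s < n" for s
        proof -
          have "\<omega> (u - scl C ?k w + scl C ?k w) (f s) = \<omega> (u - scl C ?k w) (f s) + \<omega> (scl C ?k w) (f s)"
            using linear_map_add[OF form_linear[OF fC[OF s]]] WC[OF u'] WC[OF kw] by blast
          then show ?thesis
            using linear_map_scale[OF form_linear[OF fC[OF s]] WC[OF w(1)]] by (simp add: algebra_simps)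
        qed
        have "u = scl C ?k w + (\<Sum>s<n. scl C (\<omega> u (f s) - ?k * \<omega> w (f s)) (e s))"
          using 1 2 by (simp add: algebra_simps)
        also have "\<dots> = (\<Sum>s<n. scl C (\<omega> u (f s)) (e s)) +
            scl C ?k (w - (\<Sum>s<n. scl C (\<omega> w (f s)) (e s)))"
          by (simp add: V.scale_left_diff_distrib V.scale_right_diff_distrib sum_subtractf
              V.scale_sum_right)
        finally show ?thesis by (simp add: e'_def f'_def)
      qed
      show ?thesis
        by (rule exI[of _ "Suc n"], rule exI[of _ e'], rule exI[of _ f'])
          (use exp IH eG yG in \<open>auto simp: e'_def f'_def less_Suc_eq\<close>)
    qed
  qed
qed

text \<open>A finite spanning set of G i bounds its independent sets, which starts the recursion at
  the whole piece. The outcome expands u in terms of its pairings with finitely many vectors of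
  complementary degree.\<close>

lemma dual_family:
  obtains n :: nat and e f where "\<And>s. s < n \<Longrightarrow> e s \<in> G i" "\<And>s. s < n \<Longrightarrow> f s \<in> G (- i - d)"
    "\<And>u. u \<in> G i \<Longrightarrow> u = (\<Sum>s<n. scl C (\<omega> u (f s)) (e s))"
proof -
  interpret V: vector_space "scl C" using C_space by (simp add: is_space_def)
  obtain B where B: "finite B" "G i = V.span B"
    using C_graded_algebra unfolding graded_algebra_def fin_dim_def scl_sub carr_sub by blast
  have "\<exists>n e f. (\<forall>s<n::nat. e s \<in> G i \<and> f s \<in> G (- i - d)) \<and>
     (\<forall>u\<in>G i. u = (\<Sum>s<n. scl C (\<omega> u (f s)) (e s)))"
    by (rule dual_family_aux[where N = "card B"])
      (use B V.independent_span_bound C_graded in \<open>auto simp: graded_space_def\<close>)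
  then show ?thesis using that by blast
qed


section \<open>Detecting tensors by homogeneous pairings\<close>

lemma form2_bilinear:
  "a \<in> carr C \<Longrightarrow> b \<in> carr C \<Longrightarrow> bilinear_map (Cp i) (Cp j) scalars (form2 a b)"
  by (intro bilinear_mapI linear_map_mult_left linear_map_mult_right form_linear_Cp)

lemma form3_trilinear:
  "a \<in> carr C \<Longrightarrow> b \<in> carr C \<Longrightarrow> c \<in> carr C \<Longrightarrow>
    trilinear_map (Cp i) (Cp j) (Cp k) scalars (form3 a b c)"
  by (intro trilinear_mapI linear_map_mult_left linear_map_mult_right form_linear_Cp)

text \<open>On G p x G q every bilinear form is a combination of the forms u, v \<mapsto>
  \<omega>(u, f x) \<omega>(v, f' y), with its values at (e x, e' y) as coefficients. That the test
  set is finite is essential: it turns finiteness of each pairing into finiteness of a family of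
  tensors.\<close>

lemma tensor_tests:
  "\<exists>F. finite F \<and> F \<subseteq> G (- p - d) \<times> G (- q - d) \<and>
     (\<forall>s\<in>carr (CC p q). (\<forall>(a, b)\<in>F. s (form2 a b) = 0) \<longrightarrow> s = 0)"
proof -
  obtain n :: nat and e f where n: "\<And>s. s < n \<Longrightarrow> e s \<in> G p" "\<And>s. s < n \<Longrightarrow> f s \<in> G (- p - d)"
    "\<And>u. u \<in> G p \<Longrightarrow> u = (\<Sum>s<n. scl C (\<omega> u (f s)) (e s))"
    by (rule dual_family[of p], rule that, assumption+)
  obtain n' :: nat and e' f' where n': "\<And>s. s < n' \<Longrightarrow> e' s \<in> G q" "\<And>s. s < n' \<Longrightarrow> f' s \<in> G (- q - d)"
    "\<And>u. u \<in> G q \<Longrightarrow> u = (\<Sum>s<n'. scl C (\<omega> u (f' s)) (e' s))"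
    by (rule dual_family[of q], rule that, assumption+)
  let ?K = "{..<n} \<times> {..<n'}"
  let ?F = "(\<lambda>(x, y). (f x, f' y)) ` ?K"
  have "s = 0" if s: "s \<in> carr (CC p q)"
    and z: "\<And>a b. (a, b) \<in> ?F \<Longrightarrow> s (form2 a b) = 0" for s
  proof
    fix \<beta> :: "'c \<Rightarrow> 'c \<Rightarrow> 'k"
    show "s \<beta> = 0 \<beta>"
    proof (cases "bilinear_map (Cp p) (Cp q) scalars \<beta>")
      case False
      with s show ?thesis by (elim tensor_formE) simp
    next
      case True
      let ?h = "\<lambda>k u v. \<omega> u (f (fst k)) * \<omega> v (f' (snd k))"
      have exp: "\<beta> u v = (\<Sum>k\<in>?K. \<beta> (e (fst k)) (e' (snd k)) * ?h k u v)"
        if u: "u \<in> carr (Cp p)" and v: "v \<in> carr (Cp q)" for u v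
      proof -
        have "\<beta> u v = \<beta> (\<Sum>x<n. scl C (\<omega> u (f x)) (e x)) v" using n(3) u by simp
        also have "\<dots> = (\<Sum>x<n. \<omega> u (f x) * \<beta> (e x) v)"
          using linear_map_lincomb[OF bilinear_mapD1[OF True v] Cp_space, of "{..<n}" e "\<lambda>x. \<omega> u (f x)"] n(1)
          by simp
        also have "\<dots> = (\<Sum>x<n. \<omega> u (f x) * (\<Sum>y<n'. \<omega> v (f' y) * \<beta> (e x) (e' y)))"
        proof (rule sum.cong[OF refl])
          fix x assume "x \<in> {..<n}"
          then have ex: "e x \<in> carr (Cp p)" using n(1) by simp
          have "\<beta> (e x) v = \<beta> (e x) (\<Sum>y<n'. scl C (\<omega> v (f' y)) (e' y))" using n'(3) v by simp
          then show "\<omega> u (f x) * \<beta> (e x) v = \<omega> u (f x) * (\<Sum>y<n'. \<omega> v (f' y) * \<beta> (e x) (e' y))"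
            using linear_map_lincomb[OF bilinear_mapD2[OF True ex] Cp_space, of "{..<n'}" e' "\<lambda>y. \<omega> v (f' y)"]
              n'(1) by simp
        qed
        also have "\<dots> = (\<Sum>k\<in>?K. \<beta> (e (fst k)) (e' (snd k)) * ?h k u v)"
          by (simp add: sum.cartesian_product' sum_distrib_left algebra_simps)
        finally show ?thesis .
      qed
      have "s \<beta> = s (\<lambda>u v. \<Sum>k\<in>?K. \<beta> (e (fst k)) (e' (snd k)) * ?h k u v)"
        by (rule tensor_cong[OF s Cp_space Cp_space exp])
      also have "\<dots> = (\<Sum>k\<in>?K. \<beta> (e (fst k)) (e' (snd k)) * s (?h k))"
        by (rule tensor_form_lincomb[OF s], rule form2_bilinear) (use Cp_le[OF n(2)] Cp_le[OF n'(2)] in auto)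
      also have "\<dots> = 0" by (rule sum.neutral) (use z in force)
      finally show ?thesis by simp
    qed
  qed
  note tests = this
  show ?thesis
  proof (intro exI[of _ ?F] conjI ballI impI)
    fix s assume "s \<in> carr (CC p q)"
      and "\<forall>(a, b)\<in>?F. s (form2 a b) = 0"
    then show "s = 0" by (intro tests) fast+
  qed (use n n' in auto)
qed

text \<open>The same expansion carried out one variable at a time, with three dual families.\<close>

lemma tensor3_tests:
  "\<exists>F. finite F \<and> F \<subseteq> G (- p - d) \<times> G (- q - d) \<times> G (- r - d) \<and>
     (\<forall>s\<in>carr (CCC p q r).
        (\<forall>(a, b, c)\<in>F. s (form3 a b c) = 0) \<longrightarrow> s = 0)"
proof -
  obtain n :: nat and e f where n: "\<And>s. s < n \<Longrightarrow> e s \<in> G p" "\<And>s. s < n \<Longrightarrow> f s \<in> G (- p - d)"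
    "\<And>u. u \<in> G p \<Longrightarrow> u = (\<Sum>s<n. scl C (\<omega> u (f s)) (e s))"
    by (rule dual_family[of p], rule that, assumption+)
  obtain n' :: nat and e' f' where n': "\<And>s. s < n' \<Longrightarrow> e' s \<in> G q" "\<And>s. s < n' \<Longrightarrow> f' s \<in> G (- q - d)"
    "\<And>u. u \<in> G q \<Longrightarrow> u = (\<Sum>s<n'. scl C (\<omega> u (f' s)) (e' s))"
    by (rule dual_family[of q], rule that, assumption+)
  obtain m :: nat and g h where m: "\<And>s. s < m \<Longrightarrow> g s \<in> G r" "\<And>s. s < m \<Longrightarrow> h s \<in> G (- r - d)"
    "\<And>u. u \<in> G r \<Longrightarrow> u = (\<Sum>s<m. scl C (\<omega> u (h s)) (g s))"
    by (rule dual_family[of r], rule that, assumption+)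
  let ?K = "{..<n} \<times> {..<n'} \<times> {..<m}"
  let ?F = "(\<lambda>(x, y, z). (f x, f' y, h z)) ` ?K"
  have "s = 0" if s: "s \<in> carr (CCC p q r)"
    and z: "\<And>a b c. (a, b, c) \<in> ?F \<Longrightarrow> s (form3 a b c) = 0" for s
  proof
    fix \<beta> :: "'c \<Rightarrow> 'c \<Rightarrow> 'c \<Rightarrow> 'k"
    show "s \<beta> = 0 \<beta>"
    proof (cases "trilinear_map (Cp p) (Cp q) (Cp r) scalars \<beta>")
      case False
      with s show ?thesis by (elim tensor_formE3) simp
    next
      case True
      let ?h = "\<lambda>k u v w. \<omega> u (f (fst k)) * \<omega> v (f' (fst (snd k))) * \<omega> w (h (snd (snd k)))"
      let ?b = "\<lambda>k. \<beta> (e (fst k)) (e' (fst (snd k))) (g (snd (snd k)))"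
      have exp: "\<beta> u v w = (\<Sum>k\<in>?K. ?b k * ?h k u v w)"
        if u: "u \<in> carr (Cp p)" and v: "v \<in> carr (Cp q)" and w: "w \<in> carr (Cp r)" for u v w
      proof -
        have "\<beta> u v w = \<beta> (\<Sum>x<n. scl C (\<omega> u (f x)) (e x)) v w" using n(3) u by simp
        also have "\<dots> = (\<Sum>x<n. \<omega> u (f x) * \<beta> (e x) v w)"
          using linear_map_lincomb[OF trilinear_mapD1[OF True v w] Cp_space, of "{..<n}" e "\<lambda>x. \<omega> u (f x)"] n(1)
          by simp
        also have "\<dots> = (\<Sum>x<n. \<omega> u (f x) * (\<Sum>y<n'. \<omega> v (f' y) * (\<Sum>z<m. \<omega> w (h z) * \<beta> (e x) (e' y) (g z))))"
        proof (rule sum.cong[OF refl])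
          fix x assume "x \<in> {..<n}"
          then have ex: "e x \<in> carr (Cp p)" using n(1) by simp
          have "\<beta> (e x) v w = \<beta> (e x) (\<Sum>y<n'. scl C (\<omega> v (f' y)) (e' y)) w" using n'(3) v by simp
          also have "\<dots> = (\<Sum>y<n'. \<omega> v (f' y) * \<beta> (e x) (e' y) w)"
            using linear_map_lincomb[OF trilinear_mapD2[OF True ex w] Cp_space, of "{..<n'}" e' "\<lambda>y. \<omega> v (f' y)"]
              n'(1) by simp
          also have "\<dots> = (\<Sum>y<n'. \<omega> v (f' y) * (\<Sum>z<m. \<omega> w (h z) * \<beta> (e x) (e' y) (g z)))"
          proof (rule sum.cong[OF refl])
            fix y assume "y \<in> {..<n'}"
            then have ey: "e' y \<in> carr (Cp q)" using n'(1) by simp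
            have "\<beta> (e x) (e' y) w = \<beta> (e x) (e' y) (\<Sum>z<m. scl C (\<omega> w (h z)) (g z))" using m(3) w by simp
            then show "\<omega> v (f' y) * \<beta> (e x) (e' y) w =
                \<omega> v (f' y) * (\<Sum>z<m. \<omega> w (h z) * \<beta> (e x) (e' y) (g z))"
              using linear_map_lincomb[OF trilinear_mapD3[OF True ex ey] Cp_space, of "{..<m}" g "\<lambda>y. \<omega> w (h y)"]
                m(1) by simp
          qed
          finally show "\<omega> u (f x) * \<beta> (e x) v w =
            \<omega> u (f x) * (\<Sum>y<n'. \<omega> v (f' y) * (\<Sum>z<m. \<omega> w (h z) * \<beta> (e x) (e' y) (g z)))" by simp
        qed
        also have "\<dots> = (\<Sum>k\<in>?K. ?b k * ?h k u v w)"
          by (simp add: sum.cartesian_product' sum_distrib_left algebra_simps)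
        finally show ?thesis .
      qed
      have "s \<beta> = s (\<lambda>u v w. \<Sum>k\<in>?K. ?b k * ?h k u v w)"
        by (rule tensor3_cong[OF s Cp_space Cp_space Cp_space exp])
      also have "\<dots> = (\<Sum>k\<in>?K. ?b k * s (?h k))"
        by (rule tensor3_form_lincomb[OF s], rule form3_trilinear) (use Cp_le[OF n(2)] Cp_le[OF n'(2)] Cp_le[OF m(2)] in auto)
      also have "\<dots> = 0" by (rule sum.neutral) (use z in force)
      finally show ?thesis by simp
    qed
  qed
  note tests = this
  show ?thesis
  proof (intro exI[of _ ?F] conjI ballI impI)
    fix s assume "s \<in> carr (CCC p q r)"
      and "\<forall>(a, b, c)\<in>?F. s (form3 a b c) = 0"
    then show "s = 0" by (intro tests) (assumption | drule bspec, assumption, simp)+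
  qed (use n n' m in auto)
qed

text \<open>A nonzero member of the family is seen by one of finitely many tests, so the support is
  covered by a finite union of the finite supports of the pairings.\<close>

lemma tensor_finite_support:
  assumes T: "\<And>z. T z \<in> carr (CC p q)"
    and fin: "\<And>a b. a \<in> G (- p - d) \<Longrightarrow> b \<in> G (- q - d) \<Longrightarrow>
      finite {z. T z (form2 a b) \<noteq> 0}"
  shows "finite {z. T z \<noteq> 0}"
proof -
  obtain F where F: "finite F" "F \<subseteq> G (- p - d) \<times> G (- q - d)"
    "\<forall>s\<in>carr (CC p q). (\<forall>(a, b)\<in>F. s (form2 a b) = 0) \<longrightarrow> s = 0"
    using tensor_tests[of p q] by blast
  have "{z. T z \<noteq> 0} \<subseteq> (\<Union>(a, b)\<in>F. {z. T z (form2 a b) \<noteq> 0})"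
    using F(3) T by fastforce
  moreover have "finite \<dots>" using F fin by auto
  ultimately show ?thesis by (rule finite_subset)
qed

lemma tensor3_finite_support:
  assumes T: "\<And>z. T z \<in> carr (CCC p q r)"
    and fin: "\<And>a b c. a \<in> G (- p - d) \<Longrightarrow> b \<in> G (- q - d) \<Longrightarrow> c \<in> G (- r - d) \<Longrightarrow>
      finite {z. T z (form3 a b c) \<noteq> 0}"
  shows "finite {z. T z \<noteq> 0}"
proof -
  obtain F where F: "finite F" "F \<subseteq> G (- p - d) \<times> G (- q - d) \<times> G (- r - d)"
    "\<forall>s\<in>carr (CCC p q r).
      (\<forall>(a, b, c)\<in>F. s (form3 a b c) = 0) \<longrightarrow> s = 0"
    using tensor3_tests[of p q r] by blast
  have "{z. T z \<noteq> 0} \<subseteq> (\<Union>(a, b, c)\<in>F. {z. T z (form3 a b c) \<noteq> 0})"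
    using F(3) T by fastforce
  moreover have "finite \<dots>" using F fin by auto
  ultimately show ?thesis by (rule finite_subset)
qed

text \<open>The finite test set is applied to the difference, so equality only has to be checked
  against homogeneous vectors of complementary degrees.\<close>

lemma tensor3_eqI:
  assumes S: "S \<in> carr (CCC p q r)"
    and S': "S' \<in> carr (CCC p q r)"
    and eq: "\<And>a b c. a \<in> G (- p - d) \<Longrightarrow> b \<in> G (- q - d) \<Longrightarrow> c \<in> G (- r - d) \<Longrightarrow>
      S (form3 a b c) = S' (form3 a b c)"
  shows "S = S'"
proof -
  obtain F where F: "finite F" "F \<subseteq> G (- p - d) \<times> G (- q - d) \<times> G (- r - d)"
    "\<forall>s\<in>carr (CCC p q r).
      (\<forall>(a, b, c)\<in>F. s (form3 a b c) = 0) \<longrightarrow> s = 0"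
    using tensor3_tests[of p q r] by blast
  have "S - S' = 0"
  proof (rule F(3)[rule_format])
    show "S - S' \<in> carr (CCC p q r)"
      by (intro space_diff is_space_tensor3_space S S')
  qed (use F(2) eq in auto)
  then show ?thesis by simp
qed

lemma tensor_eqI:
  assumes S: "S \<in> carr (CC p q)"
    and S': "S' \<in> carr (CC p q)"
    and eq: "\<And>a b. a \<in> G (- p - d) \<Longrightarrow> b \<in> G (- q - d) \<Longrightarrow>
      S (form2 a b) = S' (form2 a b)"
  shows "S = S'"
proof -
  obtain F where F: "finite F" "F \<subseteq> G (- p - d) \<times> G (- q - d)"
    "\<forall>s\<in>carr (CC p q). (\<forall>(a, b)\<in>F. s (form2 a b) = 0) \<longrightarrow> s = 0"
    using tensor_tests[of p q] by blast
  have "S - S' = 0"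
  proof (rule F(3)[rule_format])
    show "S - S' \<in> carr (CC p q)"
      by (intro space_diff is_space_tensor_space S S')
  qed (use F(2) eq in auto)
  then show ?thesis by simp
qed

section \<open>Components and pairings of the coproduct\<close>

lemma D_linear: "linear_map C (CC i j) (\<lambda>c. D c i j)"
  using coproduct by (simp add: bar_coproduct_def linear_map_def ctensor_space_def)

lemma D_in: "c \<in> carr C \<Longrightarrow> D c i j \<in> carr (CC i j)"
  by (rule linear_map_in[OF D_linear])

lemma D_linear_Cp: "linear_map (Cp k) (CC i j) (\<lambda>c. D c i j)"
  by (rule linear_map_sub[OF D_linear]) (use Cp_le in auto)

text \<open>On G i pairing with \<open>a\<close> only involves the component of \<open>a\<close> in
  degree - i - d, and similarly for \<open>b\<close> on G j. If one of these components vanishes,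
  the form is zero on the carriers.\<close>

lemma D_pairing_zero:
  assumes c: "c \<in> carr C" and a: "a \<in> carr C" and b: "b \<in> carr C"
    and z: "hpart G a (- i - d) = 0 \<or> hpart G b (- j - d) = 0"
  shows "D c i j (form2 a b) = 0"
proof -
  have z0: "\<omega> u 0 = 0" if "u \<in> G k" for u k
    using linear_map_zero[OF bilinear_mapD2[OF form_bilinear Cp_le[OF that]] C_space] .
  have "D c i j (form2 a b) = D c i j (\<lambda>u v. 0)"
    by (rule tensor_cong[OF D_in[OF c] Cp_space Cp_space])
      (use z a b z0 form_hpart_right in \<open>auto simp: form_hpart_right\<close>)
  then show ?thesis using tensor_zero_form[OF D_in[OF c]] by simp
qed

lemma D_pairing_finite:
  assumes c: "c \<in> carr C" and a: "a \<in> carr C" and b: "b \<in> carr C"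
  shows "finite {(i, j). D c i j (form2 a b) \<noteq> 0}"
proof (rule finite_subset)
  \<comment> \<open>Passing to the complementary degree is an involution, so the degrees that
    contribute are the images of the two finite supports.\<close>
  let ?f = "\<lambda>k. - k - d"
  have f: "i = ?f (?f i)" for i by simp
  show "{(i, j). D c i j (form2 a b) \<noteq> 0} \<subseteq>
      ?f ` {k. hpart G a k \<noteq> 0} \<times> ?f ` {k. hpart G b k \<noteq> 0}"
    using D_pairing_zero[OF c a b] f by blast
  show "finite (?f ` {k. hpart G a k \<noteq> 0} \<times> ?f ` {k. hpart G b k \<noteq> 0})"
    using hpart_props(2)[OF C_graded] a b by blast
qed

lemma D_pairing:
  assumes c: "c \<in> carr C" and a: "a \<in> carr C" and b: "b \<in> carr C"
  shows "Sum_any (\<lambda>(i, j). D c i j (form2 a b)) = \<omega> c (mC a b)"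
  using coproduct assms by (simp add: bar_coproduct_def bar_pairing_def)

text \<open>Against homogeneous vectors all components but one pair to zero, so the defining
  equation of the coproduct, a sum over all degrees, becomes a formula for a single
  component.\<close>

lemma D_pairing_homogeneous:
  assumes c: "c \<in> carr C" and a: "a \<in> G (- p - d)" and b: "b \<in> G (- q - d)"
  shows "D c p q (form2 a b) = \<omega> c (mC a b)"
proof -
  note aC = Cp_le[OF a] and bC = Cp_le[OF b]
  have "\<omega> c (mC a b) = Sum_any (\<lambda>(i, j). D c i j (form2 a b))"
    using D_pairing[OF c aC bC] by simp
  also have "\<dots> = (\<Sum>(i, j)\<in>{(p, q)}. D c i j (form2 a b))"
  proof (rule Sum_any.expand_superset)
    have "(case z of (i, j) \<Rightarrow> D c i j (form2 a b)) = 0" if "z \<noteq> (p, q)" for z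
      using that D_pairing_zero[OF c aC bC, of "fst z" "snd z"]
      by (auto simp: hpart_homogeneous[OF C_graded a] hpart_homogeneous[OF C_graded b]
          case_prod_beta prod_eq_iff)
    then show "{z. (case z of (i, j) \<Rightarrow> D c i j (form2 a b)) \<noteq> 0} \<subseteq> {(p, q)}" by blast
  qed simp
  finally show ?thesis by simp
qed

text \<open>Cocommutativity as the dual of commutativity: the two sides pair with a \<otimes> b to
  \<omega>(c, ba) and \<omega>(c, ab).\<close>

lemma D_flip:
  assumes c: "c \<in> carr C"
  shows "cflip C G (D c) = D c"
proof -
  have "cflip C G (D c) p q = D c p q" for p q
  proof (rule tensor_eqI[OF _ D_in[OF c]])
    show "cflip C G (D c) p q \<in> carr (CC p q)"
      unfolding cflip_def by (rule tensor_flip_in[OF D_in[OF c]])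
    fix a b assume a: "a \<in> G (- p - d)" and b: "b \<in> G (- q - d)"
    note aC = Cp_le[OF a] and bC = Cp_le[OF b]
    have "cflip C G (D c) p q (form2 a b) = D c q p (form2 b a)"
      using form2_bilinear[OF aC bC]
      by (simp add: cflip_def tensor_flip_def lift_def tens_def mult.commute)
    then show "cflip C G (D c) p q (form2 a b) = D c p q (form2 a b)"
      using D_pairing_homogeneous[OF c b a] D_pairing_homogeneous[OF c a b] mC_comm[OF aC bC] by simp
  qed
  then show ?thesis by (intro ext[of "cflip C G (D c)"] ext[of "cflip C G (D c) _"])
qed

text \<open>Self-adjointness moves \<open>f\<close> and \<open>g\<close> from the legs of
  \<open>D c\<close> to the test vectors, where they may produce inhomogeneous vectors. The pairing
  of the result is then \<omega>(c, f(a) g(b)), and finite support follows from that of the pairings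
  of \<open>D c\<close> with f(a) and g(b).\<close>

lemma D_cmap_sums:
  assumes c: "c \<in> carr C" and c': "c' \<in> carr C"
    and f: "linear_map C C f" and g: "linear_map C C g"
    and f_adj: "\<And>u a. u \<in> carr C \<Longrightarrow> a \<in> carr C \<Longrightarrow> \<omega> (f u) a = \<omega> u (f a)"
    and g_adj: "\<And>u a. u \<in> carr C \<Longrightarrow> a \<in> carr C \<Longrightarrow> \<omega> (g u) a = \<omega> u (g a)"
    and eq: "\<And>a b. a \<in> carr C \<Longrightarrow> b \<in> carr C \<Longrightarrow> \<omega> c (mC (f a) (g b)) = \<omega> c' (mC a b)"
  shows "cmap_sums C G f g (D c) (D c')"
proof -
  have "finite {z. cmap_term C G f g (D c) p q z \<noteq> 0} \<and> Sum_any (cmap_term C G f g (D c) p q) = D c' p q"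
    for p q
  proof -
    have lf: "linear_map (Cp i) (Cp p) (\<lambda>u. hpart G (f u) p)"
      and lg: "linear_map (Cp i) (Cp q) (\<lambda>u. hpart G (g u) q)" for i
      by (rule linear_map_compose[OF hpart_linear[OF C_graded]],
          rule linear_map_sub[OF f] linear_map_sub[OF g], use Cp_le in auto)+
    have T: "cmap_term C G f g (D c) p q z \<in> carr (CC p q)" for z
      unfolding cmap_term_def by (cases z) (simp, rule tensor_map_in[OF D_in[OF c] lf lg])
    have ev: "cmap_term C G f g (D c) p q (i, j) (form2 a b) =
        D c i j (form2 (f a) (g b))"
      if a: "a \<in> G (- p - d)" and b: "b \<in> G (- q - d)" for a b i j
    proof -
      have "cmap_term C G f g (D c) p q (i, j) (form2 a b) =
          D c i j (\<lambda>u v. \<omega> (hpart G (f u) p) a * \<omega> (hpart G (g v) q) b)"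
        using form2_bilinear[OF Cp_le[OF a] Cp_le[OF b]]
        by (simp add: cmap_term_def tensor_map_def lift_def tens_def)
      also have "\<dots> = D c i j (form2 (f a) (g b))"
      proof (rule tensor_cong[OF D_in[OF c] Cp_space Cp_space])
        fix u v assume "u \<in> carr (Cp i)" "v \<in> carr (Cp j)"
        then have u: "u \<in> carr C" and v: "v \<in> carr C" using Cp_le by auto
        \<comment> \<open>The projections onto degrees p and q are invisible to \<open>a\<close> and
          \<open>b\<close>, which have the complementary degrees.\<close>
        show "\<omega> (hpart G (f u) p) a * \<omega> (hpart G (g v) q) b = \<omega> u (f a) * \<omega> v (g b)"
          using form_hpart[OF linear_map_in[OF f u] a] form_hpart[OF linear_map_in[OF g v] b]
            f_adj[OF u Cp_le[OF a]] g_adj[OF v Cp_le[OF b]] by simp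
      qed
      finally show ?thesis .
    qed
    have ev': "(\<lambda>z. cmap_term C G f g (D c) p q z (form2 a b)) =
        (\<lambda>(i, j). D c i j (form2 (f a) (g b)))"
      if "a \<in> G (- p - d)" "b \<in> G (- q - d)" for a b
      using ev[OF that] by auto
    note fC = linear_map_in[OF f Cp_le] and gC = linear_map_in[OF g Cp_le]
    have fin: "finite {z. cmap_term C G f g (D c) p q z \<noteq> 0}"
    proof (rule tensor_finite_support[OF T])
      fix a b assume a: "a \<in> G (- p - d)" and b: "b \<in> G (- q - d)"
      show "finite {z. cmap_term C G f g (D c) p q z (form2 a b) \<noteq> 0}"
        using D_pairing_finite[OF c fC[OF a] gC[OF b]] ev[OF a b]
        by (rule_tac finite_subset) auto
    qed
    moreover have "Sum_any (cmap_term C G f g (D c) p q) = D c' p q"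
    proof (rule tensor_eqI[OF Sum_any_in[OF is_space_tensor_space T] D_in[OF c']])
      fix a b assume a: "a \<in> G (- p - d)" and b: "b \<in> G (- q - d)"
      show "Sum_any (cmap_term C G f g (D c) p q) (form2 a b) =
          D c' p q (form2 a b)"
        unfolding Sum_any_apply[OF fin] ev'[OF a b]
        using D_pairing[OF c fC[OF a] gC[OF b]] eq[OF Cp_le[OF a] Cp_le[OF b]]
          D_pairing_homogeneous[OF c' a b]
        by simp
    qed
    ultimately show ?thesis by blast
  qed
  then show ?thesis by (auto simp: cmap_sums_def cmap_eq_Sum_any fun_eq_iff)
qed

lemma mC_linear: "z \<in> carr C \<Longrightarrow> linear_map C C (mC z)"
  using bilinear_mapD2[OF mC_bilinear] by simp

text \<open>Invariance moves a right factor across the form, so commutativity is used to turn the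
  multiplier into a right factor.\<close>

lemma mC_self_adjoint:
  assumes "z \<in> carr C" "u \<in> carr C" "a \<in> carr C"
  shows "\<omega> (mC z u) a = \<omega> u (mC z a)"
  using assms by (simp add: mC_comm[of z u] form_invariant)

lemma D_cmap_sums_right:
  assumes c: "c \<in> carr C" and z: "z \<in> carr C"
  shows "cmap_sums C G (\<lambda>u. u) (mC z) (D c) (D (mC c z))"
proof (rule D_cmap_sums[OF c mC_in[OF c z] linear_map_id mC_linear[OF z] _ mC_self_adjoint[OF z]])
  fix a b assume ab: "a \<in> carr C" "b \<in> carr C"
  have "mC a (mC z b) = mC z (mC a b)" using ab z mC_assoc mC_comm by metis
  then show "\<omega> c (mC a (mC z b)) = \<omega> (mC c z) (mC a b)"
    using ab z c mC_in by (simp add: form_invariant)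
qed auto

lemma D_cmap_sums_left:
  assumes c: "c \<in> carr C" and z: "z \<in> carr C"
  shows "cmap_sums C G (mC z) (\<lambda>u. u) (D c) (D (mC c z))"
proof (rule D_cmap_sums[OF c mC_in[OF c z] mC_linear[OF z] linear_map_id mC_self_adjoint[OF z]])
  fix a b assume ab: "a \<in> carr C" "b \<in> carr C"
  then show "\<omega> c (mC (mC z a) b) = \<omega> (mC c z) (mC a b)"
    using ab z c mC_in by (simp add: form_invariant mC_assoc)
qed auto

section \<open>The iterated coproduct\<close>

lemma ccop_left_term_in:
  assumes c: "c \<in> carr C"
  shows "ccop_left_term C G D (D c) p q r i \<in> carr (CCC p q r)"
  unfolding ccop_left_term_def by (rule cop_left_in[OF D_in[OF c] D_linear_Cp Cp_space])

lemma ccop_right_term_in: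
  assumes c: "c \<in> carr C"
  shows "ccop_right_term C G D (D c) p q r i \<in> carr (CCC p q r)"
  unfolding ccop_right_term_def by (rule cop_right_in[OF D_in[OF c] D_linear_Cp Cp_space])

text \<open>The inner coproduct of a leg x pairs with a \<otimes> b to \<omega>(x, ab). Hence the
  pairing with three vectors collapses to a pairing of \<open>D c\<close> with (ab) \<otimes>
  e.\<close>

lemma ccop_left_term_pairing:
  assumes c: "c \<in> carr C" and a: "a \<in> G (- p - d)" and b: "b \<in> G (- q - d)" and e: "e \<in> G (- r - d)"
  shows "ccop_left_term C G D (D c) p q r i (form3 a b e) =
     D c i r (form2 (mC a b) e)"
proof -
  note abe = Cp_le[OF a] Cp_le[OF b] Cp_le[OF e]
  have "ccop_left_term C G D (D c) p q r i (form3 a b e) =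
     D c i r (\<lambda>x w. D x p q (\<lambda>u v. \<omega> w e * (\<omega> u a * \<omega> v b)))"
    using form3_trilinear[OF abe]
    by (simp add: ccop_left_term_def cop_left_def lift_def tens3_def mult.commute)
  also have "\<dots> = D c i r (form2 (mC a b) e)"
  proof (rule tensor_cong[OF D_in[OF c] Cp_space Cp_space])
    fix x w assume x: "x \<in> carr (Cp i)"
    then have "x \<in> carr C" using Cp_le by auto
    then show "D x p q (\<lambda>u v. \<omega> w e * (\<omega> u a * \<omega> v b)) = \<omega> x (mC a b) * \<omega> w e"
      using tensor_form_mult[OF D_in form2_bilinear[OF abe(1,2)]]
      by (simp add: D_pairing_homogeneous[OF _ a b] mult.commute)
  qed
  finally show ?thesis .
qed

lemma ccop_right_term_pairing:
  assumes c: "c \<in> carr C" and a: "a \<in> G (- p - d)" and b: "b \<in> G (- q - d)" and e: "e \<in> G (- r - d)"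
  shows "ccop_right_term C G D (D c) p q r i (form3 a b e) =
     D c p i (form2 a (mC b e))"
proof -
  note abe = Cp_le[OF a] Cp_le[OF b] Cp_le[OF e]
  have "ccop_right_term C G D (D c) p q r i (form3 a b e) =
     D c p i (\<lambda>u x. D x q r (\<lambda>v w. \<omega> u a * (\<omega> v b * \<omega> w e)))"
    using form3_trilinear[OF abe]
    by (simp add: ccop_right_term_def cop_right_def lift_def tens3_def mult.assoc)
  also have "\<dots> = D c p i (form2 a (mC b e))"
  proof (rule tensor_cong[OF D_in[OF c] Cp_space Cp_space])
    fix u x assume x: "x \<in> carr (Cp i)"
    then have "x \<in> carr C" using Cp_le by auto
    then show "D x q r (\<lambda>v w. \<omega> u a * (\<omega> v b * \<omega> w e)) = \<omega> u a * \<omega> x (mC b e)"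
      using tensor_form_mult[OF D_in form2_bilinear[OF abe(2,3)]]
      by (simp add: D_pairing_homogeneous[OF _ b e])
  qed
  finally show ?thesis .
qed

text \<open>This makes the termwise iteration of the coproduct meaningful. With \<open>r\<close>
  fixed, the intermediate degrees i with nonzero pairing are first coordinates of the finitely many
  degrees that contribute to one pairing of \<open>D c\<close>.\<close>

lemma ccop_left_term_finite:
  assumes c: "c \<in> carr C"
  shows "finite {i. ccop_left_term C G D (D c) p q r i \<noteq> 0}"
proof (rule tensor3_finite_support[OF ccop_left_term_in[OF c]])
  fix a b e assume abe: "a \<in> G (- p - d)" "b \<in> G (- q - d)" "e \<in> G (- r - d)"
  have "{i. ccop_left_term C G D (D c) p q r i (form3 a b e) \<noteq> 0} \<subseteq>
     fst ` {(i, j). D c i j (form2 (mC a b) e) \<noteq> 0}"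
    by (force simp: ccop_left_term_pairing[OF c abe])
  moreover have "finite \<dots>"
    using D_pairing_finite[OF c mC_in[OF Cp_le[OF abe(1)] Cp_le[OF abe(2)]] Cp_le[OF abe(3)]] by simp
  ultimately show "finite {i. ccop_left_term C G D (D c) p q r i (form3 a b e) \<noteq> 0}"
    by (rule finite_subset)
qed

lemma ccop_right_term_finite:
  assumes c: "c \<in> carr C"
  shows "finite {i. ccop_right_term C G D (D c) p q r i \<noteq> 0}"
proof (rule tensor3_finite_support[OF ccop_right_term_in[OF c]])
  fix a b e assume abe: "a \<in> G (- p - d)" "b \<in> G (- q - d)" "e \<in> G (- r - d)"
  have "{i. ccop_right_term C G D (D c) p q r i (form3 a b e) \<noteq> 0} \<subseteq>
     snd ` {(i, j). D c i j (form2 a (mC b e)) \<noteq> 0}"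
    by (force simp: ccop_right_term_pairing[OF c abe])
  moreover have "finite \<dots>"
    using D_pairing_finite[OF c Cp_le[OF abe(1)] mC_in[OF Cp_le[OF abe(2)] Cp_le[OF abe(3)]]] by simp
  ultimately show "finite {i. ccop_right_term C G D (D c) p q r i (form3 a b e) \<noteq> 0}"
    by (rule finite_subset)
qed

lemma ccop_left_in:
  "c \<in> carr C \<Longrightarrow> ccop_left C G D (D c) p q r \<in> carr (CCC p q r)"
  unfolding ccop_left_def by (intro Sum_any_in is_space_tensor3_space ccop_left_term_in)

lemma ccop_right_in:
  "c \<in> carr C \<Longrightarrow> ccop_right C G D (D c) p q r \<in> carr (CCC p q r)"
  unfolding ccop_right_def by (intro Sum_any_in is_space_tensor3_space ccop_right_term_in)

lemma ccop_left_pairing: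
  assumes c: "c \<in> carr C" and a: "a \<in> G (- p - d)" and b: "b \<in> G (- q - d)" and e: "e \<in> G (- r - d)"
  shows "ccop_left C G D (D c) p q r (form3 a b e) = \<omega> c (mC (mC a b) e)"
proof -
  \<comment> \<open>The only intermediate degree that contributes: ab has degree (- p - d) + (- q -
    d), which is the degree complementary to p + q + d.\<close>
  let ?k = "p + q + d"
  have ab: "mC a b \<in> G (- ?k - d)" using mC_degree[OF a b] by (simp add: algebra_simps)
  have z: "D c i r (form2 (mC a b) e) = 0" if "i \<noteq> ?k" for i
    by (rule D_pairing_zero[OF c Cp_le[OF ab] Cp_le[OF e]])
      (use that in \<open>auto simp: hpart_homogeneous[OF C_graded ab]\<close>)
  have "ccop_left C G D (D c) p q r (form3 a b e) =
      Sum_any (\<lambda>i. D c i r (form2 (mC a b) e))"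
    by (simp add: ccop_left_def Sum_any_apply[OF ccop_left_term_finite[OF c]]
        ccop_left_term_pairing[OF c a b e])
  also have "\<dots> = (\<Sum>i\<in>{?k}. D c i r (form2 (mC a b) e))"
    by (rule Sum_any.expand_superset) (use z in auto)
  finally show ?thesis using D_pairing_homogeneous[OF c ab e] by simp
qed

lemma ccop_right_pairing:
  assumes c: "c \<in> carr C" and a: "a \<in> G (- p - d)" and b: "b \<in> G (- q - d)" and e: "e \<in> G (- r - d)"
  shows "ccop_right C G D (D c) p q r (form3 a b e) = \<omega> c (mC a (mC b e))"
proof -
  let ?k = "q + r + d"
  have be: "mC b e \<in> G (- ?k - d)" using mC_degree[OF b e] by (simp add: algebra_simps)
  have z: "D c p i (form2 a (mC b e)) = 0" if "i \<noteq> ?k" for i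
    by (rule D_pairing_zero[OF c Cp_le[OF a] Cp_le[OF be]])
      (use that in \<open>auto simp: hpart_homogeneous[OF C_graded be]\<close>)
  have "ccop_right C G D (D c) p q r (form3 a b e) =
      Sum_any (\<lambda>i. D c p i (form2 a (mC b e)))"
    by (simp add: ccop_right_def Sum_any_apply[OF ccop_right_term_finite[OF c]]
        ccop_right_term_pairing[OF c a b e])
  also have "\<dots> = (\<Sum>i\<in>{?k}. D c p i (form2 a (mC b e)))"
    by (rule Sum_any.expand_superset) (use z in auto)
  finally show ?thesis using D_pairing_homogeneous[OF c a be] by simp
qed

text \<open>The dual of associativity: both sides pair with three homogeneous vectors to \<omega>(c,
  abe), bracketed in the two possible ways.\<close>

lemma D_coassociative:
  assumes c: "c \<in> carr C"
  shows "ccop_right C G D (D c) = ccop_left C G D (D c)"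
proof -
  have "ccop_right C G D (D c) p q r = ccop_left C G D (D c) p q r" for p q r
    by (rule tensor3_eqI[OF ccop_right_in[OF c] ccop_left_in[OF c]])
      (simp add: ccop_left_pairing[OF c] ccop_right_pairing[OF c] mC_assoc Cp_le)
  then show ?thesis
    by (intro ext[of "ccop_right C G D (D c)"] ext[of "ccop_right C G D (D c) _"]
        ext[of "ccop_right C G D (D c) _ _"])
qed

text \<open>The pairing depends on the first two test vectors only through their commutative
  product, so exchanging the first two legs has no effect.\<close>

lemma ccop_left_flip:
  assumes c: "c \<in> carr C"
  shows "cflip_left C G (ccop_left C G D (D c)) = ccop_left C G D (D c)"
proof -
  have "cflip_left C G (ccop_left C G D (D c)) p q r = ccop_left C G D (D c) p q r" for p q r
  proof (rule tensor3_eqI[OF _ ccop_left_in[OF c]])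
    show "cflip_left C G (ccop_left C G D (D c)) p q r \<in> carr (CCC p q r)"
      unfolding cflip_left_def by (rule flip_left_in[OF ccop_left_in[OF c]])
    fix a b e assume abe: "a \<in> G (- p - d)" "b \<in> G (- q - d)" "e \<in> G (- r - d)"
    note abeC = Cp_le[OF abe(1)] Cp_le[OF abe(2)] Cp_le[OF abe(3)]
    have "cflip_left C G (ccop_left C G D (D c)) p q r (form3 a b e) =
       ccop_left C G D (D c) q p r (form3 b a e)"
      using form3_trilinear[OF abeC]
      by (simp add: cflip_left_def flip_left_def lift3_def tens3_def mult.commute)
    then show "cflip_left C G (ccop_left C G D (D c)) p q r (form3 a b e) =
       ccop_left C G D (D c) p q r (form3 a b e)"
      using ccop_left_pairing[OF c abe] ccop_left_pairing[OF c abe(2,1,3)] mC_comm[OF abeC(1,2)]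
      by simp
  qed
  then show ?thesis
    by (intro ext[of "cflip_left C G (ccop_left C G D (D c))"]
        ext[of "cflip_left C G (ccop_left C G D (D c)) _"]
        ext[of "cflip_left C G (ccop_left C G D (D c)) _ _"])
qed

end

section \<open>The graded algebra \<open>A \<otimes> C\<close>\<close>

lemma tensor_map_tens:
  assumes "linear_map P U f" "linear_map Q V g" "u \<in> carr P" "v \<in> carr Q"
  shows "tensor_map U V f g (tens P Q u v) = tens U V (f u) (g v)"
  unfolding tensor_map_def
  by (rule lift_tens[OF _ assms(3,4)], unfold bilinear_map_fun_space)
    (intro allI bilinear_mapI tens_linear_left tens_linear_right linear_map_in[OF assms(1)]
      linear_map_in[OF assms(2)] assms)

lemma tensor_map_add: "tensor_map U V f g (t + t') = tensor_map U V f g t + tensor_map U V f g t'"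
  by (simp add: tensor_map_def lift_def fun_eq_iff)

lemma tensor_map_linear:
  assumes "linear_map P U f" "linear_map Q V g"
  shows "linear_map (tensor_space P Q) (tensor_space U V) (tensor_map U V f g)"
  by (rule linear_mapI)
    (simp_all add: tensor_map_in[OF _ assms] tensor_map_add,
      simp add: tensor_map_def lift_def fscale_def)

text \<open>Regroups two copies of a three-term axiom when an induction on tensors passes to a
  sum.\<close>

lemma add3_eq_0:
  fixes a b c :: "'v::ab_group_add"
  assumes "a + b + c = 0" "a' + b' + c' = 0"
  shows "(a + a') + (b + b') + (c + c') = 0"
proof -
  have "(a + a') + (b + b') + (c + c') = (a + b + c) + (a' + b' + c')" by (simp add: ac_simps)
  then show ?thesis using assms by simp
qed

text \<open>
  Induction on tensors, which are functions, produces \<open>\<eta>\<close>-expanded instances such as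
  \<open>\<lambda>y. (x + x') y\<close>, which these rules would rewrite inside the abstraction.
\<close>

declare zero_fun_apply [simp del] plus_fun_apply [simp del]

text \<open>Of A only linear structure is assumed: a bilinear product and a linear coproduct, no
  axioms between them. The converse statement starts from such data and uses the same
  computations.\<close>

locale tensor_coalgebra = quadratic_coalgebra C G mC \<omega> D d
  for C :: "('k::field, 'c::ab_group_add) space" and G mC \<omega> D d +
  fixes A :: "('k, 'a::ab_group_add) space" and mA :: "'a \<Rightarrow> 'a \<Rightarrow> 'a"
    and \<Delta> :: "'a \<Rightarrow> ('k, 'a, 'a) tensor"
  assumes A_space: "is_space A"
    and mA_bilinear: "bilinear_map A A A mA"
    and \<Delta>_linear: "linear_map A (tensor_space A A) \<Delta>"
begin

abbreviation "T \<equiv> tensor_space A C"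
abbreviation "H \<equiv> tensor_grading A C G"
abbreviation "Tp p \<equiv> sub T (H p)"
abbreviation "M \<equiv> tensor_mult A mA C mC"
abbreviation "hat \<equiv> hat_coproduct A \<Delta> C G D"

section \<open>The grading of A \<otimes> C\<close>

lemma T_space: "is_space T"
  by (rule is_space_tensor_space)

lemma mA_in: "a \<in> carr A \<Longrightarrow> b \<in> carr A \<Longrightarrow> mA a b \<in> carr A"
  using bilinear_map_in[OF mA_bilinear] .

lemma \<Delta>_in: "a \<in> carr A \<Longrightarrow> \<Delta> a \<in> carr (tensor_space A A)"
  using linear_map_in[OF \<Delta>_linear] .

lemma H_subspace: "module.subspace fscale (H p)"
proof -
  interpret vector_space "fscale :: 'k \<Rightarrow> (('a \<Rightarrow> 'c \<Rightarrow> 'k) \<Rightarrow> 'k) \<Rightarrow> _"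
    by (rule vector_space_fscale)
  show ?thesis by (simp add: tensor_grading_def)
qed

lemma Tp_space: "is_space (Tp p)"
  by (rule is_space_sub[OF T_space]) (simp add: H_subspace)

lemma H_le: "x \<in> H p \<Longrightarrow> x \<in> carr T"
proof -
  interpret vector_space "fscale :: 'k \<Rightarrow> (('a \<Rightarrow> 'c \<Rightarrow> 'k) \<Rightarrow> 'k) \<Rightarrow> _"
    by (rule vector_space_fscale)
  have "H p \<subseteq> carr T"
    unfolding tensor_grading_def tensor_space_def space.simps
    by (rule span_mono) (use Cp_le in blast)
  then show "x \<in> H p \<Longrightarrow> x \<in> carr T" by blast
qed

lemma tens_in_H: "a \<in> carr A \<Longrightarrow> c \<in> G p \<Longrightarrow> tens A C a c \<in> H p"
proof -
  interpret vector_space "fscale :: 'k \<Rightarrow> (('a \<Rightarrow> 'c \<Rightarrow> 'k) \<Rightarrow> 'k) \<Rightarrow> _"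
    by (rule vector_space_fscale)
  show "a \<in> carr A \<Longrightarrow> c \<in> G p \<Longrightarrow> tens A C a c \<in> H p"
    unfolding tensor_grading_def by (rule span_base) blast
qed

lemma H_induct [consumes 1, case_names tens add]:
  assumes "x \<in> H p"
    and "\<And>a c. a \<in> carr A \<Longrightarrow> c \<in> G p \<Longrightarrow> P (tens A C a c)"
    and "\<And>x y. x \<in> H p \<Longrightarrow> y \<in> H p \<Longrightarrow> P x \<Longrightarrow> P y \<Longrightarrow> P (x + y)"
  shows "P x"
  using tens_span_induct[of x A C "G p" P] assms A_space Cp_le space_zero[OF Cp_space, of p, simplified]
  unfolding tensor_grading_def by blast

lemmas T_induct = tensor_induct[OF _ A_space C_space, consumes 1, case_names tens add]

text \<open>An explicit candidate for the homogeneous component. \<open>hpart\<close> for A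
  \<otimes> C is a definite description, of no use until existence and uniqueness of decompositions
  have been shown, which is done with this map.\<close>

definition proj :: "int \<Rightarrow> ('k, 'a, 'c) tensor \<Rightarrow> ('k, 'a, 'c) tensor" where
  "proj p = tensor_map A C (\<lambda>a. a) (\<lambda>c. hpart G c p)"

lemma hpart_linear_C: "linear_map C C (\<lambda>c. hpart G c p)"
  using hpart_linear[OF C_graded, of p] Cp_le by (auto simp: linear_map_def)

lemma hpart_in_C: "c \<in> carr C \<Longrightarrow> hpart G c p \<in> carr C"
  using linear_map_in[OF hpart_linear_C] .

lemma proj_linear: "linear_map T T (proj p)"
  unfolding proj_def by (rule tensor_map_linear[OF linear_map_id hpart_linear_C])

lemma proj_tens: "a \<in> carr A \<Longrightarrow> c \<in> carr C \<Longrightarrow> proj p (tens A C a c) = tens A C a (hpart G c p)"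
  unfolding proj_def by (rule tensor_map_tens[OF linear_map_id hpart_linear_C])

text \<open>This yields uniqueness of decompositions: applying the projection to a sum of
  homogeneous elements singles out one summand.\<close>

lemma proj_H: "x \<in> H i \<Longrightarrow> proj p x = (if p = i then x else 0)"
proof (induction rule: H_induct)
  case (tens a c)
  then show ?case
    using Cp_le by (simp add: proj_tens hpart_homogeneous[OF C_graded tens(2)] tens_zero_right[OF C_space])
next
  case (add x y)
  then show "proj p (x + y) = (if p = i then x + y else 0)"
    using linear_map_add[OF proj_linear H_le H_le] by simp
qed

lemma proj_decomposition:
  "x \<in> carr T \<Longrightarrow> (\<forall>i. proj i x \<in> H i) \<and> finite {i. proj i x \<noteq> 0} \<and> Sum_any (\<lambda>i. proj i x) = x"
proof (induction rule: T_induct)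
  case (tens a c)
  let ?S = "{i. hpart G c i \<noteq> 0}"
  have fin: "finite ?S" by (rule hpart_props(2)[OF C_graded tens(2)])
  \<comment> \<open>In general only an inclusion: a \<otimes> c_i can vanish although c_i does not,
    for instance when a = 0. The sums are therefore taken over the support of
    \<open>c\<close>.\<close>
  have sub: "{i. proj i (tens A C a c) \<noteq> 0} \<subseteq> ?S"
    using tens by (auto simp: proj_tens tens_zero_right[OF C_space])
  have "Sum_any (\<lambda>i. proj i (tens A C a c)) = (\<Sum>i\<in>?S. tens A C a (hpart G c i))"
    using Sum_any.expand_superset[OF fin sub] tens by (simp add: proj_tens)
  also have "\<dots> = tens A C a (\<Sum>i\<in>?S. hpart G c i)"
    by (rule linear_map_sum[OF bilinear_mapD2[OF tens_bilinear tens(1)] C_space, symmetric])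
      (rule hpart_in_C[OF tens(2)])
  also have "(\<Sum>i\<in>?S. hpart G c i) = c"
    using hpart_props(3)[OF C_graded tens(2)] by (simp add: Sum_any.expand_set)
  finally show ?case
    using finite_subset[OF sub fin] tens hpart_props(1)[OF C_graded tens(2)]
    by (auto simp: proj_tens intro: tens_in_H)
next
  case (add x y)
  have eq: "proj i (x + y) = proj i x + proj i y" for i
    using linear_map_add[OF proj_linear add(1,2)] .
  have "finite {i. proj i (x + y) \<noteq> 0}"
    by (rule finite_subset[of _ "{i. proj i x \<noteq> 0} \<union> {i. proj i y \<noteq> 0}"])
      (use add in \<open>auto simp: eq\<close>)
  then show "(\<forall>i. proj i (x + y) \<in> H i) \<and> finite {i. proj i (x + y) \<noteq> 0} \<and>
      Sum_any (\<lambda>i. proj i (x + y)) = x + y"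
    using add space_add[OF Tp_space] by (simp add: eq Sum_any.distrib)
qed

lemma T_graded: "graded_space T H"
  unfolding graded_space_def
proof (intro conjI allI ballI T_space)
  fix i show "module.subspace (scl T) (H i)" by (simp add: H_subspace)
  show "H i \<subseteq> carr T" using H_le by blast
next
  fix x assume x: "x \<in> carr T"
  show "\<exists>!f. (\<forall>i. f i \<in> H i) \<and> finite {i. f i \<noteq> 0} \<and> Sum_any f = x"
  proof (rule ex1I[of _ "\<lambda>i. proj i x"])
    show "(\<forall>i. proj i x \<in> H i) \<and> finite {i. proj i x \<noteq> 0} \<and> Sum_any (\<lambda>i. proj i x) = x"
      by (rule proj_decomposition[OF x])
  next
    fix f assume f: "(\<forall>i. f i \<in> H i) \<and> finite {i. f i \<noteq> 0} \<and> Sum_any f = x"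
    have "f p = proj p x" for p
    proof -
      \<comment> \<open>Adding p keeps the argument uniform when the component \<open>f p\<close> is
        zero.\<close>
      let ?S = "insert p {i. f i \<noteq> 0}"
      have "x = (\<Sum>i\<in>?S. f i)" using f Sum_any.expand_superset[of ?S f] by auto
      then have "proj p x = (\<Sum>i\<in>?S. proj p (f i))"
        using linear_map_sum[OF proj_linear T_space, of ?S f] f H_le by blast
      also have "\<dots> = (\<Sum>i\<in>?S. if p = i then f i else 0)"
        using f by (intro sum.cong refl proj_H) auto
      also have "\<dots> = f p" using f by simp
      finally show ?thesis by simp
    qed
    then show "f = (\<lambda>i. proj i x)" by blast
  qed
qed

lemma hpart_T: "x \<in> carr T \<Longrightarrow> hpart H x p = proj p x"
  using hpart_unique[OF T_graded, of x "\<lambda>i. proj i x"] proj_decomposition by auto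

lemma hpart_tens: "a \<in> carr A \<Longrightarrow> c \<in> carr C \<Longrightarrow> hpart H (tens A C a c) p = tens A C a (hpart G c p)"
  by (simp add: hpart_T tens_in proj_tens)

text \<open>Products of a finite spanning set of A with one of G p span the homogeneous piece;
  finite dimension of A enters here.\<close>

lemma T_fin_dim:
  assumes "fin_dim A"
  shows "fin_dim (Tp p)"
proof -
  interpret vector_space "fscale :: 'k \<Rightarrow> (('a \<Rightarrow> 'c \<Rightarrow> 'k) \<Rightarrow> 'k) \<Rightarrow> _"
    by (rule vector_space_fscale)
  interpret VA: vector_space "scl A" using A_space by (simp add: is_space_def)
  interpret VC: vector_space "scl C" using C_space by (simp add: is_space_def)
  obtain B where B: "finite B" "carr A = VA.span B" using assms by (auto simp: fin_dim_def)
  obtain E where E: "finite E" "G p = VC.span E"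
    using C_graded_algebra unfolding graded_algebra_def fin_dim_def scl_sub carr_sub by blast
  let ?S = "(\<lambda>(b, e). tens A C b e) ` (B \<times> E)"
  have BA: "b \<in> carr A" if "b \<in> B" for b using that B VA.span_base by blast
  have EC: "e \<in> G p" if "e \<in> E" for e using that E VC.span_base by blast
  \<comment> \<open>Carrier membership rides along in the induction, because \<open>tens\<close> is
    additive only on carrier vectors.\<close>
  have 1: "c \<in> carr C \<and> tens A C b c \<in> span ?S" if b: "b \<in> B" and c: "c \<in> VC.span E" for b c
    using c
  proof (induction rule: VC.span_induct_alt)
    case base
    show "0 \<in> carr C \<and> tens A C b 0 \<in> span ?S"
      using tens_zero_right[OF C_space BA[OF b]] span_zero space_zero[OF C_space] by metis
  next
    case (step k x y)
    have xG: "x \<in> carr C" by (rule Cp_le[OF EC[OF step(1)]])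
    have "tens A C b (scl C k x + y) = fscale k (tens A C b x) + tens A C b y"
      using xG step BA[OF b] space_scale[OF C_space] by (simp add: tens_add_right tens_scale_right)
    moreover have "tens A C b x \<in> span ?S" by (rule span_base) (use b step in auto)
    moreover have "scl C k x + y \<in> carr C"
      using xG step(2) space_scale[OF C_space] space_add[OF C_space] by blast
    ultimately show ?case using step(2) by (simp add: span_add span_scale)
  qed
  have 2: "a \<in> carr A \<and> tens A C a c \<in> span ?S" if a: "a \<in> VA.span B" and c: "c \<in> G p" for a c
    using a
  proof (induction rule: VA.span_induct_alt)
    case base
    show "0 \<in> carr A \<and> tens A C 0 c \<in> span ?S"
      using tens_zero_left[OF A_space Cp_le[OF c]] span_zero space_zero[OF A_space] by metis
  next
    case (step k x y)
    have xA: "x \<in> carr A" by (rule BA[OF step(1)])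
    have "tens A C (scl A k x + y) c = fscale k (tens A C x c) + tens A C y c"
      using xA step Cp_le[OF c] space_scale[OF A_space] by (simp add: tens_add_left tens_scale_left)
    moreover have "tens A C x c \<in> span ?S" using 1 step(1) c E by blast
    moreover have "scl A k x + y \<in> carr A"
      using xA step(2) space_scale[OF A_space] space_add[OF A_space] by blast
    ultimately show ?case using step(2) by (simp add: span_add span_scale)
  qed
  have "H p = span ?S"
  proof
    show "H p \<subseteq> span ?S"
      unfolding tensor_grading_def
      by (rule span_minimal) (use 2 B in auto)
    show "span ?S \<subseteq> H p"
      by (rule span_minimal) (use BA EC tens_in_H H_subspace in auto)
  qed
  moreover have "finite ?S" using B E by simp
  ultimately show ?thesis unfolding fin_dim_def by auto
qed

section \<open>The product on A \<otimes> C\<close>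

lemma mult_form_bilinear_right:
  assumes "a1 \<in> carr A" "c1 \<in> carr C"
  shows "bilinear_map A C scalars (\<lambda>a2 c2. tens A C (mA a1 a2) (mC c1 c2) y)"
  by (intro bilinear_mapI tens_linear_left tens_linear_right bilinear_mapD2[OF mA_bilinear]
      bilinear_mapD2[OF mC_bilinear] mA_in mC_in assms)

lemma mult_form_bilinear_left:
  assumes "a2 \<in> carr A" "c2 \<in> carr C"
  shows "bilinear_map A C scalars (\<lambda>a1 c1. tens A C (mA a1 a2) (mC c1 c2) y)"
  by (intro bilinear_mapI tens_linear_left tens_linear_right bilinear_mapD1[OF mA_bilinear]
      bilinear_mapD1[OF mC_bilinear] mA_in mC_in assms)

text \<open>The product is a \<open>lift\<close> inside a \<open>lift\<close>. Evaluating the outer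
  one requires that contracting the second factor leaves a bilinear expression in the first.\<close>

lemma M_outer_bilinear:
  assumes y: "y \<in> carr T"
  shows "bilinear_map A C fun_space (\<lambda>a1 c1. lift (\<lambda>a2 c2. tens A C (mA a1 a2) (mC c1 c2)) y)"
  unfolding bilinear_map_fun_space lift_def
proof (intro allI bilinear_mapI)
  fix a1 z assume a: "a1 \<in> carr A"
  show "linear_map C scalars (\<lambda>c1. y (\<lambda>a2 c2. tens A C (mA a1 a2) (mC c1 c2) z))"
    by (rule tensor_param_linear[OF y C_space mult_form_bilinear_right[OF a]], assumption)
      (rule bilinear_mapD2[OF mult_form_bilinear_left a])
next
  fix c1 z assume c: "c1 \<in> carr C"
  show "linear_map A scalars (\<lambda>a1. y (\<lambda>a2 c2. tens A C (mA a1 a2) (mC c1 c2) z))"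
    by (rule tensor_param_linear[OF y A_space mult_form_bilinear_right[OF _ c]], assumption)
      (rule bilinear_mapD1[OF mult_form_bilinear_left c])
qed

lemma M_in:
  assumes x: "x \<in> carr T" and y: "y \<in> carr T"
  shows "M x y \<in> carr T"
  unfolding tensor_mult_def
proof (rule lift_in[OF x M_outer_bilinear[OF y] T_space scl_tensor_space])
  fix a c assume "a \<in> carr A" "c \<in> carr C"
  then show "lift (\<lambda>a2 c2. tens A C (mA a a2) (mC c c2)) y \<in> carr T"
    by (intro lift_in[OF y _ T_space scl_tensor_space])
      (auto simp: bilinear_map_fun_space intro!: mult_form_bilinear_right tens_in mA_in mC_in)
qed

lemma M_tens:
  assumes "a1 \<in> carr A" "c1 \<in> carr C" "a2 \<in> carr A" "c2 \<in> carr C"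
  shows "M (tens A C a1 c1) (tens A C a2 c2) = tens A C (mA a1 a2) (mC c1 c2)"
  unfolding tensor_mult_def lift_tens[OF M_outer_bilinear[OF tens_in[OF assms(3,4)]] assms(1,2)]
  by (rule lift_tens) (auto simp: bilinear_map_fun_space intro!: mult_form_bilinear_right assms)

text \<open>The two arguments play different roles: in x linearity is pointwise from the definition,
  while y occurs inside the form to which x is applied and needs linearity in a parameter.\<close>

lemma M_bilinear: "bilinear_map T T T M"
proof (intro bilinear_mapI)
  fix x assume x: "x \<in> carr T"
  have "linear_map T scalars (\<lambda>y. M x y z)" for z
    unfolding tensor_mult_def lift_def
  proof (rule tensor_param_linear[OF x T_space])
    show "bilinear_map A C scalars (\<lambda>a1 c1. y (\<lambda>a2 c2. tens A C (mA a1 a2) (mC c1 c2) z))"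
      if "y \<in> carr T" for y
      using M_outer_bilinear[OF that] by (simp add: bilinear_map_fun_space lift_def)
  qed (simp add: linear_map_def fscale_def plus_fun_apply)
  then show "linear_map T T (M x)"
    using M_in[OF x] by (auto simp: linear_map_def fscale_def fun_eq_iff plus_fun_apply)
next
  fix y assume "y \<in> carr T"
  then show "linear_map T T (\<lambda>x. M x y)"
    using M_in by (auto simp: linear_map_def tensor_mult_def lift_def fscale_def fun_eq_iff plus_fun_apply)
qed

lemmas M_add_left = linear_map_add[OF bilinear_mapD1[OF M_bilinear]]
  and M_add_right = linear_map_add[OF bilinear_mapD2[OF M_bilinear]]

lemma M_degree:
  assumes x: "x \<in> H i" and y: "y \<in> H j"
  shows "M x y \<in> H (i + j)"
proof -
  note sp = space_add[OF Tp_space[of "i + j"], simplified]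
  show ?thesis
    using x
  proof (induction rule: H_induct)
    case (tens a c)
    note pure = tens_in[OF tens(1) Cp_le[OF tens(2)]]
    show ?case
      using y
    proof (induction rule: H_induct)
      case (tens b e)
      then show ?case
        using \<open>a \<in> carr A\<close> \<open>c \<in> G i\<close> by (simp add: M_tens Cp_le tens_in_H mA_in mC_degree)
    next
      case (add x y)
      then show "M (tens A C a c) (x + y) \<in> H (i + j)" using M_add_right[OF pure H_le H_le] sp by simp
    qed
  next
    case (add x x')
    then show "M (x + x') y \<in> H (i + j)" using M_add_left[OF H_le[OF y] H_le H_le] sp by simp
  qed
qed

lemma T_graded_algebra: "fin_dim A \<Longrightarrow> graded_algebra T H M"
  by (simp add: graded_algebra_def T_graded T_fin_dim M_bilinear M_degree)

text \<open>The three products involve the same three elements of C, in different orders and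
  bracketings, hence share one factor by which the A-parts can be collected. No axiom for A is used,
  so the identity also serves the converse.\<close>

lemma M_anti_leibniz_tens:
  assumes "a1 \<in> carr A" "a2 \<in> carr A" "a3 \<in> carr A" "c1 \<in> carr C" "c2 \<in> carr C" "c3 \<in> carr C"
  shows "M (tens A C a1 c1) (M (tens A C a2 c2) (tens A C a3 c3)) +
      M (M (tens A C a1 c1) (tens A C a2 c2)) (tens A C a3 c3) +
      M (tens A C a2 c2) (M (tens A C a1 c1) (tens A C a3 c3)) =
    tens A C (mA a1 (mA a2 a3) + mA (mA a1 a2) a3 + mA a2 (mA a1 a3)) (mC c1 (mC c2 c3))"
proof -
  have 1: "mC c2 (mC c1 c3) = mC c1 (mC c2 c3)" using assms mC_assoc mC_comm by metis
  show ?thesis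
    using assms by (simp add: M_tens mA_in mC_in 1 mC_assoc tens_add_left space_add[OF A_space])
qed

lemma T_anti_leibniz:
  assumes "anti_leibniz_algebra A mA"
  shows "anti_leibniz_algebra T M"
  unfolding anti_leibniz_algebra_def
proof (intro conjI ballI T_space M_bilinear)
  fix x y z assume x: "x \<in> carr T" and y: "y \<in> carr T" and z: "z \<in> carr T"
  show "M x (M y z) + M (M x y) z + M y (M x z) = 0"
    using x
  proof (induction rule: T_induct)
    case (tens a1 c1)
    note x = tens tens_in[OF tens]
    show ?case
      using y
    proof (induction rule: T_induct)
      case (tens a2 c2)
      note y = tens tens_in[OF tens]
      show ?case
        using z
      proof (induction rule: T_induct)
        case (tens a3 c3)
        have "mA a1 (mA a2 a3) + mA (mA a1 a2) a3 + mA a2 (mA a1 a3) = 0"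
          using assms x y tens by (simp add: anti_leibniz_algebra_def)
        then show ?case
          using M_anti_leibniz_tens[OF x(1) y(1) tens(1) x(2) y(2) tens(2)]
            tens_zero_left[OF A_space mC_in[OF x(2) mC_in[OF y(2) tens(2)]]] by metis
      next
        case (add z z')
        then show "M (tens A C a1 c1) (M (tens A C a2 c2) (z + z')) + M (M (tens A C a1 c1) (tens A C a2 c2)) (z + z') + M (tens A C a2 c2) (M (tens A C a1 c1) (z + z')) = 0"
          using x y add3_eq_0[OF add(3,4)] by (simp add: M_add_right M_in)
      qed
    next
      case (add y y')
      then show "M (tens A C a1 c1) (M (y + y') z) + M (M (tens A C a1 c1) (y + y')) z + M (y + y') (M (tens A C a1 c1) z) = 0"
        using x z add3_eq_0[OF add(3,4)] by (simp add: M_add_right M_add_left M_in)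
    qed
  next
    case (add x x')
    then show "M (x + x') (M y z) + M (M (x + x') y) z + M y (M (x + x') z) = 0"
      using y z add3_eq_0[OF add(3,4)] by (simp add: M_add_right M_add_left M_in)
  qed
qed

end

section \<open>The coproduct on \<open>A \<otimes> C\<close>\<close>

lemma tens_form: "bilinear_map U V scalars \<beta> \<Longrightarrow> tens U V u v \<beta> = \<beta> u v"
  by (simp add: tens_def)

lemma tens3_form: "trilinear_map U V W scalars \<gamma> \<Longrightarrow> tens3 U V W u v w \<gamma> = \<gamma> u v w"
  by (simp add: tens3_def)

lemma lift_sum: "lift h (sum t K) = (\<Sum>k\<in>K. lift h (t k))"
  by (simp add: lift_def fun_eq_iff sum_fun_apply)

lemma lift_zero: "lift h 0 = 0"
  by (simp add: lift_def zero_fun_def)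

lemma lift3_zero: "lift3 h 0 = 0"
  by (simp add: lift3_def zero_fun_def)

text \<open>Additivity is asked for only along the family itself, since for a map such as
  \<open>bul3\<close> it is established only on the appropriate tensor space.\<close>

lemma Sum_any_hom:
  assumes "finite {z. T z \<noteq> 0}" "f 0 = 0" "\<And>K. f (sum T K) = (\<Sum>z\<in>K. f (T z))"
  shows "finite {z. f (T z) \<noteq> 0}" "Sum_any (\<lambda>z. f (T z)) = f (Sum_any T)"
proof -
  have sub: "{z. f (T z) \<noteq> 0} \<subseteq> {z. T z \<noteq> 0}" using assms(2) by auto
  show "finite {z. f (T z) \<noteq> 0}" by (rule finite_subset[OF sub assms(1)])
  show "Sum_any (\<lambda>z. f (T z)) = f (Sum_any T)"
    by (simp add: Sum_any.expand_superset[OF assms(1) sub] Sum_any.expand_set[of T] assms(3))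
qed

context
  fixes V :: "('k::field, 'v::ab_group_add) space" and G :: "int \<Rightarrow> 'v set"
  assumes V: "graded_space V G"
begin

lemma cmap_term_add: "cmap_term V G f g (X + X') p q z = cmap_term V G f g X p q z + cmap_term V G f g X' p q z"
  by (cases z) (simp add: cmap_term_def tensor_map_add plus_fun_apply)

text \<open>\<open>Sum_any\<close> is additive only for finite supports, which is what
  \<open>cmap_sums\<close> supplies. Additivity in the tensor and additivity in the two maps both
  follow from this one rule.\<close>

lemma cmap_sums_combine:
  assumes "cmap_sums V G f g X Y" "cmap_sums V G f' g' X' Y'"
    and "\<And>p q z. cmap_term V G f'' g'' X'' p q z = cmap_term V G f g X p q z + cmap_term V G f' g' X' p q z"
  shows "cmap_sums V G f'' g'' X'' (Y + Y')"
proof -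
  let ?s = "\<lambda>p q. {z. cmap_term V G f g X p q z \<noteq> 0}" and ?s' = "\<lambda>p q. {z. cmap_term V G f' g' X' p q z \<noteq> 0}"
  have fin: "finite (?s p q)" "finite (?s' p q)" for p q using assms by (auto simp: cmap_sums_def)
  have "finite {z. cmap_term V G f'' g'' X'' p q z \<noteq> 0}" for p q
    by (rule finite_subset[of _ "?s p q \<union> ?s' p q"]) (use fin in \<open>auto simp: assms(3)\<close>)
  moreover have "cmap V G f'' g'' X'' p q = Y p q + Y' p q" for p q
  proof -
    have "cmap V G f'' g'' X'' p q =
        Sum_any (\<lambda>z. cmap_term V G f g X p q z + cmap_term V G f' g' X' p q z)"
      by (simp add: cmap_eq_Sum_any assms(3)[symmetric])
    also have "\<dots> = Y p q + Y' p q"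
      using assms(1,2) by (subst Sum_any.distrib[OF fin]) (simp add: cmap_sums_def cmap_eq_Sum_any[symmetric])
    finally show ?thesis .
  qed
  ultimately show ?thesis by (simp add: cmap_sums_def fun_eq_iff plus_fun_apply)
qed

lemma cmap_sums_add:
  "cmap_sums V G f g X Y \<Longrightarrow> cmap_sums V G f g X' Y' \<Longrightarrow> cmap_sums V G f g (X + X') (Y + Y')"
  by (erule (1) cmap_sums_combine) (rule cmap_term_add)

lemma hpart_compose_linear:
  assumes "linear_map V V f"
  shows "linear_map (sub V (G i)) (sub V (G p)) (\<lambda>u. hpart G (f u) p)"
  by (rule linear_map_compose[OF hpart_linear[OF V]], rule linear_map_sub[OF assms])
    (use graded_space_le[OF V] in auto)

text \<open>Additivity in the maps. The hypothesis speaks of pure tensors of components, so that a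
  decomposition in the left leg and one in the right leg are both instances.\<close>

lemma cmap_sums_split:
  assumes "cmap_sums V G f g X Y" "cmap_sums V G f' g' X Y'"
    and X: "\<And>i j. X i j \<in> carr (tensor_space (sub V (G i)) (sub V (G j)))"
    and lin: "linear_map V V f" "linear_map V V g" "linear_map V V f'" "linear_map V V g'"
    and split: "\<And>u v p q. u \<in> carr V \<Longrightarrow> v \<in> carr V \<Longrightarrow>
      tens (sub V (G p)) (sub V (G q)) (hpart G (f'' u) p) (hpart G (g'' v) q) =
      tens (sub V (G p)) (sub V (G q)) (hpart G (f u) p) (hpart G (g v) q) +
      tens (sub V (G p)) (sub V (G q)) (hpart G (f' u) p) (hpart G (g' v) q)"
  shows "cmap_sums V G f'' g'' X (Y + Y')"
  using assms(1,2)
proof (rule cmap_sums_combine)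
  note sp = graded_space_sub[OF V] and le = graded_space_le[OF V]
  fix p q :: int and z :: "int \<times> int"
  obtain i j where z: "z = (i, j)" by (cases z)
  have b: "bilinear_map (sub V (G i)) (sub V (G j)) scalars
      (\<lambda>u v. tens (sub V (G p)) (sub V (G q)) (hpart G (f u) p) (hpart G (g v) q) \<beta>)"
    if "linear_map V V f" "linear_map V V g" for f g \<beta>
    by (intro bilinear_mapI tens_linear_left tens_linear_right hpart_compose_linear that
        linear_map_in[OF hpart_compose_linear[OF that(1)]]
        linear_map_in[OF hpart_compose_linear[OF that(2)]])
  have "cmap_term V G f'' g'' X p q (i, j) \<beta> =
      cmap_term V G f g X p q (i, j) \<beta> + cmap_term V G f' g' X p q (i, j) \<beta>" for \<beta>
  proof -
    have "cmap_term V G f'' g'' X p q (i, j) \<beta> =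
      X i j (\<lambda>u v. tens (sub V (G p)) (sub V (G q)) (hpart G (f u) p) (hpart G (g v) q) \<beta> +
        tens (sub V (G p)) (sub V (G q)) (hpart G (f' u) p) (hpart G (g' v) q) \<beta>)"
      unfolding cmap_term_def tensor_map_def lift_def case_prod_conv
      by (rule tensor_cong[OF X sp sp]) (use le split in \<open>auto simp: plus_fun_apply\<close>)
    also have "\<dots> = cmap_term V G f g X p q (i, j) \<beta> + cmap_term V G f' g' X p q (i, j) \<beta>"
      unfolding tensor_form_add[OF X b[OF lin(1,2)] b[OF lin(3,4)]]
      by (simp add: cmap_term_def tensor_map_def lift_def)
    finally show ?thesis .
  qed
  then show "cmap_term V G f'' g'' X p q z = cmap_term V G f g X p q z + cmap_term V G f' g' X p q z"
    by (simp add: z fun_eq_iff plus_fun_apply)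
qed

lemma hpart_map_add:
  assumes "linear_map V V f" "linear_map V V g" "u \<in> carr V" "k u = f u + g u"
  shows "hpart G (k u) p = hpart G (f u) p + hpart G (g u) p"
  using linear_map_add[OF hpart_linear[OF V] linear_map_in[OF assms(1,3)] linear_map_in[OF assms(2,3)]]
    assms(4) by simp

lemma hpart_map_in: "linear_map V V f \<Longrightarrow> u \<in> carr V \<Longrightarrow> hpart G (f u) p \<in> carr (sub V (G p))"
  using hpart_props(1)[OF V linear_map_in] by simp

lemma cmap_sums_add_left:
  assumes "cmap_sums V G f h X Y" "cmap_sums V G g h X Y'"
    and X: "\<And>i j. X i j \<in> carr (tensor_space (sub V (G i)) (sub V (G j)))"
    and f: "linear_map V V f" and g: "linear_map V V g" and h: "linear_map V V h"
    and k: "\<And>u. u \<in> carr V \<Longrightarrow> k u = f u + g u"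
  shows "cmap_sums V G k h X (Y + Y')"
  by (rule cmap_sums_split[OF assms(1,2) X f h g h])
    (simp only: hpart_map_add[where k = k, OF f g _ k] tens_add_left hpart_map_in[OF f]
      hpart_map_in[OF g] hpart_map_in[OF h])

lemma cmap_sums_add_right:
  assumes "cmap_sums V G h f X Y" "cmap_sums V G h g X Y'"
    and X: "\<And>i j. X i j \<in> carr (tensor_space (sub V (G i)) (sub V (G j)))"
    and f: "linear_map V V f" and g: "linear_map V V g" and h: "linear_map V V h"
    and k: "\<And>u. u \<in> carr V \<Longrightarrow> k u = f u + g u"
  shows "cmap_sums V G h k X (Y + Y')"
  by (rule cmap_sums_split[OF assms(1,2) X h f h g])
    (simp only: hpart_map_add[where k = k, OF f g _ k] tens_add_right hpart_map_in[OF f]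
      hpart_map_in[OF g] hpart_map_in[OF h])

end

lemma ccop_left_term_add:
  "ccop_left_term V K F (X + X') p q r i = ccop_left_term V K F X p q r i + ccop_left_term V K F X' p q r i"
  by (simp add: ccop_left_term_def cop_left_def lift_def fun_eq_iff plus_fun_apply)

lemma ccop_right_term_add:
  "ccop_right_term V K F (X + X') p q r i = ccop_right_term V K F X p q r i + ccop_right_term V K F X' p q r i"
  by (simp add: ccop_right_term_def cop_right_def lift_def fun_eq_iff plus_fun_apply)

lemma finite_support_add:
  fixes f g :: "'x \<Rightarrow> 'y::ab_group_add"
  shows "finite {z. f z \<noteq> 0} \<Longrightarrow> finite {z. g z \<noteq> 0} \<Longrightarrow> finite {z. f z + g z \<noteq> 0}"
  by (rule finite_subset[of _ "{z. f z \<noteq> 0} \<union> {z. g z \<noteq> 0}"]) auto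

text \<open>Definedness of both summands makes every sum over the intermediate degree finitely
  supported, which is exactly what additivity of \<open>Sum_any\<close> requires.\<close>

lemma ccop_left_add:
  assumes "ccop_left_defined V K F X" "ccop_left_defined V K F X'"
  shows "ccop_left_defined V K F (X + X')" "ccop_left V K F (X + X') = ccop_left V K F X + ccop_left V K F X'"
  using assms
  by (simp_all add: ccop_left_defined_def ccop_left_def ccop_left_term_add finite_support_add Sum_any.distrib)
    (simp add: fun_eq_iff plus_fun_apply)

lemma ccop_right_add:
  assumes "ccop_right_defined V K F X" "ccop_right_defined V K F X'"
  shows "ccop_right_defined V K F (X + X')" "ccop_right V K F (X + X') = ccop_right V K F X + ccop_right V K F X'"
  using assms
  by (simp_all add: ccop_right_defined_def ccop_right_def ccop_right_term_add finite_support_add Sum_any.distrib)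
    (simp add: fun_eq_iff plus_fun_apply)

lemma cflip_left_add: "cflip_left V K (X + X') = cflip_left V K X + cflip_left V K X'"
  by (simp add: cflip_left_def flip_left_def lift3_def fun_eq_iff plus_fun_apply)

lemma id_linear: "linear_map V V id"
  by (simp add: linear_map_def)

context tensor_coalgebra
begin

section \<open>The bullet product and the coproduct formula\<close>

abbreviation "pair p q a1 c1 a2 c2 \<equiv> tens (Tp p) (Tp q) (tens A C a1 c1) (tens A C a2 c2)"
abbreviation "tens3_T p q r \<equiv> tens3 (Tp p) (Tp q) (Tp r)"
abbreviation "triple p q r a1 c1 a2 c2 a3 c3 \<equiv>
  tens3_T p q r (tens A C a1 c1) (tens A C a2 c2) (tens A C a3 c3)"
abbreviation "triple_C p q r a1 a2 a3 \<gamma> \<equiv> (\<lambda>c1 c2 c3. triple p q r a1 c1 a2 c2 a3 c3 \<gamma>)"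
abbreviation "bul \<equiv> bullet A C G"

lemma tens_A_linear:
  assumes "linear_map P A f" "c \<in> G p"
  shows "linear_map P (Tp p) (\<lambda>x. tens A C (f x) c)"
  using linear_map_compose[OF bilinear_mapD1[OF tens_bilinear Cp_le[OF assms(2)]] assms(1)]
    linear_map_in[OF assms(1)] tens_in_H[OF _ assms(2)]
  by (auto simp: linear_map_def)

lemma tens_C_linear:
  assumes "linear_map P (Cp p) f" "a \<in> carr A"
  shows "linear_map P (Tp p) (\<lambda>x. tens A C a (f x))"
proof -
  have "linear_map P C f" using assms(1) Cp_le by (auto simp: linear_map_def)
  from linear_map_compose[OF bilinear_mapD2[OF tens_bilinear assms(2)] this]
  show ?thesis using linear_map_in[OF assms(1)] tens_in_H[OF assms(2)]
    by (auto simp: linear_map_def)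
qed

lemma pair_bilinear_A:
  assumes f: "linear_map A A f" and g: "linear_map A A g" and "c1 \<in> G p" "c2 \<in> G q"
  shows "bilinear_map A A scalars (\<lambda>a1 a2. pair p q (f a1) c1 (g a2) c2 \<beta>)"
  by (intro bilinear_mapI tens_linear_left tens_linear_right tens_A_linear assms)
    (use linear_map_in[OF f] linear_map_in[OF g] assms in \<open>auto intro: tens_in_H\<close>)

lemma pair_bilinear_C:
  assumes f: "linear_map (Cp i) (Cp p) f" and g: "linear_map (Cp j) (Cp q) g"
    and "a1 \<in> carr A" "a2 \<in> carr A"
  shows "bilinear_map (Cp i) (Cp j) scalars (\<lambda>c1 c2. pair p q a1 (f c1) a2 (g c2) \<beta>)"
  by (intro bilinear_mapI tens_linear_left tens_linear_right tens_C_linear assms)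
    (use linear_map_in[OF f] linear_map_in[OF g] assms in \<open>auto intro: tens_in_H\<close>)

lemma triple_trilinear_A:
  assumes "c1 \<in> G p" "c2 \<in> G q" "c3 \<in> G r"
  shows "trilinear_map A A A scalars (\<lambda>a1 a2 a3. triple p q r a1 c1 a2 c2 a3 c3 \<gamma>)"
  by (intro trilinear_mapI tens3_linear tens_A_linear linear_map_id assms)
    (use assms in \<open>auto intro: tens_in_H\<close>)

lemma triple_trilinear_C:
  assumes "a1 \<in> carr A" "a2 \<in> carr A" "a3 \<in> carr A"
  shows "trilinear_map (Cp p) (Cp q) (Cp r) scalars (\<lambda>c1 c2 c3. triple p q r a1 c1 a2 c2 a3 c3 \<gamma>)"
  by (intro trilinear_mapI tens3_linear tens_C_linear linear_map_id assms)
    (use assms in \<open>auto intro: tens_in_H\<close>)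

lemma bullet_eval: "bul t X i j \<beta> = t (\<lambda>a1 a2. X i j (\<lambda>c1 c2. pair i j a1 c1 a2 c2 \<beta>))"
  by (simp add: bullet_def lift_def)

lemma bullet_form:
  assumes "bilinear_map (Tp i) (Tp j) scalars \<beta>"
  shows "bul t X i j \<beta> = t (\<lambda>a1 a2. X i j (\<lambda>c1 c2. \<beta> (tens A C a1 c1) (tens A C a2 c2)))"
  by (simp add: bullet_eval tens_form[OF assms])

text \<open>Contracting the C-variables leaves a bilinear form in the A-variables, so a tensor over
  A may be evaluated on the result.\<close>

lemma pair_outer_bilinear:
  assumes X: "X \<in> carr (CC i j)"
    and f: "linear_map (Cp i) (Cp p) f" and g: "linear_map (Cp j) (Cp q) g"
    and f': "linear_map A A f'" and g': "linear_map A A g'"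
  shows "bilinear_map A A scalars (\<lambda>a1 a2. X (\<lambda>c1 c2. pair p q (f' a1) (f c1) (g' a2) (g c2) \<beta>))"
proof (rule bilinear_mapI)
  fix a1 assume a1: "a1 \<in> carr A"
  show "linear_map A scalars (\<lambda>a2. X (\<lambda>c1 c2. pair p q (f' a1) (f c1) (g' a2) (g c2) \<beta>))"
  proof (rule tensor_param_linear[OF X A_space])
    show "bilinear_map (Cp i) (Cp j) scalars (\<lambda>c1 c2. pair p q (f' a1) (f c1) (g' a2) (g c2) \<beta>)"
      if "a2 \<in> carr A" for a2
      by (rule pair_bilinear_C[OF f g linear_map_in[OF f' a1] linear_map_in[OF g' that]])
    show "linear_map A scalars (\<lambda>a2. pair p q (f' a1) (f c1) (g' a2) (g c2) \<beta>)"
      if c: "c1 \<in> carr (Cp i)" "c2 \<in> carr (Cp j)" for c1 c2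
      by (rule bilinear_mapD2[OF pair_bilinear_A[OF f' g'] a1])
        (use linear_map_in[OF f c(1)] linear_map_in[OF g c(2)] in simp_all)
  qed
next
  fix a2 assume a2: "a2 \<in> carr A"
  show "linear_map A scalars (\<lambda>a1. X (\<lambda>c1 c2. pair p q (f' a1) (f c1) (g' a2) (g c2) \<beta>))"
  proof (rule tensor_param_linear[OF X A_space])
    show "bilinear_map (Cp i) (Cp j) scalars (\<lambda>c1 c2. pair p q (f' a1) (f c1) (g' a2) (g c2) \<beta>)"
      if "a1 \<in> carr A" for a1
      by (rule pair_bilinear_C[OF f g linear_map_in[OF f' that] linear_map_in[OF g' a2]])
    show "linear_map A scalars (\<lambda>a1. pair p q (f' a1) (f c1) (g' a2) (g c2) \<beta>)"
      if c: "c1 \<in> carr (Cp i)" "c2 \<in> carr (Cp j)" for c1 c2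
      by (rule bilinear_mapD1[OF pair_bilinear_A[OF f' g'] a2])
        (use linear_map_in[OF f c(1)] linear_map_in[OF g c(2)] in simp_all)
  qed
qed

lemma bullet_in:
  assumes t: "t \<in> carr (tensor_space A A)" and X: "X i j \<in> carr (CC i j)"
  shows "bul t X i j \<in> carr (tensor_space (Tp i) (Tp j))"
  unfolding bullet_def
proof (rule lift_in[OF t _ is_space_tensor_space scl_tensor_space])
  show "bilinear_map A A fun_space (\<lambda>a1 a2. lift (\<lambda>c1 c2. pair i j a1 c1 a2 c2) (X i j))"
    unfolding bilinear_map_fun_space lift_def
    using pair_outer_bilinear[OF X linear_map_id linear_map_id linear_map_id linear_map_id] by blast
  fix a1 a2 assume a: "a1 \<in> carr A" "a2 \<in> carr A"
  show "lift (\<lambda>c1 c2. pair i j a1 c1 a2 c2) (X i j) \<in> carr (tensor_space (Tp i) (Tp j))"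
  proof (rule lift_in[OF X _ is_space_tensor_space scl_tensor_space])
    show "bilinear_map (Cp i) (Cp j) fun_space (\<lambda>c1 c2. pair i j a1 c1 a2 c2)"
      unfolding bilinear_map_fun_space
      using pair_bilinear_C[OF linear_map_id linear_map_id a] by blast
  qed (use a in \<open>auto intro!: tens_in tens_in_H\<close>)
qed

lemma bullet_add: "bul (t + t') X = bul t X + bul t' X"
  by (simp add: bullet_eval fun_eq_iff plus_fun_apply)

lemma bullet_diff: "bul (t - t') X = bul t X - bul t' X"
  by (simp add: bullet_eval fun_eq_iff)

lemma bullet_zero: "bul 0 X = 0"
  by (simp add: bullet_eval fun_eq_iff zero_fun_apply)

text \<open>Linearity in c comes from \<open>D\<close>, linearity in a from \<Delta>. This is what
  makes a \<otimes> c \<mapsto> \<Delta>(a) \<bullet> D(c) well defined on A \<otimes> C.\<close>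

lemma hat_outer_bilinear: "bilinear_map A C fun_space (\<lambda>a c. bul (\<Delta> a) (D c) i j)"
  unfolding bilinear_map_fun_space bullet_eval
proof (intro allI bilinear_mapI)
  fix a \<beta> assume a: "a \<in> carr A"
  show "linear_map C scalars (\<lambda>c. \<Delta> a (\<lambda>a1 a2. D c i j (\<lambda>c1 c2. pair i j a1 c1 a2 c2 \<beta>)))"
  proof (rule tensor_param_linear[OF \<Delta>_in[OF a] C_space])
    show "bilinear_map A A scalars (\<lambda>a1 a2. D c i j (\<lambda>c1 c2. pair i j a1 c1 a2 c2 \<beta>))"
      if "c \<in> carr C" for c
      using pair_outer_bilinear[OF D_in[OF that] linear_map_id linear_map_id linear_map_id linear_map_id] .
  qed (rule linear_map_eval[OF D_linear scl_tensor_space])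
next
  fix c \<beta>
  show "linear_map A scalars (\<lambda>a. \<Delta> a (\<lambda>a1 a2. D c i j (\<lambda>c1 c2. pair i j a1 c1 a2 c2 \<beta>)))"
    by (rule linear_map_eval[OF \<Delta>_linear scl_tensor_space])
qed

lemma hat_tens: "a \<in> carr A \<Longrightarrow> c \<in> carr C \<Longrightarrow> hat (tens A C a c) = bul (\<Delta> a) (D c)"
  by (intro ext[of "hat _"] ext[of "hat _ _"])
    (simp only: hat_coproduct_def lift_tens[OF hat_outer_bilinear])

lemma hat_in:
  assumes x: "x \<in> carr T"
  shows "hat x i j \<in> carr (tensor_space (Tp i) (Tp j))"
  unfolding hat_coproduct_def
  by (rule lift_in[OF x hat_outer_bilinear is_space_tensor_space scl_tensor_space bullet_in[OF \<Delta>_in D_in]])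

lemma hat_add: "hat (x + y) = hat x + hat y"
  by (simp add: hat_coproduct_def lift_def fun_eq_iff plus_fun_apply)

lemma hat_linear_component: "linear_map T (tensor_space (Tp i) (Tp j)) (\<lambda>x. hat x i j)"
  by (rule linear_mapI)
    (simp_all add: hat_in hat_add plus_fun_apply, simp add: hat_coproduct_def lift_def fscale_def)

lemma hat_linear: "linear_map T (ctensor_space T H T H) hat"
  using hat_in
  by (auto simp: linear_map_def ctensor_space_def hat_add hat_coproduct_def lift_def fscale_def fun_eq_iff
      plus_fun_apply)

text \<open>
  The termwise maps on \<open>(A \<otimes> C) \<otimes> (A \<otimes> C)\<close> split along the two factors; by Fubini the
  summation over degrees only concerns \<open>C\<close>.
\<close>

lemma cmap_sums_bullet:
  assumes t: "t \<in> carr (tensor_space A A)"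
    and X: "\<And>i j. X i j \<in> carr (CC i j)"
    and Y: "\<And>i j. Y i j \<in> carr (CC i j)"
    and f: "linear_map T T f" and g: "linear_map T T g"
    and f1: "linear_map A A f1" and g1: "linear_map A A g1"
    and f2: "linear_map C C f2" and g2: "linear_map C C g2"
    and f_tens: "\<And>a c. a \<in> carr A \<Longrightarrow> c \<in> carr C \<Longrightarrow> f (tens A C a c) = tens A C (f1 a) (f2 c)"
    and g_tens: "\<And>a c. a \<in> carr A \<Longrightarrow> c \<in> carr C \<Longrightarrow> g (tens A C a c) = tens A C (g1 a) (g2 c)"
    and XY: "cmap_sums C G f2 g2 X Y"
  shows "cmap_sums T H f g (bul t X) (bul (tensor_map A A f1 g1 t) Y)"
proof -
  \<comment> \<open>With the A-part of \<open>t\<close> and the maps \<open>f1\<close>,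
    \<open>g1\<close> absorbed, this sends c1 \<otimes> c2 to the interleaved tensor in degree (p,
    q). A single linear map independent of (i, j) thus carries terms for C to terms for A \<otimes>
    C.\<close>
  define K where "K p q = (\<lambda>c1 c2. lift (\<lambda>a1 a2. pair p q (f1 a1) c1 (g1 a2) c2) t)" for p q
  have lf: "linear_map (Cp i) (Cp p) (\<lambda>u. hpart G (f2 u) p)"
    and lg: "linear_map (Cp i) (Cp p) (\<lambda>u. hpart G (g2 u) p)" for i p
    by (rule linear_map_compose[OF hpart_linear[OF C_graded]],
        rule linear_map_sub[OF f2] linear_map_sub[OF g2], use Cp_le in auto)+
  have Lf: "linear_map (Tp i) (Tp p) (\<lambda>u. hpart H (f u) p)"
    and Lg: "linear_map (Tp i) (Tp p) (\<lambda>u. hpart H (g u) p)" for i p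
    by (rule linear_map_compose[OF hpart_linear[OF T_graded]],
        rule linear_map_sub[OF f] linear_map_sub[OF g], use H_le in auto)+
  have K_bilinear: "bilinear_map (Cp p) (Cp q) scalars (\<lambda>c1 c2. K p q c1 c2 \<beta>)" for p q \<beta>
    unfolding K_def lift_def
  proof (rule bilinear_mapI)
    fix c1 assume c1: "c1 \<in> carr (Cp p)"
    show "linear_map (Cp q) scalars (\<lambda>c2. t (\<lambda>a1 a2. pair p q (f1 a1) c1 (g1 a2) c2 \<beta>))"
    proof (rule tensor_param_linear[OF t Cp_space])
      show "bilinear_map A A scalars (\<lambda>a1 a2. pair p q (f1 a1) c1 (g1 a2) c2 \<beta>)"
        if "c2 \<in> carr (Cp q)" for c2
        by (rule pair_bilinear_A[OF f1 g1]) (use c1 that in auto)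
      show "linear_map (Cp q) scalars (\<lambda>c2. pair p q (f1 a1) c1 (g1 a2) c2 \<beta>)"
        if a: "a1 \<in> carr A" "a2 \<in> carr A" for a1 a2
        by (rule bilinear_mapD2[OF pair_bilinear_C[OF linear_map_id linear_map_id
              linear_map_in[OF f1 a(1)] linear_map_in[OF g1 a(2)]] c1])
    qed
  next
    fix c2 assume c2: "c2 \<in> carr (Cp q)"
    show "linear_map (Cp p) scalars (\<lambda>c1. t (\<lambda>a1 a2. pair p q (f1 a1) c1 (g1 a2) c2 \<beta>))"
    proof (rule tensor_param_linear[OF t Cp_space])
      show "bilinear_map A A scalars (\<lambda>a1 a2. pair p q (f1 a1) c1 (g1 a2) c2 \<beta>)"
        if "c1 \<in> carr (Cp p)" for c1
        by (rule pair_bilinear_A[OF f1 g1]) (use c2 that in auto)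
      show "linear_map (Cp p) scalars (\<lambda>c1. pair p q (f1 a1) c1 (g1 a2) c2 \<beta>)"
        if a: "a1 \<in> carr A" "a2 \<in> carr A" for a1 a2
        by (rule bilinear_mapD1[OF pair_bilinear_C[OF linear_map_id linear_map_id
              linear_map_in[OF f1 a(1)] linear_map_in[OF g1 a(2)]] c2])
    qed
  qed
  \<comment> \<open>Since the map does not depend on z, finite support and the value of the sum for
    A \<otimes> C follow from those for C.\<close>
  have terms: "cmap_term T H f g (bul t X) p q z = lift (K p q) (cmap_term C G f2 g2 X p q z)" for p q z
  proof
    fix \<beta>
    obtain i j where z: "z = (i, j)" by (cases z)
    have B: "bilinear_map (Tp i) (Tp j) scalars
        (\<lambda>u v. tens (Tp p) (Tp q) (hpart H (f u) p) (hpart H (g v) q) \<beta>)"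
      by (intro bilinear_mapI tens_linear_left[OF Lf] tens_linear_right[OF Lg]
          linear_map_in[OF Lf] linear_map_in[OF Lg])
    have "cmap_term T H f g (bul t X) p q z \<beta> =
        t (\<lambda>a1 a2. X i j (\<lambda>c1 c2. tens (Tp p) (Tp q)
          (hpart H (f (tens A C a1 c1)) p) (hpart H (g (tens A C a2 c2)) q) \<beta>))"
      by (simp add: z cmap_term_def tensor_map_def lift_def bullet_form[OF B])
    also have "\<dots> = t (\<lambda>a1 a2. X i j (\<lambda>c1 c2.
        pair p q (f1 a1) (hpart G (f2 c1) p) (g1 a2) (hpart G (g2 c2) q) \<beta>))"
    proof (rule tensor_cong[OF t A_space A_space], rule tensor_cong[OF X Cp_space Cp_space])
      fix a1 a2 c1 c2
      assume a: "a1 \<in> carr A" "a2 \<in> carr A" and c: "c1 \<in> carr (Cp i)" "c2 \<in> carr (Cp j)"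
      then have c: "c1 \<in> carr C" "c2 \<in> carr C" using Cp_le by auto
      show "tens (Tp p) (Tp q) (hpart H (f (tens A C a1 c1)) p) (hpart H (g (tens A C a2 c2)) q) \<beta> =
          pair p q (f1 a1) (hpart G (f2 c1) p) (g1 a2) (hpart G (g2 c2) q) \<beta>"
        by (simp add: f_tens g_tens a c hpart_tens linear_map_in[OF f1] linear_map_in[OF g1]
            linear_map_in[OF f2] linear_map_in[OF g2])
    qed
    \<comment> \<open>The interchange brings the C-contraction outside, which is the shape of
      \<open>K p q\<close> applied to a term for C.\<close>
    also have "\<dots> = X i j (\<lambda>c1 c2. t (\<lambda>a1 a2.
        pair p q (f1 a1) (hpart G (f2 c1) p) (g1 a2) (hpart G (g2 c2) q) \<beta>))"
    proof (rule tensor_swap[OF t X A_space A_space Cp_space Cp_space])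
      show "bilinear_map (Cp i) (Cp j) scalars
          (\<lambda>c1 c2. pair p q (f1 a1) (hpart G (f2 c1) p) (g1 a2) (hpart G (g2 c2) q) \<beta>)"
        if "a1 \<in> carr A" "a2 \<in> carr A" for a1 a2
        by (rule pair_bilinear_C[OF lf lg]) (use that linear_map_in[OF f1] linear_map_in[OF g1] in auto)
      show "bilinear_map A A scalars
          (\<lambda>a1 a2. pair p q (f1 a1) (hpart G (f2 c1) p) (g1 a2) (hpart G (g2 c2) q) \<beta>)"
        if "c1 \<in> carr (Cp i)" "c2 \<in> carr (Cp j)" for c1 c2
        by (rule pair_bilinear_A[OF f1 g1]) (use linear_map_in[OF lf that(1)] linear_map_in[OF lg that(2)] in auto)
    qed
    also have "\<dots> = lift (K p q) (cmap_term C G f2 g2 X p q z) \<beta>"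
      using tens_form[OF K_bilinear] by (simp add: z cmap_term_def tensor_map_def lift_def K_def)
    finally show "cmap_term T H f g (bul t X) p q z \<beta> = lift (K p q) (cmap_term C G f2 g2 X p q z) \<beta>" .
  qed
  \<comment> \<open>The same map applied to the total \<open>Y\<close> gives the claimed bullet
    product, again by interchanging contractions.\<close>
  have target: "lift (K p q) (Y p q) = bul (tensor_map A A f1 g1 t) Y p q" for p q
  proof
    fix \<beta>
    have "bul (tensor_map A A f1 g1 t) Y p q \<beta> =
        t (\<lambda>a1 a2. Y p q (\<lambda>c1 c2. pair p q (f1 a1) c1 (g1 a2) c2 \<beta>))"
      using tens_form[OF pair_outer_bilinear[OF Y linear_map_id linear_map_id linear_map_id linear_map_id]]
      by (simp add: bullet_eval tensor_map_def lift_def)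
    also have "\<dots> = Y p q (\<lambda>c1 c2. t (\<lambda>a1 a2. pair p q (f1 a1) c1 (g1 a2) c2 \<beta>))"
    proof (rule tensor_swap[OF t Y A_space A_space Cp_space Cp_space])
      show "bilinear_map (Cp p) (Cp q) scalars (\<lambda>c1 c2. pair p q (f1 a1) c1 (g1 a2) c2 \<beta>)"
        if "a1 \<in> carr A" "a2 \<in> carr A" for a1 a2
        by (rule pair_bilinear_C[OF linear_map_id linear_map_id])
          (use that linear_map_in[OF f1] linear_map_in[OF g1] in auto)
      show "bilinear_map A A scalars (\<lambda>a1 a2. pair p q (f1 a1) c1 (g1 a2) c2 \<beta>)"
        if "c1 \<in> carr (Cp p)" "c2 \<in> carr (Cp q)" for c1 c2
        by (rule pair_bilinear_A[OF f1 g1]) (use that in auto)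
    qed
    finally show "lift (K p q) (Y p q) \<beta> = bul (tensor_map A A f1 g1 t) Y p q \<beta>"
      by (simp add: lift_def K_def)
  qed
  have "finite {z. cmap_term T H f g (bul t X) p q z \<noteq> 0} \<and>
      cmap T H f g (bul t X) p q = bul (tensor_map A A f1 g1 t) Y p q" for p q
  proof -
    have fin: "finite {z. cmap_term C G f2 g2 X p q z \<noteq> 0}" using XY by (simp add: cmap_sums_def)
    note hom = Sum_any_hom[OF fin, of "lift (K p q)", OF lift_zero lift_sum]
    have "Sum_any (cmap_term C G f2 g2 X p q) = Y p q"
      using XY by (simp add: cmap_sums_def cmap_eq_Sum_any[symmetric])
    then show ?thesis
      using hom by (simp add: cmap_eq_Sum_any terms target)
  qed
  then show ?thesis
    by (auto simp: cmap_sums_def intro!: ext[of "cmap T H f g (bul t X)"] ext[of "cmap T H f g (bul t X) _"])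
qed

text \<open>The flip exchanges the A-legs and the C-legs simultaneously; cocommutativity of
  \<open>D\<close> absorbs the exchange of the C-legs.\<close>

lemma cflip_bullet:
  assumes t: "t \<in> carr (tensor_space A A)" and c: "c \<in> carr C"
  shows "cflip T H (bul t (D c)) = bul (tensor_flip A A t) (D c)"
proof -
  have "cflip T H (bul t (D c)) i j \<beta> = bul (tensor_flip A A t) (D c) i j \<beta>" for i j \<beta>
  proof -
    have B: "bilinear_map (Tp j) (Tp i) scalars (\<lambda>v u. tens (Tp i) (Tp j) u v \<beta>)"
      by (intro bilinear_mapI tens_linear_left tens_linear_right linear_map_id)
    have "cflip T H (bul t (D c)) i j \<beta> =
        t (\<lambda>a1 a2. D c j i (\<lambda>c1 c2. pair i j a2 c2 a1 c1 \<beta>))"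
      by (simp add: cflip_def tensor_flip_def lift_def bullet_form[OF B])
    also have "\<dots> = t (\<lambda>a1 a2. D c i j (\<lambda>c1 c2. pair i j a2 c1 a1 c2 \<beta>))"
    proof (rule tensor_cong[OF t A_space A_space])
      fix a1 a2 assume a: "a1 \<in> carr A" "a2 \<in> carr A"
      have "D c i j (\<lambda>c1 c2. pair i j a2 c1 a1 c2 \<beta>) =
          cflip C G (D c) i j (\<lambda>c1 c2. pair i j a2 c1 a1 c2 \<beta>)" by (simp add: D_flip[OF c])
      then show "D c j i (\<lambda>c1 c2. pair i j a2 c2 a1 c1 \<beta>) = D c i j (\<lambda>c1 c2. pair i j a2 c1 a1 c2 \<beta>)"
        using tens_form[OF pair_bilinear_C[OF linear_map_id linear_map_id a(2,1)]]
        by (simp add: cflip_def tensor_flip_def lift_def)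
    qed
    also have "\<dots> = bul (tensor_flip A A t) (D c) i j \<beta>"
      using tens_form[OF pair_outer_bilinear[OF D_in[OF c] linear_map_id linear_map_id linear_map_id linear_map_id]]
      by (simp add: bullet_eval tensor_flip_def lift_def)
    finally show ?thesis .
  qed
  then show ?thesis by (simp add: fun_eq_iff)
qed

end

section \<open>The coalgebra axiom\<close>

context tensor_coalgebra
begin

text \<open>The threefold analogue of \<open>bullet\<close>, at one multidegree: its C-argument is a
  single component, so that it can be applied to each summand of the iterated coproduct.\<close>

definition bul3 where
  "bul3 p q r t S = lift3 (\<lambda>a1 a2 a3. lift3 (\<lambda>c1 c2 c3. triple p q r a1 c1 a2 c2 a3 c3) S) t"

lemma bul3_eval: "bul3 p q r t S \<gamma> = t (\<lambda>a1 a2 a3. S (triple_C p q r a1 a2 a3 \<gamma>))"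
  by (simp add: bul3_def lift3_def)

lemma triple_outer_trilinear:
  assumes S: "S \<in> carr (CCC p q r)"
  shows "trilinear_map A A A scalars (\<lambda>a1 a2 a3. S (triple_C p q r a1 a2 a3 \<gamma>))"
proof (rule trilinear_mapI)
  fix a1 a2 assume a: "a1 \<in> carr A" "a2 \<in> carr A"
  show "linear_map A scalars (\<lambda>a3. S (triple_C p q r a1 a2 a3 \<gamma>))"
    by (rule tensor3_param_linear[OF S A_space triple_trilinear_C[OF a]], assumption)
      (rule trilinear_mapD3[OF triple_trilinear_A a], simp_all)
next
  fix a1 a3 assume a: "a1 \<in> carr A" "a3 \<in> carr A"
  show "linear_map A scalars (\<lambda>a2. S (triple_C p q r a1 a2 a3 \<gamma>))"
    by (rule tensor3_param_linear[OF S A_space triple_trilinear_C[OF a(1) _ a(2)]], assumption)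
      (rule trilinear_mapD2[OF triple_trilinear_A a], simp_all)
next
  fix a2 a3 assume a: "a2 \<in> carr A" "a3 \<in> carr A"
  show "linear_map A scalars (\<lambda>a1. S (triple_C p q r a1 a2 a3 \<gamma>))"
    by (rule tensor3_param_linear[OF S A_space triple_trilinear_C[OF _ a]], assumption)
      (rule trilinear_mapD1[OF triple_trilinear_A a], simp_all)
qed

lemma bul3_zero:
  assumes "t \<in> carr (tensor3_space A A A)"
  shows "bul3 p q r t 0 = 0"
proof (rule ext)
  fix \<gamma>
  show "bul3 p q r t 0 \<gamma> = 0 \<gamma>"
    using tensor3_zero_form[OF assms] by (simp add: bul3_eval zero_fun_apply)
qed

lemma bul3_zero_left: "bul3 p q r 0 S = 0"
  by (simp add: bul3_def lift3_zero)

text \<open>Additivity in the C-argument is additivity of \<open>t\<close> in its form, which needs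
  every form involved to be trilinear.\<close>

lemma bul3_sum:
  assumes t: "t \<in> carr (tensor3_space A A A)"
    and S: "\<And>k. S k \<in> carr (CCC p q r)"
  shows "bul3 p q r t (sum S K) = (\<Sum>k\<in>K. bul3 p q r t (S k))"
proof (rule ext)
  fix \<gamma>
  show "bul3 p q r t (sum S K) \<gamma> = (\<Sum>k\<in>K. bul3 p q r t (S k)) \<gamma>"
    using tensor3_form_lincomb[OF t triple_outer_trilinear[OF S], where K = K and b = "\<lambda>_. 1"]
    by (simp add: bul3_eval sum_fun_apply)
qed

text \<open>Applying the coproduct to a first leg b \<otimes> e splits it into \<Delta>(b) and D(e).
  Moving the contraction with \<Delta>(b) outside the one with D(c) gathers the A-operations on one
  side and the C-operations on the other.\<close>

lemma ccop_left_term_bullet: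
  assumes t: "t \<in> carr (tensor_space A A)" and c: "c \<in> carr C"
  shows "ccop_left_term T H hat (bul t (D c)) p q r i =
    bul3 p q r (cop_left A A A \<Delta> t) (ccop_left_term C G D (D c) p q r i)"
proof
  fix \<gamma>
  have B3: "trilinear_map (Tp p) (Tp q) (Tp r) scalars (\<lambda>u v w. tens3_T p q r u v w \<gamma>)"
    by (intro trilinear_mapI tens3_linear linear_map_id)
  have B: "bilinear_map (Tp i) (Tp r) scalars
      (\<lambda>x w. hat x p q (\<lambda>u v. tens3_T p q r u v w \<gamma>))"
  proof (rule bilinear_mapI)
    fix x assume "x \<in> carr (Tp i)"
    then have x: "x \<in> carr T" using H_le by auto
    show "linear_map (Tp r) scalars (\<lambda>w. hat x p q (\<lambda>u v. tens3_T p q r u v w \<gamma>))"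
      by (rule tensor_param_linear[OF hat_in[OF x] Tp_space])
        (rule trilinear_mapD12[OF B3] trilinear_mapD3[OF B3], assumption+)+
  next
    fix w
    show "linear_map (Tp i) scalars (\<lambda>x. hat x p q (\<lambda>u v. tens3_T p q r u v w \<gamma>))"
      by (rule linear_map_sub[OF linear_map_eval[OF hat_linear_component scl_tensor_space]])
        (use H_le in auto)
  qed
  have inner: "D c i r (\<lambda>e c3. hat (tens A C b e) p q (\<lambda>u v. tens3_T p q r u v (tens A C a3 c3) \<gamma>)) =
      \<Delta> b (\<lambda>a1 a2. ccop_left_term C G D (D c) p q r i (triple_C p q r a1 a2 a3 \<gamma>))"
    if b: "b \<in> carr A" and a3: "a3 \<in> carr A" for b a3
  proof -
    have "D c i r (\<lambda>e c3. hat (tens A C b e) p q (\<lambda>u v. tens3_T p q r u v (tens A C a3 c3) \<gamma>)) =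
        D c i r (\<lambda>e c3. \<Delta> b (\<lambda>a1 a2. D e p q (\<lambda>c1 c2. triple p q r a1 c1 a2 c2 a3 c3 \<gamma>)))"
    proof (rule tensor_cong[OF D_in[OF c] Cp_space Cp_space])
      fix e c3 assume e: "e \<in> carr (Cp i)" and c3: "c3 \<in> carr (Cp r)"
      have "bilinear_map (Tp p) (Tp q) scalars (\<lambda>u v. tens3_T p q r u v (tens A C a3 c3) \<gamma>)"
        by (rule trilinear_mapD12[OF B3]) (use tens_in_H[OF a3] c3 in simp)
      then show "hat (tens A C b e) p q (\<lambda>u v. tens3_T p q r u v (tens A C a3 c3) \<gamma>) =
          \<Delta> b (\<lambda>a1 a2. D e p q (\<lambda>c1 c2. triple p q r a1 c1 a2 c2 a3 c3 \<gamma>))"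
        using e Cp_le by (simp add: hat_tens[OF b] bullet_form)
    qed
    \<comment> \<open>The variable e is contracted by \<open>D c\<close> and is the argument of the
      inner \<open>D\<close>; after the interchange these two form a term of the iterated coproduct
      of C.\<close>
    also have "\<dots> = \<Delta> b (\<lambda>a1 a2. D c i r (\<lambda>e c3. D e p q (\<lambda>c1 c2. triple p q r a1 c1 a2 c2 a3 c3 \<gamma>)))"
    proof (rule tensor_swap[OF D_in[OF c] \<Delta>_in[OF b] Cp_space Cp_space A_space A_space])
      fix e c3 assume "e \<in> carr (Cp i)" and c3: "c3 \<in> carr (Cp r)"
      then have e: "e \<in> carr C" using Cp_le by auto
      show "bilinear_map A A scalars (\<lambda>a1 a2. D e p q (\<lambda>c1 c2. triple p q r a1 c1 a2 c2 a3 c3 \<gamma>))"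
      proof (rule bilinear_mapI)
        fix a1 assume a1: "a1 \<in> carr A"
        show "linear_map A scalars (\<lambda>a2. D e p q (\<lambda>c1 c2. triple p q r a1 c1 a2 c2 a3 c3 \<gamma>))"
          by (rule tensor_param_linear[OF D_in[OF e] A_space
                trilinear_mapD12[OF triple_trilinear_C[OF a1 _ a3] c3]], assumption)
            (rule trilinear_mapD2[OF triple_trilinear_A a1 a3], use c3 in simp_all)
      next
        fix a2 assume a2: "a2 \<in> carr A"
        show "linear_map A scalars (\<lambda>a1. D e p q (\<lambda>c1 c2. triple p q r a1 c1 a2 c2 a3 c3 \<gamma>))"
          by (rule tensor_param_linear[OF D_in[OF e] A_space
                trilinear_mapD12[OF triple_trilinear_C[OF _ a2 a3] c3]], assumption)
            (rule trilinear_mapD1[OF triple_trilinear_A a2 a3], use c3 in simp_all)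
      qed
    next
      fix a1 a2 assume a: "a1 \<in> carr A" "a2 \<in> carr A"
      show "bilinear_map (Cp i) (Cp r) scalars (\<lambda>e c3. D e p q (\<lambda>c1 c2. triple p q r a1 c1 a2 c2 a3 c3 \<gamma>))"
      proof (rule bilinear_mapI)
        fix e assume "e \<in> carr (Cp i)"
        then have e: "e \<in> carr C" using Cp_le by auto
        show "linear_map (Cp r) scalars (\<lambda>c3. D e p q (\<lambda>c1 c2. triple p q r a1 c1 a2 c2 a3 c3 \<gamma>))"
          by (rule tensor_param_linear[OF D_in[OF e] Cp_space])
            (rule trilinear_mapD12[OF triple_trilinear_C[OF a a3]]
              trilinear_mapD3[OF triple_trilinear_C[OF a a3]], assumption+)+
      qed (rule linear_map_eval[OF D_linear_Cp scl_tensor_space])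
    qed
    also have "\<dots> = \<Delta> b (\<lambda>a1 a2. ccop_left_term C G D (D c) p q r i (triple_C p q r a1 a2 a3 \<gamma>))"
      by (rule tensor_cong[OF \<Delta>_in[OF b] A_space A_space])
        (simp add: ccop_left_term_def cop_left_def lift_def tens3_form[OF triple_trilinear_C] a3)
    finally show ?thesis .
  qed
  have "ccop_left_term T H hat (bul t (D c)) p q r i \<gamma> =
      t (\<lambda>b a3. D c i r (\<lambda>e c3. hat (tens A C b e) p q (\<lambda>u v. tens3_T p q r u v (tens A C a3 c3) \<gamma>)))"
    by (simp add: ccop_left_term_def cop_left_def lift_def bullet_form[OF B])
  also have "\<dots> = t (\<lambda>b a3. \<Delta> b (\<lambda>a1 a2. ccop_left_term C G D (D c) p q r i
      (triple_C p q r a1 a2 a3 \<gamma>)))"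
    by (rule tensor_cong[OF t A_space A_space inner])
  also have "\<dots> = bul3 p q r (cop_left A A A \<Delta> t) (ccop_left_term C G D (D c) p q r i) \<gamma>"
    using tens3_form[OF triple_outer_trilinear[OF ccop_left_term_in[OF c]]]
    by (simp add: bul3_eval cop_left_def lift_def)
  finally show "ccop_left_term T H hat (bul t (D c)) p q r i \<gamma> =
    bul3 p q r (cop_left A A A \<Delta> t) (ccop_left_term C G D (D c) p q r i) \<gamma>" .
qed

lemma ccop_right_term_bullet:
  assumes t: "t \<in> carr (tensor_space A A)" and c: "c \<in> carr C"
  shows "ccop_right_term T H hat (bul t (D c)) p q r i =
    bul3 p q r (cop_right A A A \<Delta> t) (ccop_right_term C G D (D c) p q r i)"
proof
  fix \<gamma>
  have B3: "trilinear_map (Tp p) (Tp q) (Tp r) scalars (\<lambda>u v w. tens3_T p q r u v w \<gamma>)"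
    by (intro trilinear_mapI tens3_linear linear_map_id)
  have B: "bilinear_map (Tp p) (Tp i) scalars
      (\<lambda>u x. hat x q r (\<lambda>v w. tens3_T p q r u v w \<gamma>))"
  proof (rule bilinear_mapI)
    fix x assume "x \<in> carr (Tp i)"
    then have x: "x \<in> carr T" using H_le by auto
    show "linear_map (Tp p) scalars (\<lambda>u. hat x q r (\<lambda>v w. tens3_T p q r u v w \<gamma>))"
      by (rule tensor_param_linear[OF hat_in[OF x] Tp_space])
        (rule trilinear_mapD23[OF B3] trilinear_mapD1[OF B3], assumption+)+
  next
    fix u
    show "linear_map (Tp i) scalars (\<lambda>x. hat x q r (\<lambda>v w. tens3_T p q r u v w \<gamma>))"
      by (rule linear_map_sub[OF linear_map_eval[OF hat_linear_component scl_tensor_space]])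
        (use H_le in auto)
  qed
  have inner: "D c p i (\<lambda>c1 e. hat (tens A C b e) q r (\<lambda>v w. tens3_T p q r (tens A C a1 c1) v w \<gamma>)) =
      \<Delta> b (\<lambda>a2 a3. ccop_right_term C G D (D c) p q r i (triple_C p q r a1 a2 a3 \<gamma>))"
    if a1: "a1 \<in> carr A" and b: "b \<in> carr A" for a1 b
  proof -
    have "D c p i (\<lambda>c1 e. hat (tens A C b e) q r (\<lambda>v w. tens3_T p q r (tens A C a1 c1) v w \<gamma>)) =
        D c p i (\<lambda>c1 e. \<Delta> b (\<lambda>a2 a3. D e q r (\<lambda>c2 c3. triple p q r a1 c1 a2 c2 a3 c3 \<gamma>)))"
    proof (rule tensor_cong[OF D_in[OF c] Cp_space Cp_space])
      fix c1 e assume e: "e \<in> carr (Cp i)" and c1: "c1 \<in> carr (Cp p)"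
      have "bilinear_map (Tp q) (Tp r) scalars (\<lambda>v w. tens3_T p q r (tens A C a1 c1) v w \<gamma>)"
        by (rule trilinear_mapD23[OF B3]) (use tens_in_H[OF a1] c1 in simp)
      then show "hat (tens A C b e) q r (\<lambda>v w. tens3_T p q r (tens A C a1 c1) v w \<gamma>) =
          \<Delta> b (\<lambda>a2 a3. D e q r (\<lambda>c2 c3. triple p q r a1 c1 a2 c2 a3 c3 \<gamma>))"
        using e Cp_le by (simp add: hat_tens[OF b] bullet_form)
    qed
    also have "\<dots> = \<Delta> b (\<lambda>a2 a3. D c p i (\<lambda>c1 e. D e q r (\<lambda>c2 c3. triple p q r a1 c1 a2 c2 a3 c3 \<gamma>)))"
    proof (rule tensor_swap[OF D_in[OF c] \<Delta>_in[OF b] Cp_space Cp_space A_space A_space])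
      fix c1 e assume "e \<in> carr (Cp i)" and c1: "c1 \<in> carr (Cp p)"
      then have e: "e \<in> carr C" using Cp_le by auto
      show "bilinear_map A A scalars (\<lambda>a2 a3. D e q r (\<lambda>c2 c3. triple p q r a1 c1 a2 c2 a3 c3 \<gamma>))"
      proof (rule bilinear_mapI)
        fix a2 assume a2: "a2 \<in> carr A"
        show "linear_map A scalars (\<lambda>a3. D e q r (\<lambda>c2 c3. triple p q r a1 c1 a2 c2 a3 c3 \<gamma>))"
          by (rule tensor_param_linear[OF D_in[OF e] A_space
                trilinear_mapD23[OF triple_trilinear_C[OF a1 a2] c1]], assumption)
            (rule trilinear_mapD3[OF triple_trilinear_A a1 a2], use c1 in simp_all)
      next
        fix a3 assume a3: "a3 \<in> carr A"
        show "linear_map A scalars (\<lambda>a2. D e q r (\<lambda>c2 c3. triple p q r a1 c1 a2 c2 a3 c3 \<gamma>))"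
          by (rule tensor_param_linear[OF D_in[OF e] A_space
                trilinear_mapD23[OF triple_trilinear_C[OF a1 _ a3] c1]], assumption)
            (rule trilinear_mapD2[OF triple_trilinear_A a1 a3], use c1 in simp_all)
      qed
    next
      fix a2 a3 assume a: "a2 \<in> carr A" "a3 \<in> carr A"
      show "bilinear_map (Cp p) (Cp i) scalars (\<lambda>c1 e. D e q r (\<lambda>c2 c3. triple p q r a1 c1 a2 c2 a3 c3 \<gamma>))"
      proof (rule bilinear_mapI)
        fix e assume "e \<in> carr (Cp i)"
        then have e: "e \<in> carr C" using Cp_le by auto
        show "linear_map (Cp p) scalars (\<lambda>c1. D e q r (\<lambda>c2 c3. triple p q r a1 c1 a2 c2 a3 c3 \<gamma>))"
          by (rule tensor_param_linear[OF D_in[OF e] Cp_space])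
            (rule trilinear_mapD23[OF triple_trilinear_C[OF a1 a]]
              trilinear_mapD1[OF triple_trilinear_C[OF a1 a]], assumption+)+
      qed (rule linear_map_eval[OF D_linear_Cp scl_tensor_space])
    qed
    also have "\<dots> = \<Delta> b (\<lambda>a2 a3. ccop_right_term C G D (D c) p q r i (triple_C p q r a1 a2 a3 \<gamma>))"
      by (rule tensor_cong[OF \<Delta>_in[OF b] A_space A_space])
        (simp add: ccop_right_term_def cop_right_def lift_def tens3_form[OF triple_trilinear_C] a1)
    finally show ?thesis .
  qed
  have "ccop_right_term T H hat (bul t (D c)) p q r i \<gamma> =
      t (\<lambda>a1 b. D c p i (\<lambda>c1 e. hat (tens A C b e) q r (\<lambda>v w. tens3_T p q r (tens A C a1 c1) v w \<gamma>)))"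
    by (simp add: ccop_right_term_def cop_right_def lift_def bullet_form[OF B])
  also have "\<dots> = t (\<lambda>a1 b. \<Delta> b (\<lambda>a2 a3. ccop_right_term C G D (D c) p q r i
      (triple_C p q r a1 a2 a3 \<gamma>)))"
    by (rule tensor_cong[OF t A_space A_space inner])
  also have "\<dots> = bul3 p q r (cop_right A A A \<Delta> t) (ccop_right_term C G D (D c) p q r i) \<gamma>"
    using tens3_form[OF triple_outer_trilinear[OF ccop_right_term_in[OF c]]]
    by (simp add: bul3_eval cop_right_def lift_def)
  finally show "ccop_right_term T H hat (bul t (D c)) p q r i \<gamma> =
    bul3 p q r (cop_right A A A \<Delta> t) (ccop_right_term C G D (D c) p q r i) \<gamma>" .
qed

text \<open>Exchanging legs of A \<otimes> C exchanges those of A and of C together. Both flips are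
  kept here; the one on C is absorbed afterwards by cocommutativity.\<close>

lemma flip_left_bul3:
  assumes t: "t \<in> carr (tensor3_space A A A)" and S: "S \<in> carr (CCC q p r)"
  shows "flip_left (Tp p) (Tp q) (Tp r) (bul3 q p r t S) =
    bul3 p q r (flip_left A A A t) (flip_left (Cp p) (Cp q) (Cp r) S)"
proof
  fix \<gamma>
  have B: "trilinear_map (Tp q) (Tp p) (Tp r) scalars (\<lambda>v u w. tens3_T p q r u v w \<gamma>)"
    by (intro trilinear_mapI tens3_linear linear_map_id)
  have "flip_left (Tp p) (Tp q) (Tp r) (bul3 q p r t S) \<gamma> =
      t (\<lambda>a1 a2 a3. S (\<lambda>c1 c2 c3. triple p q r a2 c2 a1 c1 a3 c3 \<gamma>))"
    by (simp add: flip_left_def lift3_def bul3_eval tens3_form[OF B])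
  also have "\<dots> = t (\<lambda>a1 a2 a3. flip_left (Cp p) (Cp q) (Cp r) S
      (\<lambda>c1 c2 c3. triple p q r a2 c1 a1 c2 a3 c3 \<gamma>))"
    by (rule tensor3_cong[OF t A_space A_space A_space])
      (simp add: flip_left_def lift3_def tens3_form[OF triple_trilinear_C])
  also have "\<dots> = bul3 p q r (flip_left A A A t) (flip_left (Cp p) (Cp q) (Cp r) S) \<gamma>"
    using tens3_form[OF triple_outer_trilinear[OF flip_left_in[OF S]]]
    by (simp add: bul3_eval flip_left_def[of A A A] lift3_def[of _ t])
  finally show "flip_left (Tp p) (Tp q) (Tp r) (bul3 q p r t S) \<gamma> =
    bul3 p q r (flip_left A A A t) (flip_left (Cp p) (Cp q) (Cp r) S) \<gamma>" .
qed

text \<open>Coassociativity replaces the right iterated coproduct of C by the left one, and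
  invariance under the flip absorbs the third term's exchange, so all three values have the same
  C-argument.\<close>

lemma ccop_hat_tens:
  assumes a: "a \<in> carr A" and c: "c \<in> carr C"
  shows "ccop_left_defined T H hat (hat (tens A C a c))"
    and "ccop_right_defined T H hat (hat (tens A C a c))"
    and "ccop_left T H hat (hat (tens A C a c)) p q r =
      bul3 p q r (cop_left A A A \<Delta> (\<Delta> a)) (ccop_left C G D (D c) p q r)"
    and "ccop_right T H hat (hat (tens A C a c)) p q r =
      bul3 p q r (cop_right A A A \<Delta> (\<Delta> a)) (ccop_left C G D (D c) p q r)"
    and "cflip_left T H (ccop_right T H hat (hat (tens A C a c))) p q r =
      bul3 p q r (flip_left A A A (cop_right A A A \<Delta> (\<Delta> a))) (ccop_left C G D (D c) p q r)"
proof -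
  note l = cop_left_in[OF \<Delta>_in[OF a] \<Delta>_linear A_space]
    and r = cop_right_in[OF \<Delta>_in[OF a] \<Delta>_linear A_space]
  have L: "finite {i. bul3 p q r (cop_left A A A \<Delta> (\<Delta> a)) (ccop_left_term C G D (D c) p q r i) \<noteq> 0}"
    "Sum_any (\<lambda>i. bul3 p q r (cop_left A A A \<Delta> (\<Delta> a)) (ccop_left_term C G D (D c) p q r i)) =
      bul3 p q r (cop_left A A A \<Delta> (\<Delta> a)) (Sum_any (ccop_left_term C G D (D c) p q r))" for p q r
    by (rule Sum_any_hom[where f = "bul3 p q r (cop_left A A A \<Delta> (\<Delta> a))",
          OF ccop_left_term_finite[OF c] bul3_zero[OF l]],
        rule bul3_sum[OF l ccop_left_term_in[OF c]])+
  have R: "finite {i. bul3 p q r (cop_right A A A \<Delta> (\<Delta> a)) (ccop_right_term C G D (D c) p q r i) \<noteq> 0}"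
    "Sum_any (\<lambda>i. bul3 p q r (cop_right A A A \<Delta> (\<Delta> a)) (ccop_right_term C G D (D c) p q r i)) =
      bul3 p q r (cop_right A A A \<Delta> (\<Delta> a)) (Sum_any (ccop_right_term C G D (D c) p q r))" for p q r
    by (rule Sum_any_hom[where f = "bul3 p q r (cop_right A A A \<Delta> (\<Delta> a))",
          OF ccop_right_term_finite[OF c] bul3_zero[OF r]],
        rule bul3_sum[OF r ccop_right_term_in[OF c]])+
  show "ccop_left_defined T H hat (hat (tens A C a c))"
    using L(1) by (simp add: ccop_left_defined_def hat_tens[OF a c] ccop_left_term_bullet[OF \<Delta>_in[OF a] c])
  show "ccop_right_defined T H hat (hat (tens A C a c))"
    using R(1) by (simp add: ccop_right_defined_def hat_tens[OF a c] ccop_right_term_bullet[OF \<Delta>_in[OF a] c])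
  show "ccop_left T H hat (hat (tens A C a c)) p q r =
      bul3 p q r (cop_left A A A \<Delta> (\<Delta> a)) (ccop_left C G D (D c) p q r)"
    using L(2) by (simp add: ccop_left_def hat_tens[OF a c] ccop_left_term_bullet[OF \<Delta>_in[OF a] c])
  have rr: "ccop_right T H hat (hat (tens A C a c)) p q r =
      bul3 p q r (cop_right A A A \<Delta> (\<Delta> a)) (ccop_left C G D (D c) p q r)" for p q r
    using R(2) unfolding D_coassociative[OF c, symmetric]
    by (simp add: ccop_right_def hat_tens[OF a c] ccop_right_term_bullet[OF \<Delta>_in[OF a] c])
  then show "ccop_right T H hat (hat (tens A C a c)) p q r =
      bul3 p q r (cop_right A A A \<Delta> (\<Delta> a)) (ccop_left C G D (D c) p q r)" .
  have "flip_left (Cp p) (Cp q) (Cp r) (ccop_left C G D (D c) q p r) = ccop_left C G D (D c) p q r"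
    using fun_cong[OF fun_cong[OF fun_cong[OF ccop_left_flip[OF c]]], of p q r] by (simp add: cflip_left_def)
  then show "cflip_left T H (ccop_right T H hat (hat (tens A C a c))) p q r =
      bul3 p q r (flip_left A A A (cop_right A A A \<Delta> (\<Delta> a))) (ccop_left C G D (D c) p q r)"
    by (simp add: cflip_left_def rr flip_left_bul3[OF r ccop_left_in[OF c]])
qed

text \<open>Like \<open>defect1\<close> and \<open>defect2\<close> below, the left-hand side of an
  axiom kept as an element: the direct statement inserts its vanishing, the converse deduces it from
  an injectivity argument.\<close>

definition co_defect where
  "co_defect a = cop_left A A A \<Delta> (\<Delta> a) + cop_right A A A \<Delta> (\<Delta> a) +
     flip_left A A A (cop_right A A A \<Delta> (\<Delta> a))"

lemma ccop_hat_defect: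
  assumes a: "a \<in> carr A" and c: "c \<in> carr C"
  shows "ccop_left T H hat (hat (tens A C a c)) + ccop_right T H hat (hat (tens A C a c)) +
     cflip_left T H (ccop_right T H hat (hat (tens A C a c))) =
     (\<lambda>p q r. bul3 p q r (co_defect a) (ccop_left C G D (D c) p q r))"
  by (intro ext) (simp only: plus_fun_apply ccop_hat_tens[OF a c] bul3_eval co_defect_def)

lemma T_coalgebra:
  assumes "anti_leibniz_coalgebra A \<Delta>"
  shows "completed_anti_leibniz_coalgebra T H hat"
  unfolding completed_anti_leibniz_coalgebra_def
proof (intro conjI[OF T_graded] conjI[OF hat_linear] ballI)
  let ?E = "\<lambda>X. ccop_left T H hat X + ccop_right T H hat X + cflip_left T H (ccop_right T H hat X)"
  \<comment> \<open>Definedness belongs to the induction predicate because additivity of the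
    iterated coproducts, used in the sum case, depends on it.\<close>
  let ?P = "\<lambda>x. ccop_left_defined T H hat (hat x) \<and> ccop_right_defined T H hat (hat x) \<and> ?E (hat x) = 0"
  fix x assume x: "x \<in> carr T"
  show "?P x"
  proof (rule T_induct[where P = ?P, OF x])
    fix a c assume ac: "a \<in> carr A" "c \<in> carr C"
    have "co_defect a = 0" using assms ac by (simp add: co_defect_def anti_leibniz_coalgebra_def)
    then have "?E (hat (tens A C a c)) = 0"
      by (simp add: ccop_hat_defect[OF ac] bul3_zero_left) (simp add: zero_fun_def)
    then show "?P (tens A C a c)" using ccop_hat_tens(1,2)[OF ac] by blast
  next
    fix x y assume "?P x" "?P y"
    then show "?P (x + y)"
      using add3_eq_0[of "ccop_left T H hat (hat x)" "ccop_right T H hat (hat x)" _ "ccop_left T H hat (hat y)"]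
      by (simp add: hat_add ccop_left_add ccop_right_add cflip_left_add)
  qed
qed

section \<open>The compatibility conditions on pure tensors\<close>

definition defect1 where
  "defect1 a1 a2 = (let e = \<Delta> a1 - tensor_flip A A (\<Delta> a1) in
     \<Delta> (mA a1 a2) +
     (tensor_map A A id (rmult mA a2) e + tensor_map A A (lmult mA a2 - rmult mA a2) id e) +
     (tensor_map A A id (lmult mA a1) (\<Delta> a2) + tensor_map A A (lmult mA a1) id (\<Delta> a2)))"

definition defect2 where
  "defect2 a1 a2 = tensor_map A A (rmult mA a1) id (\<Delta> a2) -
     tensor_flip A A (tensor_map A A (rmult mA a2) id (\<Delta> a1))"

definition skew where
  "skew x = hat x - cflip T H (hat x)"

text \<open>The left-hand side of (B1) has value W and each of its four termwise sums is finitely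
  supported. The bare equation for \<open>cmap\<close> is not closed under addition in x1 or x2;
  this relation is, so induction on tensors applies to it.\<close>

definition compat1 where
  "compat1 x1 x2 W \<longleftrightarrow> (\<exists>Y1 Y2 Y3 Y4.
     cmap_sums T H id (rmult M x2) (skew x1) Y1 \<and>
     cmap_sums T H (lmult M x2 - rmult M x2) id (skew x1) Y2 \<and>
     cmap_sums T H id (lmult M x1) (hat x2) Y3 \<and>
     cmap_sums T H (lmult M x1) id (hat x2) Y4 \<and>
     hat (M x1 x2) + (Y1 + Y2) + (Y3 + Y4) = W)"

definition compat2 where
  "compat2 x1 x2 W \<longleftrightarrow> (\<exists>Y1 Y2.
     cmap_sums T H (rmult M x1) id (hat x2) Y1 \<and>
     cmap_sums T H (rmult M x2) id (hat x1) Y2 \<and>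
     Y1 - cflip T H Y2 = W)"

lemma compat1D:
  assumes "compat1 x1 x2 W"
  shows "(let e = hat x1 - cflip T H (hat x1) in
      hat (M x1 x2) +
      (cmap T H id (rmult M x2) e + cmap T H (lmult M x2 - rmult M x2) id e) +
      (cmap T H id (lmult M x1) (hat x2) + cmap T H (lmult M x1) id (hat x2))) = W"
  using assms by (auto simp: compat1_def skew_def Let_def dest!: cmap_sumsD)

lemma compat2D:
  assumes "compat2 x1 x2 W"
  shows "cmap T H (rmult M x1) id (hat x2) - cflip T H (cmap T H (rmult M x2) id (hat x1)) = W"
  using assms by (auto simp: compat2_def dest!: cmap_sumsD)

lemma rmult_A_linear: "a \<in> carr A \<Longrightarrow> linear_map A A (rmult mA a)"
  and lmult_A_linear: "a \<in> carr A \<Longrightarrow> linear_map A A (lmult mA a)"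
  and rmult_T_linear: "x \<in> carr T \<Longrightarrow> linear_map T T (rmult M x)"
  and lmult_T_linear: "x \<in> carr T \<Longrightarrow> linear_map T T (lmult M x)"
  unfolding rmult_def lmult_def
  using bilinear_mapD1[OF mA_bilinear] bilinear_mapD2[OF mA_bilinear]
    bilinear_mapD1[OF M_bilinear] bilinear_mapD2[OF M_bilinear] by auto

lemma commutator_A_linear: "a \<in> carr A \<Longrightarrow> linear_map A A (lmult mA a - rmult mA a)"
  and commutator_T_linear: "x \<in> carr T \<Longrightarrow> linear_map T T (lmult M x - rmult M x)"
  unfolding fun_diff_def[of "lmult mA a"] fun_diff_def[of "lmult M x"]
  by (intro linear_map_minus rmult_A_linear lmult_A_linear rmult_T_linear lmult_T_linear A_space T_space;
      assumption)+

text \<open>By commutativity of C, right multiplication by a \<otimes> c also acts on the C-factor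
  as multiplication by c. So the left, right and commutator actions share one map on C.\<close>

lemma rmult_tens:
  "a \<in> carr A \<Longrightarrow> c \<in> carr C \<Longrightarrow> b \<in> carr A \<Longrightarrow> e \<in> carr C \<Longrightarrow>
    rmult M (tens A C a c) (tens A C b e) = tens A C (rmult mA a b) (mC c e)"
  by (simp add: rmult_def M_tens mC_comm)

lemma lmult_tens:
  "a \<in> carr A \<Longrightarrow> c \<in> carr C \<Longrightarrow> b \<in> carr A \<Longrightarrow> e \<in> carr C \<Longrightarrow>
    lmult M (tens A C a c) (tens A C b e) = tens A C (lmult mA a b) (mC c e)"
  by (simp add: lmult_def M_tens)

lemma commutator_tens:
  assumes "a \<in> carr A" "c \<in> carr C" "b \<in> carr A" "e \<in> carr C"
  shows "(lmult M (tens A C a c) - rmult M (tens A C a c)) (tens A C b e) =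
    tens A C ((lmult mA a - rmult mA a) b) (mC c e)"
proof -
  \<comment> \<open>Compatibility with differences is obtained from additivity, applied to (ab - ba)
    + ba.\<close>
  have "tens A C (mA a b - mA b a + mA b a) (mC c e) =
      tens A C (mA a b - mA b a) (mC c e) + tens A C (mA b a) (mC c e)"
    using assms by (intro tens_add_left space_diff[OF A_space] mA_in mC_in)
  then show ?thesis
    using rmult_tens[OF assms] lmult_tens[OF assms]
    by (simp only: minus_apply rmult_def lmult_def) (simp add: algebra_simps)
qed

lemma skew_tens:
  "a \<in> carr A \<Longrightarrow> c \<in> carr C \<Longrightarrow> skew (tens A C a c) = bul (\<Delta> a - tensor_flip A A (\<Delta> a)) (D c)"
  by (simp add: skew_def hat_tens cflip_bullet \<Delta>_in bullet_diff)

text \<open>Each of the four sums factors into an operation on A and multiplication of one leg of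
  \<open>D c1\<close> by c2, or of \<open>D c2\<close> by c1. The second leg or the first makes no
  difference to the C-part, so the A-parts add up to \<open>defect1 a1 a2\<close>.\<close>

lemma compat1_tens:
  assumes a1: "a1 \<in> carr A" and c1: "c1 \<in> carr C" and a2: "a2 \<in> carr A" and c2: "c2 \<in> carr C"
  shows "compat1 (tens A C a1 c1) (tens A C a2 c2) (bul (defect1 a1 a2) (D (mC c1 c2)))"
proof -
  note x1 = tens_in[OF a1 c1] and x2 = tens_in[OF a2 c2]
  let ?e = "\<Delta> a1 - tensor_flip A A (\<Delta> a1)"
  have e: "?e \<in> carr (tensor_space A A)"
    by (intro space_diff is_space_tensor_space \<Delta>_in tensor_flip_in a1)
  note c12 = mC_in[OF c1 c2]
  note right = D_cmap_sums_right[folded id_def] and left = D_cmap_sums_left[folded id_def]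
  have 1: "cmap_sums T H id (rmult M (tens A C a2 c2)) (skew (tens A C a1 c1))
      (bul (tensor_map A A id (rmult mA a2) ?e) (D (mC c1 c2)))"
    unfolding skew_tens[OF a1 c1]
    by (rule cmap_sums_bullet[OF e D_in[OF c1] D_in[OF c12] id_linear rmult_T_linear[OF x2]
          id_linear rmult_A_linear[OF a2] id_linear mC_linear[OF c2] _ _ right[OF c1 c2]])
      (simp_all add: rmult_tens a2 c2)
  have 2: "cmap_sums T H (lmult M (tens A C a2 c2) - rmult M (tens A C a2 c2)) id (skew (tens A C a1 c1))
      (bul (tensor_map A A (lmult mA a2 - rmult mA a2) id ?e) (D (mC c1 c2)))"
    unfolding skew_tens[OF a1 c1]
    by (rule cmap_sums_bullet[OF e D_in[OF c1] D_in[OF c12] commutator_T_linear[OF x2] id_linear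
          commutator_A_linear[OF a2] id_linear mC_linear[OF c2] id_linear _ _ left[OF c1 c2]])
      (simp_all only: commutator_tens[OF a2 c2] id_apply)
  have 3: "cmap_sums T H id (lmult M (tens A C a1 c1)) (hat (tens A C a2 c2))
      (bul (tensor_map A A id (lmult mA a1) (\<Delta> a2)) (D (mC c1 c2)))"
    \<comment> \<open>Here c1 multiplies a leg of \<open>D c2\<close>, which produces the coproduct
      of c2 c1; commutativity matches it with the terms built from \<open>D c1\<close>.\<close>
    unfolding hat_tens[OF a2 c2] mC_comm[OF c1 c2]
    by (rule cmap_sums_bullet[OF \<Delta>_in[OF a2] D_in[OF c2] D_in[OF mC_in[OF c2 c1]] id_linear
          lmult_T_linear[OF x1] id_linear lmult_A_linear[OF a1] id_linear mC_linear[OF c1] _ _ right[OF c2 c1]])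
      (simp_all add: lmult_tens a1 c1)
  have 4: "cmap_sums T H (lmult M (tens A C a1 c1)) id (hat (tens A C a2 c2))
      (bul (tensor_map A A (lmult mA a1) id (\<Delta> a2)) (D (mC c1 c2)))"
    unfolding hat_tens[OF a2 c2] mC_comm[OF c1 c2]
    by (rule cmap_sums_bullet[OF \<Delta>_in[OF a2] D_in[OF c2] D_in[OF mC_in[OF c2 c1]] lmult_T_linear[OF x1]
          id_linear lmult_A_linear[OF a1] id_linear mC_linear[OF c1] id_linear _ _ left[OF c2 c1]])
      (simp_all add: lmult_tens a1 c1)
  have "hat (M (tens A C a1 c1) (tens A C a2 c2)) +
      (bul (tensor_map A A id (rmult mA a2) ?e) (D (mC c1 c2)) +
       bul (tensor_map A A (lmult mA a2 - rmult mA a2) id ?e) (D (mC c1 c2))) +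
      (bul (tensor_map A A id (lmult mA a1) (\<Delta> a2)) (D (mC c1 c2)) +
       bul (tensor_map A A (lmult mA a1) id (\<Delta> a2)) (D (mC c1 c2))) =
      bul (defect1 a1 a2) (D (mC c1 c2))"
    by (simp add: M_tens assms hat_tens mA_in c12 defect1_def Let_def bullet_add)
  with 1 2 3 4 show ?thesis unfolding compat1_def by blast
qed

lemma compat2_tens:
  assumes a1: "a1 \<in> carr A" and c1: "c1 \<in> carr C" and a2: "a2 \<in> carr A" and c2: "c2 \<in> carr C"
  shows "compat2 (tens A C a1 c1) (tens A C a2 c2) (bul (defect2 a1 a2) (D (mC c1 c2)))"
proof -
  note x1 = tens_in[OF a1 c1] and x2 = tens_in[OF a2 c2]
  note c12 = mC_in[OF c1 c2]
  note left = D_cmap_sums_left[folded id_def]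
  have 1: "cmap_sums T H (rmult M (tens A C a1 c1)) id (hat (tens A C a2 c2))
      (bul (tensor_map A A (rmult mA a1) id (\<Delta> a2)) (D (mC c1 c2)))"
    unfolding hat_tens[OF a2 c2] mC_comm[OF c1 c2]
    by (rule cmap_sums_bullet[OF \<Delta>_in[OF a2] D_in[OF c2] D_in[OF mC_in[OF c2 c1]] rmult_T_linear[OF x1]
          id_linear rmult_A_linear[OF a1] id_linear mC_linear[OF c1] id_linear _ _ left[OF c2 c1]])
      (simp_all add: rmult_tens a1 c1)
  have 2: "cmap_sums T H (rmult M (tens A C a2 c2)) id (hat (tens A C a1 c1))
      (bul (tensor_map A A (rmult mA a2) id (\<Delta> a1)) (D (mC c1 c2)))"
    unfolding hat_tens[OF a1 c1]
    by (rule cmap_sums_bullet[OF \<Delta>_in[OF a1] D_in[OF c1] D_in[OF c12] rmult_T_linear[OF x2]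
          id_linear rmult_A_linear[OF a2] id_linear mC_linear[OF c2] id_linear _ _ left[OF c1 c2]])
      (simp_all add: rmult_tens a2 c2)
  have "bul (tensor_map A A (rmult mA a1) id (\<Delta> a2)) (D (mC c1 c2)) -
      cflip T H (bul (tensor_map A A (rmult mA a2) id (\<Delta> a1)) (D (mC c1 c2))) =
      bul (defect2 a1 a2) (D (mC c1 c2))"
    using tensor_map_in[OF \<Delta>_in[OF a1] rmult_A_linear[OF a2] id_linear]
    by (simp add: cflip_bullet c12 defect2_def bullet_diff)
  with 1 2 show ?thesis unfolding compat2_def by blast
qed

section \<open>Extending the compatibility conditions to all tensors\<close>

lemma cflip_add: "cflip T H (X + X') = cflip T H X + cflip T H X'"
  by (simp add: cflip_def tensor_flip_def lift_def fun_eq_iff plus_fun_apply)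

lemma skew_add: "skew (x + y) = skew x + skew y"
  by (simp add: skew_def hat_add cflip_add)

lemma skew_in: "x \<in> carr T \<Longrightarrow> skew x i j \<in> carr (tensor_space (Tp i) (Tp j))"
  using space_diff[OF is_space_tensor_space hat_in tensor_flip_in[OF hat_in]]
  by (simp add: skew_def cflip_def)

text \<open>The first two sums are additive through the tensor \<open>skew x\<close>, the last two
  through the map \<open>lmult M x\<close>. Both kinds of additivity rest on the recorded
  supports.\<close>

lemma compat1_add_left:
  assumes "compat1 x y W" "compat1 x' y W'" and x: "x \<in> carr T" "x' \<in> carr T" and y: "y \<in> carr T"
  shows "compat1 (x + x') y (W + W')"
proof -
  from assms obtain Y1 Y2 Y3 Y4 where Y:
    "cmap_sums T H id (rmult M y) (skew x) Y1"
    "cmap_sums T H (lmult M y - rmult M y) id (skew x) Y2"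
    "cmap_sums T H id (lmult M x) (hat y) Y3"
    "cmap_sums T H (lmult M x) id (hat y) Y4"
    "hat (M x y) + (Y1 + Y2) + (Y3 + Y4) = W" unfolding compat1_def by blast
  from assms obtain Z1 Z2 Z3 Z4 where Z:
    "cmap_sums T H id (rmult M y) (skew x') Z1"
    "cmap_sums T H (lmult M y - rmult M y) id (skew x') Z2"
    "cmap_sums T H id (lmult M x') (hat y) Z3"
    "cmap_sums T H (lmult M x') id (hat y) Z4"
    "hat (M x' y) + (Z1 + Z2) + (Z3 + Z4) = W'" unfolding compat1_def by blast
  have k: "lmult M (x + x') u = lmult M x u + lmult M x' u" if "u \<in> carr T" for u
    using M_add_left[OF that x] by (simp add: lmult_def)
  note lin = lmult_T_linear[OF x(1)] lmult_T_linear[OF x(2)]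
  have "cmap_sums T H id (rmult M y) (skew (x + x')) (Y1 + Z1)"
    unfolding skew_add by (rule cmap_sums_add[OF T_graded Y(1) Z(1)])
  moreover have "cmap_sums T H (lmult M y - rmult M y) id (skew (x + x')) (Y2 + Z2)"
    unfolding skew_add by (rule cmap_sums_add[OF T_graded Y(2) Z(2)])
  moreover have "cmap_sums T H id (lmult M (x + x')) (hat y) (Y3 + Z3)"
    by (rule cmap_sums_add_right[OF T_graded Y(3) Z(3) hat_in[OF y] lin id_linear k])
  moreover have "cmap_sums T H (lmult M (x + x')) id (hat y) (Y4 + Z4)"
    by (rule cmap_sums_add_left[OF T_graded Y(4) Z(4) hat_in[OF y] lin id_linear k])
  moreover have "hat (M (x + x') y) + ((Y1 + Z1) + (Y2 + Z2)) + ((Y3 + Z3) + (Y4 + Z4)) = W + W'"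
    using M_add_left[OF y x] by (simp add: hat_add ac_simps flip: Y(5) Z(5))
  ultimately show ?thesis unfolding compat1_def by blast
qed

text \<open>The roles are exchanged: y enters the first two sums through the maps and the last two
  through the tensor \<open>hat y\<close>.\<close>

lemma compat1_add_right:
  assumes "compat1 x y W" "compat1 x y' W'" and x: "x \<in> carr T" and y: "y \<in> carr T" "y' \<in> carr T"
  shows "compat1 x (y + y') (W + W')"
proof -
  from assms obtain Y1 Y2 Y3 Y4 where Y:
    "cmap_sums T H id (rmult M y) (skew x) Y1"
    "cmap_sums T H (lmult M y - rmult M y) id (skew x) Y2"
    "cmap_sums T H id (lmult M x) (hat y) Y3"
    "cmap_sums T H (lmult M x) id (hat y) Y4"
    "hat (M x y) + (Y1 + Y2) + (Y3 + Y4) = W" unfolding compat1_def by blast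
  from assms obtain Z1 Z2 Z3 Z4 where Z:
    "cmap_sums T H id (rmult M y') (skew x) Z1"
    "cmap_sums T H (lmult M y' - rmult M y') id (skew x) Z2"
    "cmap_sums T H id (lmult M x) (hat y') Z3"
    "cmap_sums T H (lmult M x) id (hat y') Z4"
    "hat (M x y') + (Z1 + Z2) + (Z3 + Z4) = W'" unfolding compat1_def by blast
  have r: "rmult M (y + y') u = rmult M y u + rmult M y' u" if "u \<in> carr T" for u
    using M_add_right[OF that y] by (simp add: rmult_def)
  have l: "lmult M (y + y') u = lmult M y u + lmult M y' u" if "u \<in> carr T" for u
    using M_add_left[OF that y] by (simp add: lmult_def)
  have k: "(lmult M (y + y') - rmult M (y + y')) u =
      (lmult M y - rmult M y) u + (lmult M y' - rmult M y') u" if "u \<in> carr T" for u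
    by (simp add: minus_apply[of "lmult M _"] r[OF that] l[OF that])
  have "cmap_sums T H id (rmult M (y + y')) (skew x) (Y1 + Z1)"
    by (rule cmap_sums_add_right[OF T_graded Y(1) Z(1) skew_in[OF x] rmult_T_linear[OF y(1)]
          rmult_T_linear[OF y(2)] id_linear r])
  moreover have "cmap_sums T H (lmult M (y + y') - rmult M (y + y')) id (skew x) (Y2 + Z2)"
    by (rule cmap_sums_add_left[OF T_graded Y(2) Z(2) skew_in[OF x] commutator_T_linear[OF y(1)]
          commutator_T_linear[OF y(2)] id_linear k])
  moreover have "cmap_sums T H id (lmult M x) (hat (y + y')) (Y3 + Z3)"
    unfolding hat_add by (rule cmap_sums_add[OF T_graded Y(3) Z(3)])
  moreover have "cmap_sums T H (lmult M x) id (hat (y + y')) (Y4 + Z4)"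
    unfolding hat_add by (rule cmap_sums_add[OF T_graded Y(4) Z(4)])
  moreover have "hat (M x (y + y')) + ((Y1 + Z1) + (Y2 + Z2)) + ((Y3 + Z3) + (Y4 + Z4)) = W + W'"
    using M_add_right[OF x y] by (simp add: hat_add ac_simps flip: Y(5) Z(5))
  ultimately show ?thesis unfolding compat1_def by blast
qed

lemma compat2_add_left:
  assumes "compat2 x y W" "compat2 x' y W'" and x: "x \<in> carr T" "x' \<in> carr T" and y: "y \<in> carr T"
  shows "compat2 (x + x') y (W + W')"
proof -
  from assms obtain Y1 Y2 where Y: "cmap_sums T H (rmult M x) id (hat y) Y1"
    "cmap_sums T H (rmult M y) id (hat x) Y2" "Y1 - cflip T H Y2 = W" unfolding compat2_def by blast
  from assms obtain Z1 Z2 where Z: "cmap_sums T H (rmult M x') id (hat y) Z1"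
    "cmap_sums T H (rmult M y) id (hat x') Z2" "Z1 - cflip T H Z2 = W'" unfolding compat2_def by blast
  have r: "rmult M (x + x') u = rmult M x u + rmult M x' u" if "u \<in> carr T" for u
    using M_add_right[OF that x] by (simp add: rmult_def)
  have "cmap_sums T H (rmult M (x + x')) id (hat y) (Y1 + Z1)"
    by (rule cmap_sums_add_left[OF T_graded Y(1) Z(1) hat_in[OF y] rmult_T_linear[OF x(1)]
          rmult_T_linear[OF x(2)] id_linear r])
  moreover have "cmap_sums T H (rmult M y) id (hat (x + x')) (Y2 + Z2)"
    unfolding hat_add by (rule cmap_sums_add[OF T_graded Y(2) Z(2)])
  moreover have "(Y1 + Z1) - cflip T H (Y2 + Z2) = W + W'"
    by (simp add: cflip_add flip: Y(3) Z(3))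
  ultimately show ?thesis unfolding compat2_def by blast
qed

lemma compat2_add_right:
  assumes "compat2 x y W" "compat2 x y' W'" and x: "x \<in> carr T" and y: "y \<in> carr T" "y' \<in> carr T"
  shows "compat2 x (y + y') (W + W')"
proof -
  from assms obtain Y1 Y2 where Y: "cmap_sums T H (rmult M x) id (hat y) Y1"
    "cmap_sums T H (rmult M y) id (hat x) Y2" "Y1 - cflip T H Y2 = W" unfolding compat2_def by blast
  from assms obtain Z1 Z2 where Z: "cmap_sums T H (rmult M x) id (hat y') Z1"
    "cmap_sums T H (rmult M y') id (hat x) Z2" "Z1 - cflip T H Z2 = W'" unfolding compat2_def by blast
  have r: "rmult M (y + y') u = rmult M y u + rmult M y' u" if "u \<in> carr T" for u
    using M_add_right[OF that y] by (simp add: rmult_def)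
  have "cmap_sums T H (rmult M x) id (hat (y + y')) (Y1 + Z1)"
    unfolding hat_add by (rule cmap_sums_add[OF T_graded Y(1) Z(1)])
  moreover have "cmap_sums T H (rmult M (y + y')) id (hat x) (Y2 + Z2)"
    by (rule cmap_sums_add_left[OF T_graded Y(2) Z(2) hat_in[OF x] rmult_T_linear[OF y(1)]
          rmult_T_linear[OF y(2)] id_linear r])
  moreover have "(Y1 + Z1) - cflip T H (Y2 + Z2) = W + W'"
    by (simp add: cflip_add flip: Y(3) Z(3))
  ultimately show ?thesis unfolding compat2_def by blast
qed

lemma compat_all:
  assumes A: "\<And>a1 a2. a1 \<in> carr A \<Longrightarrow> a2 \<in> carr A \<Longrightarrow> defect1 a1 a2 = 0 \<and> defect2 a1 a2 = 0"
    and x: "x \<in> carr T" and y: "y \<in> carr T"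
  shows "compat1 x y 0 \<and> compat2 x y 0"
  using x
proof (induction rule: T_induct)
  case (tens a1 c1)
  note pure = tens_in[OF tens]
  show ?case
    using y
  proof (induction rule: T_induct)
    case (tens a2 c2)
    show ?case
      using compat1_tens[OF \<open>a1 \<in> carr A\<close> \<open>c1 \<in> carr C\<close> tens]
        compat2_tens[OF \<open>a1 \<in> carr A\<close> \<open>c1 \<in> carr C\<close> tens] A[OF \<open>a1 \<in> carr A\<close> tens(1)]
      by (simp add: bullet_zero)
  next
    case (add y y')
    then show ?case
      using compat1_add_right[OF _ _ pure, of y 0 y' 0] compat2_add_right[OF _ _ pure, of y 0 y' 0]
      by simp
  qed
next
  case (add x x')
  then show ?case
    using compat1_add_left[OF _ _ _ _ y, of x 0 x' 0] compat2_add_left[OF _ _ _ _ y, of x 0 x' 0] by simp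
qed

text \<open>The linearity conditions are locale assumptions, so being a bialgebra is the vanishing
  of four expressions. Both directions of the equivalence use this form.\<close>

lemma anti_leibniz_bialgebra_defects:
  "anti_leibniz_bialgebra A mA \<Delta> \<longleftrightarrow>
    (\<forall>a1\<in>carr A. \<forall>a2\<in>carr A. \<forall>a3\<in>carr A.
       mA a1 (mA a2 a3) + mA (mA a1 a2) a3 + mA a2 (mA a1 a3) = 0) \<and>
    (\<forall>a\<in>carr A. co_defect a = 0) \<and>
    (\<forall>a1\<in>carr A. \<forall>a2\<in>carr A. defect1 a1 a2 = 0 \<and> defect2 a1 a2 = 0)"
  by (simp add: anti_leibniz_bialgebra_def anti_leibniz_algebra_def anti_leibniz_coalgebra_def
      A_space mA_bilinear \<Delta>_linear co_defect_def defect1_def defect2_def Let_def)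

theorem completed_bialgebra:
  assumes "fin_dim A" "anti_leibniz_bialgebra A mA \<Delta>"
  shows "completed_anti_leibniz_bialgebra T H M hat"
  unfolding completed_anti_leibniz_bialgebra_def
proof (intro conjI ballI T_graded_algebra[OF assms(1)])
  show "anti_leibniz_algebra T M"
    using assms(2) T_anti_leibniz by (simp add: anti_leibniz_bialgebra_def)
  show "completed_anti_leibniz_coalgebra T H hat"
    using assms(2) T_coalgebra by (simp add: anti_leibniz_bialgebra_def)
  fix x y assume "x \<in> carr T" "y \<in> carr T"
  then have c: "compat1 x y 0" "compat2 x y 0"
    using compat_all assms(2) by (auto simp: anti_leibniz_bialgebra_defects)
  show "let e = hat x - cflip T H (hat x) in
      hat (M x y) +
      (cmap T H id (rmult M y) e + cmap T H (lmult M y - rmult M y) id e) +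
      (cmap T H id (lmult M x) (hat y) + cmap T H (lmult M x) id (hat y)) = 0"
    using compat1D[OF c(1)] by (simp add: Let_def)
  show "cmap T H (rmult M x) id (hat y) - cflip T H (cmap T H (rmult M y) id (hat x)) = 0"
    by (rule compat2D[OF c(2)])
qed

end

section \<open>Membership of the defects\<close>

context tensor_coalgebra
begin

text \<open>The injectivity lemmas for the converse apply only to elements of the tensor products of
  A, not to arbitrary functionals.\<close>

lemma defect1_in:
  assumes "a1 \<in> carr A" "a2 \<in> carr A"
  shows "defect1 a1 a2 \<in> carr (tensor_space A A)"
  unfolding defect1_def Let_def
  by (intro space_add[OF is_space_tensor_space] \<Delta>_in mA_in tensor_map_in[where P = A and Q = A] id_linear rmult_A_linear
      lmult_A_linear commutator_A_linear space_diff[OF is_space_tensor_space] tensor_flip_in assms)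

lemma defect2_in:
  assumes "a1 \<in> carr A" "a2 \<in> carr A"
  shows "defect2 a1 a2 \<in> carr (tensor_space A A)"
  unfolding defect2_def
  by (intro \<Delta>_in tensor_map_in[where P = A and Q = A] id_linear rmult_A_linear
      space_diff[OF is_space_tensor_space] tensor_flip_in assms)

lemma co_defect_in:
  assumes "a \<in> carr A"
  shows "co_defect a \<in> carr (tensor3_space A A A)"
  unfolding co_defect_def
  by (intro space_add[OF is_space_tensor3_space] flip_left_in cop_left_in[where P = A] cop_right_in[where P = A] \<Delta>_in \<Delta>_linear A_space assms)

end

section \<open>Laurent polynomials\<close>

text \<open>The degree parameter is 0 because t^i and t^j pair to zero unless i + j = 0. The
  coproduct is known only through its defining pairing, which suffices below.\<close>

locale laurent_coalgebra = tensor_coalgebra laurent laurent_grading "(*)" laurent_form D 0 A mA \<Delta>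
  for D :: "(int \<Rightarrow>\<^sub>0 'k::field) \<Rightarrow> ('k, int \<Rightarrow>\<^sub>0 'k, int \<Rightarrow>\<^sub>0 'k) ctensor"
    and A :: "('k, 'a::ab_group_add) space" and mA \<Delta>
begin

lemma one_in: "(1 :: int \<Rightarrow>\<^sub>0 'k) \<in> laurent_grading 0" "(1 :: int \<Rightarrow>\<^sub>0 'k) \<in> carr laurent"
  by (auto simp: laurent_grading_def laurent_def image_iff intro!: exI[of _ 1])

text \<open>The constant coefficient is the pairing with 1. This turns constant terms of the legs of
  the coproduct into pairings of the kind already computed.\<close>

lemma lookup_form: "Poly_Mapping.lookup p 0 = laurent_form p 1"
  by (simp add: laurent_form_mult)

lemma constant_term_bilinear: "bilinear_map A laurent A (\<lambda>a p. scl A (Poly_Mapping.lookup p 0) a)"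
proof -
  interpret vector_space "scl A" using A_space by (simp add: is_space_def)
  show ?thesis
    using space_scale[OF A_space]
    by (auto simp: bilinear_map_def linear_map_def laurent_def lookup_add lookup_laurent_scale
        scale_left_distrib scale_right_distrib mult.commute)
qed

text \<open>The target A is an arbitrary vector space, whereas \<open>lift\<close> only maps into
  spaces of scalar functions; the map therefore comes from the universal property of the tensor
  product.\<close>

lemma constant_term_map:
  obtains \<kappa> where "linear_map T A \<kappa>"
    "\<And>a p. a \<in> carr A \<Longrightarrow> \<kappa> (tens A laurent a p) = scl A (Poly_Mapping.lookup p 0) a"
  using tensor_universal[OF A_space constant_term_bilinear] by (auto simp: laurent_def)

lemma scale_one: "scl A 1 a = a"
proof -
  interpret vector_space "scl A" using A_space by (simp add: is_space_def)
  show ?thesis by simp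
qed

lemma tens_one_injective:
  assumes "a \<in> carr A" "tens A laurent a 1 = 0"
  shows "a = 0"
proof -
  obtain \<kappa> where \<kappa>: "linear_map T A \<kappa>"
    "\<And>a p. a \<in> carr A \<Longrightarrow> \<kappa> (tens A laurent a p) = scl A (Poly_Mapping.lookup p 0) a"
    by (rule constant_term_map, rule that, assumption+)
  show ?thesis
    using \<kappa>(2)[OF assms(1), of 1] assms(2) linear_map_zero[OF \<kappa>(1) T_space]
    by (simp add: lookup_one scale_one)
qed

text \<open>A bilinear form on A pulls back along the constant-term map to the degree 0 piece of A
  \<otimes> C. Evaluating the (0, 0) component of the bullet product on it returns
  \<open>t \<beta>\<close>, so all values of \<open>t\<close> are recovered.\<close>

lemma bullet_one_injective:
  assumes t: "t \<in> carr (tensor_space A A)" and z: "bul t (D 1) = 0"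
  shows "t = 0"
proof
  fix \<beta> :: "'a \<Rightarrow> 'a \<Rightarrow> 'k"
  obtain \<kappa> where \<kappa>: "linear_map T A \<kappa>"
    "\<And>a p. a \<in> carr A \<Longrightarrow> \<kappa> (tens A laurent a p) = scl A (Poly_Mapping.lookup p 0) a"
    by (rule constant_term_map, rule that, assumption+)
  show "t \<beta> = 0 \<beta>"
  proof (cases "bilinear_map A A scalars \<beta>")
    case False
    with t show ?thesis by (elim tensor_formE) (simp add: zero_fun_apply)
  next
    case True
    have \<kappa>0: "linear_map (Tp 0) A \<kappa>" by (rule linear_map_sub[OF \<kappa>(1)]) (use H_le in auto)
    have B: "bilinear_map (Tp 0) (Tp 0) scalars (\<lambda>x y. \<beta> (\<kappa> x) (\<kappa> y))"
      by (intro bilinear_mapI linear_map_compose[OF bilinear_mapD1[OF True] \<kappa>0]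
          linear_map_compose[OF bilinear_mapD2[OF True] \<kappa>0] linear_map_in[OF \<kappa>0])
    have inner: "D 1 0 0 (\<lambda>c1 c2. \<beta> (\<kappa> (tens A laurent a1 c1)) (\<kappa> (tens A laurent a2 c2))) = \<beta> a1 a2"
      if a: "a1 \<in> carr A" "a2 \<in> carr A" for a1 a2
    proof -
      \<comment> \<open>Bilinearity extracts the two constant coefficients as scalars. Being
        pairings with 1, they contract against \<open>D 1\<close> to \<omega>(1, 1), which equals
        1.\<close>
      have "\<beta> (scl A k a1) (scl A l a2) = \<beta> a1 a2 * (k * l)" for k l
        using linear_map_scale[OF bilinear_mapD1[OF True space_scale[OF A_space a(2)]] a(1)]
          linear_map_scale[OF bilinear_mapD2[OF True a(1)] a(2)] by (simp add: algebra_simps)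
      then have "D 1 0 0 (\<lambda>c1 c2. \<beta> (\<kappa> (tens A laurent a1 c1)) (\<kappa> (tens A laurent a2 c2))) =
          D 1 0 0 (\<lambda>c1 c2. \<beta> a1 a2 * (laurent_form c1 1 * laurent_form c2 1))"
        by (simp add: \<kappa>(2) a lookup_form)
      also have "\<dots> = \<beta> a1 a2 * laurent_form 1 (1 * 1)"
        using tensor_form_mult[OF D_in[OF one_in(2)] form2_bilinear[OF one_in(2) one_in(2)]]
          D_pairing_homogeneous[OF one_in(2), of 1 0 1 0] one_in by simp
      finally show ?thesis by (simp add: laurent_form_mult lookup_one)
    qed
    have "0 = bul t (D 1) 0 0 (\<lambda>x y. \<beta> (\<kappa> x) (\<kappa> y))" using z by (simp add: zero_fun_apply)
    also have "\<dots> = t (\<lambda>a1 a2. D 1 0 0 (\<lambda>c1 c2. \<beta> (\<kappa> (tens A laurent a1 c1)) (\<kappa> (tens A laurent a2 c2))))"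
      by (rule bullet_form[OF B])
    also have "\<dots> = t \<beta>"
      by (rule tensor_cong[OF t A_space A_space]) (rule inner)
    finally show ?thesis by (simp add: zero_fun_apply)
  qed
qed

text \<open>The threefold version: the (0, 0, 0) component of the iterated coproduct of 1 pairs with
  1 in every leg to \<omega>(1, 1) = 1, so the constant-term map in each leg recovers
  \<open>t\<close>.\<close>

lemma bul3_one_injective:
  assumes t: "t \<in> carr (tensor3_space A A A)"
    and z: "bul3 0 0 0 t (ccop_left laurent laurent_grading D (D 1) 0 0 0) = 0"
  shows "t = 0"
proof
  fix \<gamma> :: "'a \<Rightarrow> 'a \<Rightarrow> 'a \<Rightarrow> 'k"
  obtain \<kappa> where \<kappa>: "linear_map T A \<kappa>"
    "\<And>a p. a \<in> carr A \<Longrightarrow> \<kappa> (tens A laurent a p) = scl A (Poly_Mapping.lookup p 0) a"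
    by (rule constant_term_map, rule that, assumption+)
  let ?S = "ccop_left laurent laurent_grading D (D 1) 0 0 0"
  show "t \<gamma> = 0 \<gamma>"
  proof (cases "trilinear_map A A A scalars \<gamma>")
    case False
    with t show ?thesis by (elim tensor_formE3) (simp add: zero_fun_apply)
  next
    case True
    have \<kappa>0: "linear_map (Tp 0) A \<kappa>" by (rule linear_map_sub[OF \<kappa>(1)]) (use H_le in auto)
    have B: "trilinear_map (Tp 0) (Tp 0) (Tp 0) scalars (\<lambda>x y z. \<gamma> (\<kappa> x) (\<kappa> y) (\<kappa> z))"
      by (intro trilinear_mapI linear_map_compose[OF trilinear_mapD1[OF True] \<kappa>0]
          linear_map_compose[OF trilinear_mapD2[OF True] \<kappa>0]
          linear_map_compose[OF trilinear_mapD3[OF True] \<kappa>0] linear_map_in[OF \<kappa>0])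
    have inner: "?S (\<lambda>c1 c2 c3. \<gamma> (\<kappa> (tens A laurent a1 c1)) (\<kappa> (tens A laurent a2 c2))
        (\<kappa> (tens A laurent a3 c3))) = \<gamma> a1 a2 a3"
      if a: "a1 \<in> carr A" "a2 \<in> carr A" "a3 \<in> carr A" for a1 a2 a3
    proof -
      note sc = space_scale[OF A_space]
      have "\<gamma> (scl A k a1) (scl A l a2) (scl A m a3) = \<gamma> a1 a2 a3 * (k * l * m)" for k l m
        using linear_map_scale[OF trilinear_mapD1[OF True sc[OF a(2)] sc[OF a(3)]] a(1)]
          linear_map_scale[OF trilinear_mapD2[OF True a(1) sc[OF a(3)]] a(2)]
          linear_map_scale[OF trilinear_mapD3[OF True a(1) a(2)] a(3)] by (simp add: algebra_simps)
      then have "?S (\<lambda>c1 c2 c3. \<gamma> (\<kappa> (tens A laurent a1 c1)) (\<kappa> (tens A laurent a2 c2))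
          (\<kappa> (tens A laurent a3 c3))) =
          ?S (\<lambda>c1 c2 c3. \<gamma> a1 a2 a3 * (laurent_form c1 1 * laurent_form c2 1 * laurent_form c3 1))"
        by (simp add: \<kappa>(2) a lookup_form)
      \<comment> \<open>Pulling out the scalar is the case of a linear combination with a
        one-element index set.\<close>
      also have "\<dots> = \<gamma> a1 a2 a3 * ?S (\<lambda>c1 c2 c3. laurent_form c1 1 * laurent_form c2 1 * laurent_form c3 1)"
        using tensor3_form_lincomb[OF ccop_left_in[OF one_in(2)]
            form3_trilinear[OF one_in(2) one_in(2) one_in(2)], where K = "{()}"] by simp
      also have "\<dots> = \<gamma> a1 a2 a3 * laurent_form 1 (1 * 1 * 1)"
        using ccop_left_pairing[OF one_in(2), of 1 0 1 0 1 0] one_in by simp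
      finally show ?thesis by (simp add: laurent_form_mult lookup_one)
    qed
    have "0 = bul3 0 0 0 t ?S (\<lambda>x y z. \<gamma> (\<kappa> x) (\<kappa> y) (\<kappa> z))" using z by (simp add: zero_fun_apply)
    also have "\<dots> = t (\<lambda>a1 a2 a3. ?S (\<lambda>c1 c2 c3. \<gamma> (\<kappa> (tens A laurent a1 c1)) (\<kappa> (tens A laurent a2 c2))
          (\<kappa> (tens A laurent a3 c3))))"
      by (simp add: bul3_eval tens3_form[OF B])
    also have "\<dots> = t \<gamma>"
      by (rule tensor3_cong[OF t A_space A_space A_space]) (rule inner)
    finally show ?thesis by (simp add: zero_fun_apply)
  qed
qed

text \<open>On elements a \<otimes> 1 the axioms become defects of A combined with 1, with
  \<open>D 1\<close> or with the iterated coproduct of 1. The three injectivity lemmas cancel these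
  factors.\<close>

lemma bialgebra_of_completed:
  assumes "completed_anti_leibniz_bialgebra T H M hat"
  shows "anti_leibniz_bialgebra A mA \<Delta>"
  unfolding anti_leibniz_bialgebra_defects
proof (intro conjI ballI)
  fix a1 a2 a3 assume a: "a1 \<in> carr A" "a2 \<in> carr A" "a3 \<in> carr A"
  let ?x = "\<lambda>a. tens A laurent a 1"
  have "M (?x a1) (M (?x a2) (?x a3)) + M (M (?x a1) (?x a2)) (?x a3) + M (?x a2) (M (?x a1) (?x a3)) = 0"
    using assms a one_in(2)
    by (simp add: completed_anti_leibniz_bialgebra_def anti_leibniz_algebra_def tens_in)
  then have "tens A laurent (mA a1 (mA a2 a3) + mA (mA a1 a2) a3 + mA a2 (mA a1 a3)) 1 = 0"
    using M_anti_leibniz_tens[OF a one_in(2) one_in(2) one_in(2)] by simp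
  then show "mA a1 (mA a2 a3) + mA (mA a1 a2) a3 + mA a2 (mA a1 a3) = 0"
    by (intro tens_one_injective space_add[OF A_space] mA_in a)
next
  fix a assume a: "a \<in> carr A"
  have "(\<lambda>p q r. bul3 p q r (co_defect a) (ccop_left laurent laurent_grading D (D 1) p q r)) = 0"
    using assms tens_in[OF a one_in(2)] ccop_hat_defect[OF a one_in(2)]
    by (simp add: completed_anti_leibniz_bialgebra_def completed_anti_leibniz_coalgebra_def)
  \<comment> \<open>A single component suffices, the one in which the constant terms live.\<close>
  from fun_cong[OF fun_cong[OF fun_cong[OF this]], of 0 0 0]
  have "bul3 0 0 0 (co_defect a) (ccop_left laurent laurent_grading D (D 1) 0 0 0) = 0"
    by (simp only: zero_fun_apply)
  then show "co_defect a = 0" by (rule bul3_one_injective[OF co_defect_in[OF a]])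
next
  fix a1 a2 assume a: "a1 \<in> carr A" "a2 \<in> carr A"
  note x = tens_in[OF a(1) one_in(2)] tens_in[OF a(2) one_in(2)]
  note compat = conjunct2[OF conjunct2[OF conjunct2[OF
    assms[unfolded completed_anti_leibniz_bialgebra_def]]], THEN bspec, OF x(1), THEN bspec, OF x(2)]
  \<comment> \<open>The computation on pure tensors evaluates exactly the expressions that the
    hypothesis declares to be 0.\<close>
  have "bul (defect1 a1 a2) (D (1 * 1)) = 0" "bul (defect2 a1 a2) (D (1 * 1)) = 0"
    using compat compat1D[OF compat1_tens[OF a(1) one_in(2) a(2) one_in(2)]]
      compat2D[OF compat2_tens[OF a(1) one_in(2) a(2) one_in(2)]]
    by (simp_all only: Let_def)
  then show "defect1 a1 a2 = 0" "defect2 a1 a2 = 0"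
    using bullet_one_injective defect1_in[OF a] defect2_in[OF a] by simp_all
qed

end

lemma laurent_form_degree:
  fixes x y :: "int \<Rightarrow>\<^sub>0 'k::field"
  assumes "i + j + 0 \<noteq> 0" "x \<in> laurent_grading i" "y \<in> laurent_grading j"
  shows "laurent_form x y = 0"
  using assms by (auto simp: laurent_grading_def laurent_form_mult mult_single lookup_single)

theorem theorem4p11:
  fixes A :: "('k::field_char_0, 'a::ab_group_add) space"
    and mA :: "'a \<Rightarrow> 'a \<Rightarrow> 'a"
    and \<Delta> :: "'a \<Rightarrow> ('k, 'a, 'a) tensor"
    and C :: "('k, 'c::ab_group_add) space"
    and G :: "int \<Rightarrow> 'c set"
    and mC :: "'c \<Rightarrow> 'c \<Rightarrow> 'c"
    and \<omega> :: "'c \<Rightarrow> 'c \<Rightarrow> 'k"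
    and D :: "'c \<Rightarrow> ('k, 'c, 'c) ctensor"
    and D\<^sub>L :: "(int \<Rightarrow>\<^sub>0 'k) \<Rightarrow> ('k, int \<Rightarrow>\<^sub>0 'k, int \<Rightarrow>\<^sub>0 'k) ctensor"
  shows
    "(fin_dim A \<and> anti_leibniz_bialgebra A mA \<Delta> \<and>
      quadratic_graded_comm_algebra C G mC \<omega> \<and> bar_coproduct C G mC \<omega> D \<longrightarrow>
        completed_anti_leibniz_bialgebra (tensor_space A C) (tensor_grading A C G)
          (tensor_mult A mA C mC) (hat_coproduct A \<Delta> C G D)) \<and>
     (is_space A \<and> fin_dim A \<and> bilinear_map A A A mA \<and> linear_map A (tensor_space A A) \<Delta> \<and>
      bar_coproduct laurent laurent_grading (*) laurent_form D\<^sub>L \<longrightarrow>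
        (completed_anti_leibniz_bialgebra
           (tensor_space A laurent) (tensor_grading A laurent laurent_grading)
           (tensor_mult A mA laurent (*)) (hat_coproduct A \<Delta> laurent laurent_grading D\<^sub>L)
         \<longleftrightarrow> anti_leibniz_bialgebra A mA \<Delta>))"
proof (intro conjI impI)
  assume a: "fin_dim A \<and> anti_leibniz_bialgebra A mA \<Delta> \<and>
      quadratic_graded_comm_algebra C G mC \<omega> \<and> bar_coproduct C G mC \<omega> D"
  then have "\<exists>d. \<forall>i j. i + j + d \<noteq> 0 \<longrightarrow> (\<forall>x\<in>G i. \<forall>y\<in>G j. \<omega> x y = 0)"
    by (simp add: quadratic_graded_comm_algebra_def)
  \<comment> \<open>The locale takes the degree of the form as a parameter, so a witness is fixed
    before interpreting it.\<close>
  then obtain d where "\<forall>i j. i + j + d \<noteq> 0 \<longrightarrow> (\<forall>x\<in>G i. \<forall>y\<in>G j. \<omega> x y = 0)" ..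
  then interpret tensor_coalgebra C G mC \<omega> D d A mA \<Delta>
    using a by unfold_locales
      (auto simp: anti_leibniz_bialgebra_def anti_leibniz_algebra_def anti_leibniz_coalgebra_def)
  show "completed_anti_leibniz_bialgebra (tensor_space A C) (tensor_grading A C G)
          (tensor_mult A mA C mC) (hat_coproduct A \<Delta> C G D)"
    using completed_bialgebra a by blast
next
  assume a: "is_space A \<and> fin_dim A \<and> bilinear_map A A A mA \<and> linear_map A (tensor_space A A) \<Delta> \<and>
      bar_coproduct laurent laurent_grading (*) laurent_form D\<^sub>L"
  interpret laurent_coalgebra "D\<^sub>L" A mA \<Delta>
    using a by unfold_locales (simp_all add: laurent_quadratic laurent_form_degree)
  show "completed_anti_leibniz_bialgebra
           (tensor_space A laurent) (tensor_grading A laurent laurent_grading)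
           (tensor_mult A mA laurent (*)) (hat_coproduct A \<Delta> laurent laurent_grading D\<^sub>L)
         \<longleftrightarrow> anti_leibniz_bialgebra A mA \<Delta>"
    using completed_bialgebra bialgebra_of_completed a by blast
qed

end
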